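(* Let $d>2$ be an integer and let $F:\mathbb{Z}^d\to\mathbb{R}$ be a $\mathbb{Z}^d$-symmetric function with $\hat F(0)=0$ for which there are $K_1,K_2>0$ and $\rho>\max\{\frac{d-8}{2},0\}$ such that for all $x\in\mathbb{Z}^d$ and $k\in\mathbb{T}^d$, $$|F(x)|\le \frac{K_1}{(\max\{|x|,1\})^{d+2+\rho}},\qquad \hat F(k)\ge K_2|k|^2 .$$ Let $g:\mathbb{Z}^d\to\mathbb{R}$ be $\mathbb{Z}^d$-symmetric and satisfy, for some $K_3>0$, $$|g(x)|\le\frac{K_3}{(\max\{|x|,1\})^{d+\min\{\rho,2\}}}\qquad(x\in\mathbb{Z}^d).$$ Let $\kappa_0=-\sum_{x\in\mathbb{Z}^d}|x|^2F(x)\in[2dK_2,\infty)$ and $a_d=\frac{d\,\Gamma(\frac{d-2}{2})}{2\pi^{d/2}}$. Then the solution $H$ to $F*H=g$ given by the Fourier integral $$H(x)=\int_{\mathbb{T}^d}\frac{\hat g(k)e^{-ik\cdot x}}{\hat F(k)}\frac{dk}{(2\pi)^d}\qquad(x\in\mathbb{Z}^d)$$ satisfies $$H(x)=\frac{a_d\sum_{y\in\mathbb{Z}^d}g(y)}{\kappa_0(\max\{|x|,1\})^{d-2}}+O\left(\frac{1}{(\max\{|x|,1\})^{d-2+s}}\right)\qquad(x\in\mathbb{Z}^d)$$ for any power $s$ which obeys $s<\min\{\rho,2\}$ if $2<d\le 8$, and $s<\min\{\rho-\frac{d-8}{2},2\}$ if $d>8$. The constant in the error term depends only on $d,K_1,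K_2,K_3,\rho,s$.
   Context: $|x|$ is the Euclidean norm. $\mathbb{T}^d=(\mathbb{R}/2\pi\mathbb{Z})^d$ is identified with $(-\pi,\pi]^d\subset\mathbb{R}^d$, and $|k|$ is the Euclidean norm under this identification. The Fourier transform of a summable $f:\mathbb{Z}^d\to\mathbb{R}$ is $\hat f(k)=\sum_{x\in\mathbb{Z}^d}f(x)e^{ik\cdot x}$. The convolution is $(f*g)(x)=\sum_{y\in\mathbb{Z}^d}f(y)g(x-y)$. A function on $\mathbb{Z}^d$ is $\mathbb{Z}^d$-symmetric if it is invariant under reflection in coordinate hyperplanes and rotation by $\pi/2$ (i.e., under permutations and sign changes of the coordinates). *)

theory Defs
  imports "HOL-Analysis.Analysis"
begin

text \<open>
  The lattice \<open>\<int>\<^sup>d\<close> is the type \<open>int ^ 'd\<close> with \<open>d = CARD('d)\<close>; \<open>rvec\<close> embeds it into \<open>\<real>\<^sup>d\<close>.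
\<close>

definition rvec :: "int ^ 'd \<Rightarrow> real ^ 'd" where
  "rvec x = (\<chi> i. real_of_int (x $ i))"

definition enorm :: "int ^ 'd::finite \<Rightarrow> real" where
  "enorm x = norm (rvec x)"

definition xnorm :: "int ^ 'd::finite \<Rightarrow> real" where
  "xnorm x = max (enorm x) 1"

definition lattice_symmetric :: "(int ^ 'd \<Rightarrow> real) \<Rightarrow> bool" where
  "lattice_symmetric f \<longleftrightarrow>
     (\<forall>p \<sigma> x. bij p \<longrightarrow> (\<forall>i. \<sigma> i \<in> {1, -1}) \<longrightarrow> f (\<chi> i. \<sigma> i * x $ p i) = f x)"

definition torus :: "(real ^ 'd) set" where
  "torus = {k. \<forall>i. - pi < k $ i \<and> k $ i \<le> pi}"

definition fourier :: "(int ^ 'd::finite \<Rightarrow> real) \<Rightarrow> real ^ 'd \<Rightarrow> complex" where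
  "fourier f k = (\<Sum>\<^sub>\<infinity>x. complex_of_real (f x) * exp (\<i> * complex_of_real (k \<bullet> rvec x)))"

definition conv :: "(int ^ 'd \<Rightarrow> complex) \<Rightarrow> (int ^ 'd \<Rightarrow> complex) \<Rightarrow> int ^ 'd \<Rightarrow> complex" where
  "conv f g x = (\<Sum>\<^sub>\<infinity>y. f y * g (x - y))"

text \<open>
  The integrand is \<open>0\<close> at \<open>k = 0\<close> when \<open>fourier F 0 = 0\<close>, by the convention \<open>z / 0 = 0\<close>;
  this is a null set.
\<close>
definition sol_integrand ::
  "(int ^ 'd::finite \<Rightarrow> real) \<Rightarrow> (int ^ 'd \<Rightarrow> real) \<Rightarrow> int ^ 'd \<Rightarrow> real ^ 'd \<Rightarrow> complex" where
  "sol_integrand F g x k =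
     fourier g k * exp (- \<i> * complex_of_real (k \<bullet> rvec x)) / fourier F k
       / complex_of_real ((2 * pi) ^ CARD('d))"

definition sol ::
  "(int ^ 'd::finite \<Rightarrow> real) \<Rightarrow> (int ^ 'd \<Rightarrow> real) \<Rightarrow> int ^ 'd \<Rightarrow> complex" where
  "sol F g x = (LINT k:torus|lborel. sol_integrand F g x k)"

definition kappa0 :: "(int ^ 'd::finite \<Rightarrow> real) \<Rightarrow> real" where
  "kappa0 F = - (\<Sum>\<^sub>\<infinity>x. (enorm x)\<^sup>2 * F x)"

definition a_const :: "nat \<Rightarrow> real" where
  "a_const d = real d * Gamma ((real d - 2) / 2) / (2 * pi powr (real d / 2))"

end

theory Submission
  imports Defs "HOL-Probability.Probability"
begin

text \<open>
  Derivatives of Fourier coefficients are replaced by finite differences, since the limited decay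
  of \<open>F\<close> gives too few derivatives of its transform: the step \<open>u = \<pi> x / |x|\<^sup>2\<close> satisfies
  \<open>exp (i u \<sqdot> x) = - 1\<close>, so \<open>(- 2)\<^sup>n \<integral> \<phi>(k) exp (- i k \<sqdot> x) dk\<close> is the integral of the \<open>n\<close>-th difference of
  \<open>\<phi>\<close> with step \<open>u\<close> against the same exponential. With \<open>\<phi> = 1 / f - 2 d / (\<kappa> |k|\<^sup>2)\<close>, where \<open>f\<close> is the
  transform of \<open>F\<close>, this bounds the difference between the lattice Green function and the transform
  of \<open>2 d / (\<kappa> |k|\<^sup>2)\<close> over the whole space, which the heat kernel makes explicit. Near the origin the
  size of \<open>\<phi>\<close> suffices. Away from it, either the differences fall on many factors \<open>f\<close>, each of which
  gains \<open>|u| / |k|\<close> from the second moment of \<open>F\<close>, or one factor carries a difference of high order,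
  which Parseval's identity bounds in \<open>L\<^sup>2\<close>; this is where the restriction for \<open>d > 8\<close> arises.
  Finally \<open>H\<close> is the convolution of \<open>g\<close> with the Green
  function, and the symmetry of \<open>g\<close> cancels the first-order term of the expansion of \<open>|x - y|\<close>
  around \<open>x\<close>.
\<close>

section \<open>Finite differences\<close>

text \<open>Decay of order d - 2 + s asks for that many orders of smoothness of 1 / f, but F has
  moments only below 2 + \<rho>; from a pointwise difference of f, of whatever order, the proof
  draws a single factor |u| / |k| relative to the size |k|^2. Hence n = M (d + 1) differences with M
  large: if no factor of the expanded product receives more than M of them, at least d + 1 factors
  receive some, and all but the Taylor remainder of f gain |u| / |k|. \<open>gain\<close>, the M-th
  root of |u| / |k|, turns this count into a geometric rate per difference. A factor hit more than M
  times gains |u|^a in L^2 for a < 2 + \<rho> + d / 2, which is d / 2 more than the moments allow.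
  The other factors then have size |k|^(-4), so Cauchy-Schwarz wants |k|^(-8) integrable at 0. For d
  > 8 it is, and a = d - 2 + s yields exactly s < \<rho> - (d - 8) / 2. For d <= 8 a part of the
  singularity is traded for powers of |u| by |k| >= |u|, and s < \<rho> pays for it.\<close>

fun findiff :: "'a::real_vector \<Rightarrow> nat \<Rightarrow> ('a \<Rightarrow> 'b::ab_group_add) \<Rightarrow> 'a \<Rightarrow> 'b" where
  "findiff u 0 \<phi> k = \<phi> k"
| "findiff u (Suc m) \<phi> k = findiff u m \<phi> (k + u) - findiff u m \<phi> k"

text \<open>The recursion peels off the outermost difference, this form the innermost one; an
  estimate of the first difference alone then bounds all higher ones.\<close>

lemma findiff_Suc_eq:
  "findiff u (Suc m) \<phi> k = findiff u m (\<lambda>k. \<phi> (k + u) - \<phi> k) k"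
  by (induction m arbitrary: k) auto

lemma findiff_cong:
  assumes "\<And>j. j \<le> m \<Longrightarrow> \<phi> (k + real j *\<^sub>R u) = \<psi> (k + real j *\<^sub>R u)"
  shows "findiff u m \<phi> k = findiff u m \<psi> k"
  using assms
proof (induction m arbitrary: k)
  case 0
  then show ?case using 0[of 0] by simp
next
  case (Suc m)
  have "findiff u m \<phi> (k + u) = findiff u m \<psi> (k + u)"
  proof (rule Suc.IH)
    fix j assume "j \<le> m"
    then show "\<phi> (k + u + real j *\<^sub>R u) = \<psi> (k + u + real j *\<^sub>R u)"
      using Suc.prems[of "Suc j"] by (simp add: scaleR_add_left add.assoc)
  qed
  moreover have "findiff u m \<phi> k = findiff u m \<psi> k"
    by (rule Suc.IH) (use Suc.prems in auto)
  ultimately show ?case by simp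
qed

lemma findiff_diff:
  "findiff u m (\<lambda>k. \<phi> k - \<psi> k) k = findiff u m \<phi> k - findiff u m \<psi> k"
  by (induction m arbitrary: k) auto

lemma findiff_cmult:
  "findiff u m (\<lambda>k. c * \<phi> k) k = c * findiff u m (\<phi> :: _ \<Rightarrow> 'b::ring) k"
  by (induction m arbitrary: k) (auto simp: algebra_simps)

lemma findiff_const: "findiff u (Suc m) (\<lambda>k. c) k = 0"
  by (induction m arbitrary: k) auto

lemma findiff_of_real:
  "findiff u m (\<lambda>k. of_real (\<phi> k)) k = (of_real (findiff u m \<phi> k) :: 'b::real_normed_algebra_1)"
  by (induction m arbitrary: k) auto

lemma findiff_norm_le:
  fixes \<phi> :: "'a::real_vector \<Rightarrow> 'b::real_normed_vector"
  assumes "\<And>j. j \<le> m \<Longrightarrow> norm (\<phi> (k + real j *\<^sub>R u)) \<le> B"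
  shows "norm (findiff u m \<phi> k) \<le> 2 ^ m * B"
  using assms
proof (induction m arbitrary: k)
  case 0
  then show ?case using 0[of 0] by simp
next
  case (Suc m)
  have "norm (findiff u m \<phi> (k + u)) \<le> 2 ^ m * B"
  proof (rule Suc.IH)
    fix j assume "j \<le> m"
    then show "norm (\<phi> (k + u + real j *\<^sub>R u)) \<le> B"
      using Suc.prems[of "Suc j"] by (simp add: scaleR_add_left add.assoc)
  qed
  moreover have "norm (findiff u m \<phi> k) \<le> 2 ^ m * B"
    by (rule Suc.IH) (use Suc.prems in auto)
  ultimately show ?case
    using norm_triangle_ineq4[of "findiff u m \<phi> (k + u)" "findiff u m \<phi> k"] by simp
qed

lemma findiff_norm_le_sum:
  fixes \<phi> :: "'a::real_vector \<Rightarrow> 'b::real_normed_vector"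
  shows "norm (findiff u m \<phi> k) \<le> 2 ^ m * (\<Sum>j\<le>m. norm (\<phi> (k + real j *\<^sub>R u)))"
  by (rule findiff_norm_le) (rule member_le_sum, auto)

lemma findiff_add_order: "findiff u (m + l) \<phi> k = findiff u m (findiff u l \<phi>) k"
  by (induction m arbitrary: k) auto

text \<open>Induction with Pascal's rule. The first factor is sampled at shifted points, which is
  why bounds are later required at all k + j u with m + j <= n and not only at k.\<close>

lemma findiff_leibniz:
  fixes \<phi> \<psi> :: "'a::real_vector \<Rightarrow> 'b::comm_ring_1"
  shows "findiff u m (\<lambda>k. \<phi> k * \<psi> k) k =
    (\<Sum>i\<le>m. of_nat (m choose i) * findiff u i \<phi> (k + real (m - i) *\<^sub>R u) * findiff u (m - i) \<psi> k)"
proof (induction m arbitrary: k)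
  case 0
  then show ?case by simp
next
  case (Suc m)
  define T where "T i j k = findiff u i \<phi> (k + real j *\<^sub>R u) * findiff u j \<psi> k" for i j k
  have IH: "findiff u m (\<lambda>k. \<phi> k * \<psi> k) k = (\<Sum>i\<le>m. of_nat (m choose i) * T i (m - i) k)" for k
    using Suc.IH[of k] by (simp add: T_def mult.assoc)
  have step: "T i j (k + u) - T i j k = T i (Suc j) k + T (Suc i) j k" for i j
  proof -
    have e: "k + u + real j *\<^sub>R u = k + real j *\<^sub>R u + u"
      "k + real (Suc j) *\<^sub>R u = k + real j *\<^sub>R u + u"
      by (simp_all add: scaleR_add_left)
    show ?thesis unfolding T_def e by (simp add: left_diff_distrib right_diff_distrib)
  qed
  have "findiff u (Suc m) (\<lambda>k. \<phi> k * \<psi> k) k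
      = (\<Sum>i\<le>m. of_nat (m choose i) * (T i (m - i) (k + u) - T i (m - i) k))"
    by (simp add: IH sum_subtractf right_diff_distrib)
  also have "\<dots> = (\<Sum>i\<le>m. of_nat (m choose i) * T i (Suc m - i) k)
      + (\<Sum>i\<le>m. of_nat (m choose i) * T (Suc i) (m - i) k)"
    by (simp add: step distrib_left sum.distrib Suc_diff_le)
  also have "\<dots> = (\<Sum>i\<le>Suc m. of_nat (Suc m choose i) * T i (Suc m - i) k)"
  proof -
    have 1: "(\<Sum>i\<le>Suc m. of_nat (Suc m choose i) * T i (Suc m - i) k)
      = T 0 (Suc m) k + (\<Sum>i\<le>m. of_nat ((m choose Suc i) + (m choose i)) * T (Suc i) (m - i) k)"
      by (subst sum.atMost_Suc_shift) (simp add: add.commute)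
    have 2: "(\<Sum>i\<le>m. of_nat (m choose i) * T i (Suc m - i) k)
      = T 0 (Suc m) k + (\<Sum>i\<le>m. of_nat (m choose Suc i) * T (Suc i) (m - i) k)"
    proof -
      have "(\<Sum>i\<le>m. of_nat (m choose i) * T i (Suc m - i) k)
        = (\<Sum>i\<le>Suc m. of_nat (m choose i) * T i (Suc m - i) k)" by (simp add: binomial_eq_0)
      also have "\<dots> = T 0 (Suc m) k + (\<Sum>i\<le>m. of_nat (m choose Suc i) * T (Suc i) (m - i) k)"
        by (subst sum.atMost_Suc_shift) simp
      finally show ?thesis .
    qed
    show ?thesis unfolding 1 2 by (simp add: distrib_right sum.distrib)
  qed
  finally show ?case by (simp add: T_def mult.assoc)
qed

text \<open>
  \<open>\<eta>\<close> is the gain of one difference, \<open>c\<close> the number of differences that yield no gain, and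
  \<open>\<delta>\<close> collects the differences of high order, which are only controlled in \<open>L\<^sup>2\<close>.
\<close>
definition diff_bound ::
  "'a::real_vector \<Rightarrow> 'a \<Rightarrow> nat \<Rightarrow> real \<Rightarrow> real \<Rightarrow> nat \<Rightarrow> real \<Rightarrow> ('a \<Rightarrow> real) \<Rightarrow> bool" where
  "diff_bound u k n \<eta> \<delta> c A \<phi> \<longleftrightarrow>
     (\<forall>m j. m + j \<le> n \<longrightarrow> \<bar>findiff u m \<phi> (k + real j *\<^sub>R u)\<bar> \<le> A * (\<eta> ^ (m - c) + \<delta>))"

lemma sum_choose_le:
  fixes g :: "nat \<Rightarrow> real"
  assumes "m \<le> n" "0 \<le> X" "\<And>i. i \<le> m \<Longrightarrow> \<bar>g i\<bar> \<le> X"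
  shows "\<bar>\<Sum>i\<le>m. of_nat (m choose i) * g i\<bar> \<le> 2 ^ n * X"
proof -
  have "\<bar>\<Sum>i\<le>m. of_nat (m choose i) * g i\<bar> \<le> (\<Sum>i\<le>m. of_nat (m choose i) * X)"
    by (rule order_trans[OF sum_abs]) (auto intro!: sum_mono mult_left_mono assms simp: abs_mult)
  also have "\<dots> = of_nat (\<Sum>i\<le>m. m choose i) * X" by (simp add: sum_distrib_right)
  also have "\<dots> = 2 ^ m * X" by (simp add: choose_row_sum)
  also have "\<dots> \<le> 2 ^ n * X" by (intro mult_right_mono power_increasing assms) auto
  finally show ?thesis .
qed

text \<open>Multiplying out (\<eta>^(i - c) + \<delta>) (\<eta>^(m - i - c') + \<delta>') with
  \<eta>, \<delta>' <= 1 leaves one pure power of \<eta> and at most 2 \<delta> + \<delta>'.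
  Truncated subtraction does no harm, since (i - c) + (m - i - c') is at least m - (c + c'). The
  factor 2^n pays for the binomial coefficients.\<close>

lemma diff_bound_mult:
  assumes a: "diff_bound u k n \<eta> \<delta> c A \<phi>" and b: "diff_bound u k n \<eta> \<delta>' c' B \<psi>"
    and "0 \<le> \<eta>" "\<eta> \<le> 1" "0 \<le> \<delta>" "0 \<le> \<delta>'" "\<delta>' \<le> 1" "0 \<le> A" "0 \<le> B"
  shows "diff_bound u k n \<eta> (2 * \<delta> + \<delta>') (c + c') (2 ^ n * A * B) (\<lambda>k. \<phi> k * \<psi> k)"
  unfolding diff_bound_def
proof (intro allI impI)
  fix m j assume mj: "m + j \<le> n"
  define X where "X = A * B * (\<eta> ^ (m - (c + c')) + (2 * \<delta> + \<delta>'))"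
  have X0: "X \<ge> 0" unfolding X_def using assms by simp
  define h where "h i = findiff u i \<phi> (k + real j *\<^sub>R u + real (m - i) *\<^sub>R u)
      * findiff u (m - i) \<psi> (k + real j *\<^sub>R u)" for i
  have "\<bar>h i\<bar> \<le> X" if i: "i \<le> m" for i
  proof -
    have "\<bar>findiff u i \<phi> (k + real (j + (m - i)) *\<^sub>R u)\<bar> \<le> A * (\<eta> ^ (i - c) + \<delta>)"
      using a mj i unfolding diff_bound_def by (metis add.assoc add.commute add_diff_inverse_nat linorder_not_le)
    then have 1: "\<bar>findiff u i \<phi> (k + real j *\<^sub>R u + real (m - i) *\<^sub>R u)\<bar> \<le> A * (\<eta> ^ (i - c) + \<delta>)"
      by (simp add: scaleR_add_left add.assoc)
    have 2: "\<bar>findiff u (m - i) \<psi> (k + real j *\<^sub>R u)\<bar> \<le> B * (\<eta> ^ (m - i - c') + \<delta>')"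
      using b[unfolded diff_bound_def, rule_format, of "m - i" j] mj i by simp
    have "\<bar>h i\<bar> \<le> (A * (\<eta> ^ (i - c) + \<delta>)) * (B * (\<eta> ^ (m - i - c') + \<delta>'))"
      unfolding h_def abs_mult by (intro mult_mono 1 2) (use assms in auto)
    also have "\<dots> = A * B * (\<eta> ^ (i - c + (m - i - c')) + \<delta> * \<eta> ^ (m - i - c') + \<delta> * \<delta>' + \<eta> ^ (i - c) * \<delta>')"
      by (simp add: power_add algebra_simps)
    also have "\<dots> \<le> A * B * (\<eta> ^ (m - (c + c')) + \<delta> * 1 + \<delta> * 1 + 1 * \<delta>')"
      by (intro mult_left_mono add_mono mult_right_mono power_decreasing)
         (use assms in \<open>auto intro: power_le_one\<close>)
    also have "\<dots> = X" by (simp add: X_def)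
    finally show ?thesis .
  qed
  then have "\<bar>\<Sum>i\<le>m. of_nat (m choose i) * h i\<bar> \<le> 2 ^ n * X"
    using mj X0 by (intro sum_choose_le) auto
  then show "\<bar>findiff u m (\<lambda>k. \<phi> k * \<psi> k) (k + real j *\<^sub>R u)\<bar>
      \<le> 2 ^ n * A * B * (\<eta> ^ (m - (c + c')) + (2 * \<delta> + \<delta>'))"
    by (simp add: findiff_leibniz h_def X_def mult.assoc)
qed

text \<open>
  Differencing \<open>\<phi> * (1 / \<phi>) = 1\<close> expresses the highest difference of \<open>1 / \<phi>\<close> by lower ones.
\<close>
lemma diff_bound_inverse:
  assumes a: "diff_bound u k n \<eta> \<delta> 0 (L * \<alpha>) \<phi>"
    and low: "\<And>j. j \<le> n \<Longrightarrow> \<phi> (k + real j *\<^sub>R u) \<ge> \<alpha>"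
    and "0 \<le> \<eta>" "\<eta> \<le> 1" "0 \<le> \<delta>" "\<delta> \<le> 1" "0 < \<alpha>" "0 \<le> L"
  shows "diff_bound u k n \<eta> \<delta> 0 ((1 + 3 * 2 ^ n * L) ^ n / \<alpha>) (\<lambda>k. 1 / \<phi> k)"
proof -
  \<comment> \<open>The cost of one more order: 2^n bounds the binomial sum, L is the size of \<phi>
    relative to its lower bound \<alpha>, and 3 absorbs the terms with \<delta> in a product of two
    factors of the form power of \<eta> plus \<delta>.\<close>
  define Q where "Q = 1 + 3 * 2 ^ n * L"
  have Q1: "Q \<ge> 1" using assms by (simp add: Q_def)
  define \<psi> where "\<psi> k = 1 / \<phi> k" for k
  have main: "\<bar>findiff u m \<psi> (k + real j *\<^sub>R u)\<bar> \<le> Q ^ m / \<alpha> * (\<eta> ^ m + \<delta>)" if "m + j \<le> n" for m j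
    using that
  proof (induction m arbitrary: j rule: less_induct)
    case (less m)
    have lowj: "\<phi> (k + real j *\<^sub>R u) \<ge> \<alpha>" using low less.prems by simp
    show ?case
    proof (cases m)
      case 0
      have "1 / \<phi> (k + real j *\<^sub>R u) \<le> 1 / \<alpha>"
        using lowj assms by (simp add: frac_le)
      also have "\<dots> \<le> 1 / \<alpha> * (1 + \<delta>)" using assms by (simp add: field_simps)
      finally show ?thesis using 0 lowj assms by (simp add: \<psi>_def)
    next
      case (Suc m')
      define y where "y = k + real j *\<^sub>R u"
      define h where "h i = findiff u (Suc i) \<phi> (y + real (m' - i) *\<^sub>R u) * findiff u (m' - i) \<psi> y" for i
      \<comment> \<open>The product equals 1 only where \<phi> does not vanish; \<open>low\<close>
        grants this at the sampled points, and a difference sees no others.\<close>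
      have "findiff u m (\<lambda>k. \<phi> k * \<psi> k) y = findiff u m (\<lambda>k. 1) y"
      proof (rule findiff_cong)
        fix i assume "i \<le> m"
        then have "\<phi> (k + real (j + i) *\<^sub>R u) \<ge> \<alpha>" using low[of "j + i"] less.prems by simp
        then have "\<phi> (y + real i *\<^sub>R u) \<noteq> 0" using \<open>0 < \<alpha>\<close>
          unfolding y_def by (auto simp: scaleR_add_left add.assoc)
        then show "\<phi> (y + real i *\<^sub>R u) * \<psi> (y + real i *\<^sub>R u) = 1" by (simp add: \<psi>_def)
      qed
      also have "\<dots> = 0" unfolding Suc by (rule findiff_const)
      finally have "(\<Sum>i\<le>Suc m'. of_nat (m choose i) * findiff u i \<phi> (y + real (m - i) *\<^sub>R u) * findiff u (m - i) \<psi> y) = 0"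
        by (simp add: findiff_leibniz Suc)
      then have "\<phi> (y + real m *\<^sub>R u) * findiff u m \<psi> y = - (\<Sum>i\<le>m'. of_nat (m choose Suc i) * h i)"
        by (subst (asm) sum.atMost_Suc_shift) (simp add: Suc h_def mult.assoc)
      moreover have "\<bar>\<Sum>i\<le>m'. of_nat (m choose Suc i) * h i\<bar> \<le> 2 ^ n * (3 * L * Q ^ m' * (\<eta> ^ m + \<delta>))"
      proof -
        have hb: "\<bar>h i\<bar> \<le> 3 * L * Q ^ m' * (\<eta> ^ m + \<delta>)" if i: "i \<le> m'" for i
        proof -
          have "\<bar>findiff u (Suc i) \<phi> (k + real (j + (m' - i)) *\<^sub>R u)\<bar> \<le> L * \<alpha> * (\<eta> ^ (Suc i - 0) + \<delta>)"
            using a less.prems i Suc unfolding diff_bound_def by (metis (no_types, lifting) Suc_diff_le add.commute add.left_commute add_Suc le_add_diff_inverse2)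
          then have 1: "\<bar>findiff u (Suc i) \<phi> (y + real (m' - i) *\<^sub>R u)\<bar> \<le> L * \<alpha> * (\<eta> ^ Suc i + \<delta>)"
            by (simp add: y_def scaleR_add_left add.assoc)
          have "\<bar>findiff u (m' - i) \<psi> y\<bar> \<le> Q ^ (m' - i) / \<alpha> * (\<eta> ^ (m' - i) + \<delta>)"
            unfolding y_def by (rule less.IH) (use Suc less.prems in auto)
          also have "\<dots> \<le> Q ^ m' / \<alpha> * (\<eta> ^ (m' - i) + \<delta>)"
            by (intro mult_right_mono divide_right_mono power_increasing) (use Q1 assms in auto)
          finally have 2: "\<bar>findiff u (m' - i) \<psi> y\<bar> \<le> Q ^ m' / \<alpha> * (\<eta> ^ (m' - i) + \<delta>)" .
          have "\<bar>h i\<bar> \<le> (L * \<alpha> * (\<eta> ^ Suc i + \<delta>)) * (Q ^ m' / \<alpha> * (\<eta> ^ (m' - i) + \<delta>))"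
            unfolding h_def abs_mult by (intro mult_mono 1 2) (use assms in auto)
          also have "\<dots> = L * Q ^ m' * (\<eta> ^ (Suc i + (m' - i)) + \<delta> * \<eta> ^ (m' - i) + \<eta> ^ Suc i * \<delta> + \<delta> * \<delta>)"
            using \<open>0 < \<alpha>\<close> by (simp add: power_add field_simps)
          also have "\<dots> \<le> L * Q ^ m' * (\<eta> ^ (Suc i + (m' - i)) + \<delta> * 1 + 1 * \<delta> + \<delta> * 1)"
            by (intro mult_left_mono add_mono mult_right_mono power_le_one) (use assms Q1 in auto)
          also have "Suc i + (m' - i) = m" using i Suc by simp
          also have "L * Q ^ m' * (\<eta> ^ m + \<delta> * 1 + 1 * \<delta> + \<delta> * 1) \<le> L * Q ^ m' * (3 * (\<eta> ^ m + \<delta>))"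
            by (intro mult_left_mono) (use assms Q1 in auto)
          finally show ?thesis by (simp add: algebra_simps)
        qed
        have "\<bar>\<Sum>i\<le>m'. of_nat (m choose Suc i) * h i\<bar> = \<bar>\<Sum>i\<le>m. of_nat (m choose i) * (if i = 0 then 0 else h (i - 1))\<bar>"
          unfolding Suc by (subst sum.atMost_Suc_shift) simp
        also have "\<dots> \<le> 2 ^ n * (3 * L * Q ^ m' * (\<eta> ^ m + \<delta>))"
          by (rule sum_choose_le) (use less.prems Suc hb assms Q1 in auto)
        finally show ?thesis .
      qed
      ultimately have 3: "\<phi> (y + real m *\<^sub>R u) * \<bar>findiff u m \<psi> y\<bar> \<le> 2 ^ n * (3 * L * Q ^ m' * (\<eta> ^ m + \<delta>))"
        if "\<phi> (y + real m *\<^sub>R u) \<ge> 0" using that by (metis abs_minus_cancel abs_mult abs_of_nonneg)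
      have 4: "\<phi> (y + real m *\<^sub>R u) \<ge> \<alpha>"
        using low[of "j + m"] less.prems by (simp add: y_def scaleR_add_left add.assoc)
      have "\<alpha> * \<bar>findiff u m \<psi> y\<bar> \<le> \<phi> (y + real m *\<^sub>R u) * \<bar>findiff u m \<psi> y\<bar>"
        by (intro mult_right_mono 4) auto
      also have "\<dots> \<le> 2 ^ n * (3 * L * Q ^ m' * (\<eta> ^ m + \<delta>))" using 3 4 assms by simp
      also have "\<dots> = (3 * 2 ^ n * L) * (Q ^ m' * (\<eta> ^ m + \<delta>))" by simp
      also have "\<dots> \<le> Q * (Q ^ m' * (\<eta> ^ m + \<delta>))"
        by (intro mult_right_mono) (use assms Q1 in \<open>auto simp: Q_def\<close>)
      finally show ?thesis using \<open>0 < \<alpha>\<close> by (simp add: y_def Suc field_simps)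
    qed
  qed
  have "Q ^ m / \<alpha> * (\<eta> ^ m + \<delta>) \<le> Q ^ n / \<alpha> * (\<eta> ^ m + \<delta>)" if "m \<le> n" for m
    by (intro mult_right_mono divide_right_mono power_increasing that) (use Q1 assms in auto)
  with main have "\<bar>findiff u m \<psi> (k + real j *\<^sub>R u)\<bar> \<le> Q ^ n / \<alpha> * (\<eta> ^ m + \<delta>)" if "m + j \<le> n" for m j
    using that by (meson add_leD1 order_trans)
  then show ?thesis unfolding diff_bound_def by (simp flip: Q_def \<psi>_def)
qed

section \<open>Lattice sums\<close>

lemma rvec_diff: "rvec (x - y) = rvec x - rvec y"
  by (simp add: rvec_def vec_eq_iff)

lemma rvec_minus: "rvec (- x) = - rvec x"
  by (simp add: rvec_def vec_eq_iff)

lemma rvec_nth [simp]: "rvec x $ i = real_of_int (x $ i)"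
  by (simp add: rvec_def)

lemma rvec_0 [simp]: "rvec 0 = 0"
  by (simp add: rvec_def vec_eq_iff)

lemma enorm_minus [simp]: "enorm (- x) = enorm x"
  by (simp add: enorm_def rvec_minus)

lemma xnorm_minus [simp]: "xnorm (- x) = xnorm x"
  by (simp add: xnorm_def)

lemma enorm_nonneg [simp]: "0 \<le> enorm x"
  by (simp add: enorm_def)

lemma xnorm_ge_1 [simp]: "1 \<le> xnorm x"
  by (simp add: xnorm_def)

lemma xnorm_pos [simp]: "0 < xnorm x"
  using xnorm_ge_1[of x] by linarith

lemma xnorm_nonneg [simp]: "0 \<le> xnorm x"
  using xnorm_pos[of x] by linarith

lemma xnorm_neq_0 [simp]: "xnorm x \<noteq> 0"
  using xnorm_pos[of x] by linarith

lemma enorm_le_xnorm: "enorm x \<le> xnorm x"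
  by (simp add: xnorm_def)

lemma abs_nth_le_enorm: "\<bar>real_of_int (x $ i)\<bar> \<le> enorm x"
  unfolding enorm_def using component_le_norm_cart[of "rvec x" i] by simp

lemma enorm_ge_1:
  assumes "x \<noteq> 0" shows "1 \<le> enorm x"
proof -
  obtain i where "x $ i \<noteq> 0" using assms by (auto simp: vec_eq_iff)
  then have "1 \<le> \<bar>real_of_int (x $ i)\<bar>" by linarith
  then show ?thesis using abs_nth_le_enorm[of x i] by linarith
qed

lemma xnorm_eq_enorm: "x \<noteq> 0 \<Longrightarrow> xnorm x = enorm x"
  using enorm_ge_1[of x] by (simp add: xnorm_def)

lemma summable_on_int_powr:
  assumes "p > 1"
  shows "(\<lambda>m::int. max (\<bar>real_of_int m\<bar>) 1 powr - p) summable_on UNIV"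
proof -
  let ?h = "\<lambda>m::int. max (\<bar>real_of_int m\<bar>) 1 powr - p"
  have "summable (\<lambda>n. real n powr - p)" using assms by (simp add: summable_real_powr_iff)
  then have "summable (\<lambda>n. max (real n) 1 powr - p)"
    by (rule summable_cong[THEN iffD1, rotated])
       (auto intro!: eventually_mono[OF eventually_ge_at_top[of 1]] simp: max_def)
  then have nat: "(\<lambda>n. max (real n) 1 powr - p) summable_on UNIV"
    by (intro norm_summable_imp_summable_on) simp
  have "?h summable_on range int"
    by (subst summable_on_reindex) (use nat in \<open>auto simp: o_def\<close>)
  moreover have "?h summable_on range (\<lambda>n. - int n)"
    by (subst summable_on_reindex) (use nat in \<open>auto simp: o_def inj_on_def\<close>)
  ultimately have "?h summable_on (range int \<union> range (\<lambda>n. - int n))"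
    by (rule summable_on_union)
  also have "range int \<union> range (\<lambda>n. - int n) = UNIV"
  proof -
    have "m \<in> range int \<union> range (\<lambda>n. - int n)" for m
      by (cases m rule: int_cases2) auto
    then show ?thesis by blast
  qed
  finally show ?thesis .
qed

text \<open>With p = \<gamma> / d > 1 the summand is a product of d copies of
  \<open>xnorm x powr - p\<close>, and each copy is at most the p-th inverse power of one
  coordinate. Finite partial sums are thus bounded by a product of convergent one-dimensional
  sums.\<close>

lemma summable_on_xnorm_powr:
  assumes "\<gamma> > real CARD('d)"
  shows "(\<lambda>x::int^'d::finite. xnorm x powr - \<gamma>) summable_on UNIV"
proof (rule nonneg_bdd_above_summable_on)
  define p where "p = \<gamma> / real CARD('d)"
  have p1: "p > 1" using assms by (simp add: p_def field_simps)
  define h where "h m = max (\<bar>real_of_int m\<bar>) 1 powr - p" for m :: int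
  have h0: "h m \<ge> 0" for m by (simp add: h_def)
  have hs: "h summable_on UNIV" unfolding h_def by (rule summable_on_int_powr[OF p1])
  have le: "xnorm x powr - \<gamma> \<le> (\<Prod>i\<in>UNIV. h (x $ i))" for x :: "int^'d"
  proof -
    have "xnorm x powr - \<gamma> = (\<Prod>i\<in>(UNIV::'d set). xnorm x powr - p)"
      by (subst prod_constant, subst powr_power) (auto simp: p_def less_imp_neq[THEN not_sym])
    also have "\<dots> \<le> (\<Prod>i\<in>UNIV. h (x $ i))"
    proof (rule prod_mono, safe)
      fix i :: 'd
      have "max (\<bar>real_of_int (x $ i)\<bar>) 1 \<le> xnorm x"
        using abs_nth_le_enorm[of x i] by (auto simp: xnorm_def)
      then show "xnorm x powr - p \<le> h (x $ i)"
        unfolding h_def using p1 by (intro powr_mono2') auto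
    qed simp
    finally show ?thesis .
  qed
  show "bdd_above (sum (\<lambda>x::int^'d. xnorm x powr - \<gamma>) ` {F. F \<subseteq> UNIV \<and> finite F})"
  proof (rule bdd_aboveI2)
    fix S :: "(int^'d) set" assume "S \<in> {F. F \<subseteq> UNIV \<and> finite F}"
    then have fin: "finite S" by simp
    define B where "B = (\<Union>x\<in>S. range (($) x))"
    have finB: "finite B" unfolding B_def using fin by (auto intro: finite_imageI)
    have "sum (\<lambda>x. xnorm x powr - \<gamma>) S \<le> (\<Sum>x\<in>S. \<Prod>i\<in>UNIV. h (x $ i))"
      by (intro sum_mono le)
    also have "\<dots> = (\<Sum>g\<in>($) ` S. \<Prod>i\<in>UNIV. h (g i))"
      by (subst sum.reindex) (auto simp: inj_on_def vec_eq_iff)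
    also have "\<dots> \<le> (\<Sum>g\<in>PiE (UNIV :: 'd set) (\<lambda>_. B). \<Prod>i\<in>UNIV. h (g i))"
    proof (rule sum_mono2)
      show "finite (PiE (UNIV :: 'd set) (\<lambda>_. B))" by (intro finite_PiE) (auto simp: finB)
      show "($) ` S \<subseteq> PiE (UNIV :: 'd set) (\<lambda>_. B)" by (auto simp: B_def)
    qed (auto intro!: prod_nonneg h0)
    also have "\<dots> = (\<Prod>i\<in>(UNIV::'d set). \<Sum>m\<in>B. h m)"
      by (rule prod_sum_PiE[symmetric]) (auto simp: finB)
    also have "\<dots> \<le> (\<Prod>i\<in>(UNIV::'d set). infsum h UNIV)"
      by (intro prod_mono) (auto intro!: sum_nonneg h0 finite_sum_le_infsum hs finB)
    finally show "sum (\<lambda>x. xnorm x powr - \<gamma>) S \<le> (\<Prod>i\<in>(UNIV::'d set). infsum h UNIV)" .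
  qed
qed simp

text \<open>An Epstein-type zeta value with |x| cut off at 1. Moments of F and g are bounded by
  multiples of it, so the constants depend on dimension and exponents only and can be fixed before
  the functions are.\<close>

definition lattice_zeta :: "'d::finite itself \<Rightarrow> real \<Rightarrow> real" where
  "lattice_zeta _ \<gamma> = (\<Sum>\<^sub>\<infinity>x::int^'d. xnorm x powr - \<gamma>)"

lemma lattice_zeta_nonneg: "0 \<le> lattice_zeta TYPE('d::finite) \<gamma>"
  unfolding lattice_zeta_def by (rule infsum_nonneg) simp

lemma weighted_sum_bound:
  fixes F :: "int^'d::finite \<Rightarrow> real"
  assumes F: "\<And>x. \<bar>F x\<bar> \<le> K / xnorm x powr \<gamma>" and p: "real CARD('d) + p < \<gamma>"
  shows weighted_summable: "(\<lambda>x. \<bar>F x\<bar> * xnorm x powr p) summable_on UNIV"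
    and weighted_sum_le: "(\<Sum>\<^sub>\<infinity>x. \<bar>F x\<bar> * xnorm x powr p) \<le> K * lattice_zeta TYPE('d) (\<gamma> - p)"
proof -
  have s: "(\<lambda>x::int^'d. K * xnorm x powr - (\<gamma> - p)) summable_on UNIV"
    by (intro summable_on_cmult_right summable_on_xnorm_powr) (use p in simp)
  have le: "\<bar>F x\<bar> * xnorm x powr p \<le> K * xnorm x powr - (\<gamma> - p)" for x
  proof -
    have "\<bar>F x\<bar> * xnorm x powr p \<le> K / xnorm x powr \<gamma> * xnorm x powr p"
      by (intro mult_right_mono F) simp
    also have "\<dots> = K * xnorm x powr - (\<gamma> - p)"
      by (simp add: powr_diff powr_minus field_simps)
    finally show ?thesis .
  qed
  show sm: "(\<lambda>x. \<bar>F x\<bar> * xnorm x powr p) summable_on UNIV"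
    by (rule summable_on_comparison_test[OF s]) (use le in auto)
  have "(\<Sum>\<^sub>\<infinity>x. \<bar>F x\<bar> * xnorm x powr p) \<le> (\<Sum>\<^sub>\<infinity>x::int^'d. K * xnorm x powr - (\<gamma> - p))"
    by (rule infsum_mono[OF sm s]) (use le in auto)
  also have "\<dots> = K * lattice_zeta TYPE('d) (\<gamma> - p)"
    unfolding lattice_zeta_def by (rule infsum_cmult_right')
  finally show "(\<Sum>\<^sub>\<infinity>x. \<bar>F x\<bar> * xnorm x powr p) \<le> K * lattice_zeta TYPE('d) (\<gamma> - p)" .
qed

text \<open>Transports unconditional sums over a countable type to sums over the naturals, extended
  by 0 off the range of \<open>to_nat\<close>, where termwise integration of series is
  available.\<close>

lemma has_sum_to_nat:
  fixes f :: "'a::countable \<Rightarrow> 'b::{comm_monoid_add, t2_space}"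
  shows "((\<lambda>n. if n \<in> range (to_nat :: 'a \<Rightarrow> nat) then f (from_nat n) else 0) has_sum S) UNIV
    \<longleftrightarrow> (f has_sum S) UNIV" (is "(?g has_sum S) UNIV \<longleftrightarrow> _")
proof -
  have "(?g has_sum S) UNIV \<longleftrightarrow> (?g has_sum S) (range (to_nat :: 'a \<Rightarrow> nat))"
    by (rule has_sum_cong_neutral) auto
  also have "\<dots> \<longleftrightarrow> (?g \<circ> (to_nat :: 'a \<Rightarrow> nat) has_sum S) UNIV"
    by (rule has_sum_reindex[OF inj_to_nat])
  also have "?g \<circ> (to_nat :: 'a \<Rightarrow> nat) = f" by (auto simp: fun_eq_iff)
  finally show ?thesis .
qed

lemma infsum_integral_swap:
  fixes \<phi> :: "'a::countable \<Rightarrow> 'b \<Rightarrow> complex"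
  assumes int: "\<And>x. integrable M (\<phi> x)"
    and summ: "(\<lambda>x. \<integral>k. norm (\<phi> x k) \<partial>M) summable_on UNIV"
    and pt: "\<And>k. (\<lambda>x. norm (\<phi> x k)) summable_on UNIV"
  shows integrable_infsum: "integrable M (\<lambda>k. \<Sum>\<^sub>\<infinity>x. \<phi> x k)"
    and integral_has_sum: "((\<lambda>x. \<integral>k. \<phi> x k \<partial>M) has_sum (\<integral>k. (\<Sum>\<^sub>\<infinity>x. \<phi> x k) \<partial>M)) UNIV"
proof -
  define I where "I = range (to_nat :: 'a \<Rightarrow> nat)"
  define \<psi> where "\<psi> n k = (if n \<in> I then \<phi> (from_nat n) k else 0)" for n k
  have psi_int: "integrable M (\<psi> n)" for n unfolding \<psi>_def using int by (cases "n \<in> I") auto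
  have nrm: "norm (\<psi> n k) = (if n \<in> I then norm (\<phi> (from_nat n) k) else 0)" for n k
    by (simp add: \<psi>_def)
  have pts: "summable (\<lambda>n. norm (\<psi> n k))" for k
  proof -
    have "((\<lambda>n. norm (\<psi> n k)) has_sum (\<Sum>\<^sub>\<infinity>x. norm (\<phi> x k))) UNIV"
      unfolding nrm I_def using has_sum_to_nat[of "\<lambda>x. norm (\<phi> x k)"] pt[of k] by simp
    then show ?thesis by (blast dest: has_sum_imp_sums sums_summable)
  qed
  have ints: "summable (\<lambda>n. \<integral>k. norm (\<psi> n k) \<partial>M)"
  proof -
    have eq: "(\<integral>k. norm (\<psi> n k) \<partial>M) = (if n \<in> I then \<integral>k. norm (\<phi> (from_nat n) k) \<partial>M else 0)" for n
      by (simp add: nrm)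
    have "((\<lambda>n. \<integral>k. norm (\<psi> n k) \<partial>M) has_sum (\<Sum>\<^sub>\<infinity>x. \<integral>k. norm (\<phi> x k) \<partial>M)) UNIV"
      unfolding eq I_def using has_sum_to_nat[of "\<lambda>x. \<integral>k. norm (\<phi> x k) \<partial>M"] summ by simp
    then show ?thesis by (blast dest: has_sum_imp_sums sums_summable)
  qed
  have inf_eq: "(\<Sum>n. \<psi> n k) = (\<Sum>\<^sub>\<infinity>x. \<phi> x k)" for k
  proof -
    have "(\<lambda>x. \<phi> x k) summable_on UNIV" by (rule abs_summable_summable[OF pt])
    then have "((\<lambda>n. \<psi> n k) has_sum (\<Sum>\<^sub>\<infinity>x. \<phi> x k)) UNIV"
      unfolding \<psi>_def I_def using has_sum_to_nat[of "\<lambda>x. \<phi> x k"] by simp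
    then show ?thesis by (blast dest: has_sum_imp_sums sums_unique[symmetric])
  qed
  have "integrable M (\<lambda>k. \<Sum>n. \<psi> n k)"
    by (rule integrable_suminf) (use psi_int pts ints in auto)
  then show "integrable M (\<lambda>k. \<Sum>\<^sub>\<infinity>x. \<phi> x k)" by (simp add: inf_eq)
  have "(\<lambda>n. \<integral>k. \<psi> n k \<partial>M) sums (\<integral>k. (\<Sum>n. \<psi> n k) \<partial>M)"
    by (rule sums_integral) (use psi_int pts ints in auto)
  moreover have "summable (\<lambda>n. norm (\<integral>k. \<psi> n k \<partial>M))"
    by (rule summable_comparison_test[OF _ ints]) (auto intro!: integral_norm_bound)
  ultimately have "((\<lambda>n. \<integral>k. \<psi> n k \<partial>M) has_sum (\<integral>k. (\<Sum>\<^sub>\<infinity>x. \<phi> x k) \<partial>M)) UNIV"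
    unfolding inf_eq by (simp add: norm_summable_imp_has_sum)
  moreover have "(\<integral>k. \<psi> n k \<partial>M) = (if n \<in> I then (\<integral>k. \<phi> (from_nat n) k \<partial>M) else 0)" for n
    by (simp add: \<psi>_def)
  ultimately show "((\<lambda>x. \<integral>k. \<phi> x k \<partial>M) has_sum (\<integral>k. (\<Sum>\<^sub>\<infinity>x. \<phi> x k) \<partial>M)) UNIV"
    unfolding I_def using has_sum_to_nat[of "\<lambda>x. \<integral>k. \<phi> x k \<partial>M"] by simp
qed

section \<open>The torus\<close>

lemma integrable_lborel_translate_iff:
  fixes f :: "'a::euclidean_space \<Rightarrow> 'b::{banach, second_countable_topology}"
  shows "integrable lborel (\<lambda>k. f (k + a)) \<longleftrightarrow> integrable lborel f" (is "?L \<longleftrightarrow> ?R")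
proof -
  have *: "integrable lborel (\<lambda>k. f (k + a))" if "integrable lborel f" for f :: "'a \<Rightarrow> 'b" and a
  proof -
    have "integrable (distr lborel borel ((+) a)) f" using that by (simp add: lborel_distr_plus)
    then show ?thesis by (subst (asm) integrable_distr_eq) (use that in \<open>auto simp: add.commute\<close>)
  qed
  show ?thesis using *[of f a] *[of "\<lambda>k. f (k + a)" "- a"] by auto
qed

lemma integral_lborel_translate:
  fixes f :: "'a::euclidean_space \<Rightarrow> 'b::{banach, second_countable_topology}"
  shows "(\<integral>k. f (k + a) \<partial>lborel) = (\<integral>k. f k \<partial>lborel)"
proof (cases "integrable lborel f")
  case True
  have "(\<integral>k. f k \<partial>lborel) = (\<integral>k. f k \<partial>distr lborel borel ((+) a))" by (simp add: lborel_distr_plus)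
  also have "\<dots> = (\<integral>k. f (a + k) \<partial>lborel)"
    by (rule integral_distr) (use True in auto)
  finally show ?thesis by (simp add: add.commute)
next
  case False
  then show ?thesis using integrable_lborel_translate_iff[of f a] by (simp add: not_integrable_integral_eq)
qed

section \<open>Integration of periodic functions over the torus\<close>

definition torus_measure :: "(real ^ 'd::finite) measure" where
  "torus_measure = restrict_space lborel torus"

lemma torus_eq_Int: "torus = (\<Inter>i. {k::real^'d::finite. - pi < k $ i} \<inter> {k. k $ i \<le> pi})"
  by (auto simp: torus_def)

lemma torus_sets [measurable, simp]: "(torus :: (real^'d::finite) set) \<in> sets borel"
  unfolding torus_eq_Int by measurable

lemma box_subset_torus: "box (\<chi> i. - pi) (\<chi> i. pi) \<subseteq> (torus :: (real^'d::finite) set)"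
  by (auto simp: torus_def mem_box_cart less_imp_le)

lemma torus_subset_cbox: "(torus :: (real^'d::finite) set) \<subseteq> cbox (\<chi> i. - pi) (\<chi> i. pi)"
  by (auto simp: torus_def mem_box_cart less_imp_le)

lemma emeasure_torus: "emeasure lborel (torus :: (real^'d::finite) set) = ennreal ((2 * pi) ^ CARD('d))"
proof (rule antisym)
  have p: "(\<Prod>b\<in>(Basis :: (real^'d) set). ((\<chi> i. pi) - (\<chi> i. - pi)) \<bullet> b) = (2 * pi) ^ CARD('d)"
  proof -
    have "((\<chi> i. pi) - (\<chi> i. - pi)) \<bullet> b = 2 * pi" if "b \<in> (Basis :: (real^'d) set)" for b
      using that by (auto simp: Basis_vec_def inner_axis)
    then show ?thesis by simp
  qed
  have le: "(\<chi> i. - pi) \<bullet> b \<le> (\<chi> i. pi) \<bullet> b" if "b \<in> (Basis :: (real^'d) set)" for b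
    using that by (auto simp: Basis_vec_def inner_axis)
  have "emeasure lborel (torus :: (real^'d) set) \<le> emeasure lborel (cbox (\<chi> i. - pi) (\<chi> i. pi) :: (real^'d) set)"
    by (rule emeasure_mono[OF torus_subset_cbox]) auto
  also have "\<dots> = ennreal ((2 * pi) ^ CARD('d))"
    by (subst emeasure_lborel_cbox) (auto simp: le p)
  finally show "emeasure lborel (torus :: (real^'d) set) \<le> ennreal ((2 * pi) ^ CARD('d))" .
  have "ennreal ((2 * pi) ^ CARD('d)) = emeasure lborel (box (\<chi> i. - pi) (\<chi> i. pi) :: (real^'d) set)"
    by (subst emeasure_lborel_box) (auto simp: le p)
  also have "\<dots> \<le> emeasure lborel (torus :: (real^'d) set)"
    by (rule emeasure_mono[OF box_subset_torus]) auto
  finally show "ennreal ((2 * pi) ^ CARD('d)) \<le> emeasure lborel (torus :: (real^'d) set)" .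
qed

lemma space_torus_measure [simp]: "space torus_measure = torus"
  by (simp add: torus_measure_def space_restrict_space)

lemma finite_measure_torus: "finite_measure (torus_measure :: (real^'d::finite) measure)"
  by (rule finite_measureI)
     (simp add: torus_measure_def space_restrict_space emeasure_restrict_space emeasure_torus)

lemma borel_measurable_torus [measurable (raw)]:
  "f \<in> borel_measurable borel \<Longrightarrow> f \<in> borel_measurable torus_measure"
  by (simp add: torus_measure_def measurable_restrict_space1)

lemma integrable_torus_iff:
  fixes f :: "real^'d::finite \<Rightarrow> 'b::{banach, second_countable_topology}"
  shows "integrable torus_measure f \<longleftrightarrow> set_integrable lborel torus f"
  by (simp add: torus_measure_def set_integrable_restrict_space set_integrable_def integrable_restrict_space)

lemma integral_torus_eq:
  fixes f :: "real^'d::finite \<Rightarrow> 'b::{banach, second_countable_topology}"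
  shows "integral\<^sup>L torus_measure f = (LINT k:torus|lborel. f k)"
  by (simp add: torus_measure_def set_lebesgue_integral_def integral_restrict_space)

definition periodic :: "(real^'d \<Rightarrow> 'b) \<Rightarrow> bool" where
  "periodic \<phi> \<longleftrightarrow> (\<forall>k n. \<phi> (k + (2 * pi) *\<^sub>R rvec n) = \<phi> k)"

lemma periodic_findiff: "periodic \<phi> \<Longrightarrow> periodic (findiff u m \<phi>)"
proof (induction m)
  case 0
  then show ?case by (simp add: periodic_def)
next
  case (Suc m)
  show ?case unfolding periodic_def
  proof (intro allI)
    fix k n
    have "findiff u m \<phi> (k + u + (2 * pi) *\<^sub>R rvec n) = findiff u m \<phi> (k + u)"
      "findiff u m \<phi> (k + (2 * pi) *\<^sub>R rvec n) = findiff u m \<phi> k"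
      using Suc by (auto simp: periodic_def)
    then show "findiff u (Suc m) \<phi> (k + (2 * pi) *\<^sub>R rvec n) = findiff u (Suc m) \<phi> k"
      by (simp add: add.assoc add.commute[of u])
  qed
qed

text \<open>A point of the torus moved by at most 2 \<pi> in each coordinate has its coordinates
  between - 3 \<pi> and 3 \<pi>, so one of these finitely many lattice shifts, and only one, brings
  it back.\<close>

definition unit_shifts :: "(int ^ 'd::finite) set" where
  "unit_shifts = {n. \<forall>i. n $ i \<in> {-1, 0, 1}}"

lemma finite_unit_shifts: "finite (unit_shifts :: (int^'d::finite) set)"
proof -
  have "unit_shifts \<subseteq> vec_lambda ` PiE (UNIV :: 'd set) (\<lambda>_. {-1, 0, 1})"
  proof
    fix n :: "int^'d" assume "n \<in> unit_shifts"
    then have "($) n \<in> PiE UNIV (\<lambda>_. {-1, 0, 1})" by (auto simp: unit_shifts_def)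
    then show "n \<in> vec_lambda ` PiE (UNIV :: 'd set) (\<lambda>_. {-1, 0, 1})"
      by (metis image_eqI vec_lambda_eta)
  qed
  then show ?thesis by (rule finite_subset) (auto intro!: finite_imageI finite_PiE)
qed

lemma torus_residue_ex1:
  fixes t :: real
  assumes "- 3 * pi < t" "t \<le> 3 * pi"
  shows "\<exists>!m::int. m \<in> {-1, 0, 1} \<and> - pi < t + 2 * pi * real_of_int m \<and> t + 2 * pi * real_of_int m \<le> pi"
proof (rule ex_ex1I)
  consider "t \<le> - pi" | "- pi < t" "t \<le> pi" | "pi < t" by linarith
  then show "\<exists>m::int. m \<in> {-1, 0, 1} \<and> - pi < t + 2 * pi * real_of_int m \<and> t + 2 * pi * real_of_int m \<le> pi"
  proof cases
    case 1 then show ?thesis using assms by (intro exI[of _ 1]) auto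
  next
    case 2 then show ?thesis by (intro exI[of _ 0]) auto
  next
    case 3 then show ?thesis using assms by (intro exI[of _ "-1"]) auto
  qed
next
  fix m m' :: int
  assume m: "m \<in> {-1, 0, 1} \<and> - pi < t + 2 * pi * real_of_int m \<and> t + 2 * pi * real_of_int m \<le> pi"
    and m': "m' \<in> {-1, 0, 1} \<and> - pi < t + 2 * pi * real_of_int m' \<and> t + 2 * pi * real_of_int m' \<le> pi"
  have "pi > 0" by simp
  with m m' show "m = m'" by auto
qed

lemma sum_indicator_shifts:
  fixes k :: "real^'d::finite"
  assumes "\<And>i. - 3 * pi < k $ i \<and> k $ i \<le> 3 * pi"
  shows "(\<Sum>n\<in>unit_shifts. indicator torus (k + (2 * pi) *\<^sub>R rvec n)) = (1 :: real)"
proof -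
  define P where "P i m \<longleftrightarrow> m \<in> {-1, 0, 1} \<and> - pi < k $ i + 2 * pi * real_of_int m \<and> k $ i + 2 * pi * real_of_int m \<le> pi" for i and m :: int
  have ex: "\<exists>!m. P i m" for i unfolding P_def by (rule torus_residue_ex1) (use assms[of i] in simp_all)
  define n0 :: "int^'d" where "n0 = (\<chi> i. THE m. P i m)"
  have P0: "P i (n0 $ i)" for i unfolding n0_def using theI'[OF ex] by simp
  have iff: "n \<in> unit_shifts \<and> k + (2 * pi) *\<^sub>R rvec n \<in> torus \<longleftrightarrow> n = n0" for n
  proof -
    have "n \<in> unit_shifts \<and> k + (2 * pi) *\<^sub>R rvec n \<in> torus \<longleftrightarrow> (\<forall>i. P i (n $ i))"
      by (auto simp: unit_shifts_def torus_def P_def)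
    also have "\<dots> \<longleftrightarrow> (\<forall>i. n $ i = n0 $ i)" using ex P0 by metis
    finally show ?thesis by (simp add: vec_eq_iff)
  qed
  have "(\<Sum>n\<in>unit_shifts. indicator torus (k + (2 * pi) *\<^sub>R rvec n)) = (\<Sum>n\<in>unit_shifts. if n = n0 then 1 else 0 :: real)"
    by (rule sum.cong) (use iff in \<open>auto simp: indicator_def\<close>)
  also have "\<dots> = 1" using iff[of n0] by (simp add: finite_unit_shifts)
  finally show ?thesis .
qed

lemma unit_shifts_uminus: "uminus ` unit_shifts = unit_shifts"
proof -
  have "- n \<in> unit_shifts" if "n \<in> unit_shifts" for n :: "int^'d"
    using that by (force simp: unit_shifts_def)
  then show ?thesis by (metis (no_types, lifting) image_eqI minus_minus subsetI subset_antisym image_subsetI)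
qed

lemma sum_indicator_shifts_minus:
  fixes k :: "real^'d::finite"
  assumes "\<And>i. - 3 * pi < k $ i \<and> k $ i \<le> 3 * pi"
  shows "(\<Sum>n\<in>unit_shifts. indicator torus (k - (2 * pi) *\<^sub>R rvec n)) = (1 :: real)"
proof -
  have "(\<Sum>n\<in>uminus ` unit_shifts. indicator torus (k - (2 * pi) *\<^sub>R rvec n))
    = (\<Sum>n\<in>unit_shifts. indicator torus (k + (2 * pi) *\<^sub>R rvec n) :: real)"
    by (subst sum.reindex) (auto simp: rvec_minus o_def)
  then show ?thesis unfolding unit_shifts_uminus sum_indicator_shifts[OF assms] .
qed

text \<open>
  Both the torus and its translate are fundamental domains; cutting either one along the other
  gives pieces that match up to lattice translations.
\<close>
lemma torus_translate:
  fixes \<phi> :: "real^'d::finite \<Rightarrow> 'b::{banach, second_countable_topology}"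
  assumes per: "periodic \<phi>" and int: "integrable torus_measure \<phi>"
    and u: "\<And>i. \<bar>u $ i\<bar> \<le> 2 * pi"
  shows integrable_torus_translate: "integrable torus_measure (\<lambda>k. \<phi> (k + u))"
    and integral_torus_translate: "(\<integral>k. \<phi> (k + u) \<partial>torus_measure) = (\<integral>k. \<phi> k \<partial>torus_measure)"
proof -
  let ?T = "torus :: (real^'d) set"
  define p :: "int^'d \<Rightarrow> real^'d" where "p n = (2 * pi) *\<^sub>R rvec n" for n
  have per': "\<phi> (k + p n) = \<phi> k" for k n using per by (simp add: periodic_def p_def)
  \<comment> \<open>\<open>h n\<close> is \<phi> on the part of the torus which the shift by
    \<open>p n\<close> carries into the translated torus. Summed over n these parts exhaust the
    torus; summed after the shifts they exhaust the translate.\<close>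
  define h where "h n k = indicator ?T (k + p n - u) *\<^sub>R (indicator ?T k *\<^sub>R \<phi> k)" for n k
  have T: "set_integrable lborel ?T \<phi>" using int by (simp add: integrable_torus_iff)
  have h_int: "integrable lborel (h n)" for n
  proof -
    have "{k. k + p n - u \<in> ?T} \<in> sets borel" by measurable
    then have "integrable lborel (\<lambda>k. indicator {k. k + p n - u \<in> ?T} k *\<^sub>R (indicator ?T k *\<^sub>R \<phi> k))"
      using T by (intro integrable_mult_indicator[where f="\<lambda>k. indicator ?T k *\<^sub>R \<phi> k"]) (auto simp: set_integrable_def)
    then show ?thesis unfolding h_def[abs_def] by (rule Bochner_Integration.integrable_cong[THEN iffD1, rotated 2]) (auto split: split_indicator)
  qed
  have sum1: "(\<Sum>n\<in>unit_shifts. h n k) = indicator ?T k *\<^sub>R \<phi> k" for k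
  proof (cases "k \<in> ?T")
    case True
    have rng: "- 3 * pi < (k - u) $ i \<and> (k - u) $ i \<le> 3 * pi" for i
      using True u[of i] unfolding torus_def by (simp add: abs_le_iff) (smt (verit))
    have "(\<Sum>n\<in>unit_shifts. h n k) = (\<Sum>n\<in>unit_shifts. indicator ?T (k - u + p n)) *\<^sub>R (indicator ?T k *\<^sub>R \<phi> k)"
      unfolding h_def scaleR_sum_left by (simp add: algebra_simps)
    then show ?thesis using sum_indicator_shifts[OF rng] by (simp add: p_def)
  qed (simp add: h_def)
  have sum2: "(\<Sum>n\<in>unit_shifts. h n (k - p n)) = indicator ?T (k - u) *\<^sub>R \<phi> k" for k
  proof (cases "k - u \<in> ?T")
    case True
    have rng: "- 3 * pi < k $ i \<and> k $ i \<le> 3 * pi" for i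
      using True u[of i] unfolding torus_def by (simp add: abs_le_iff) (smt (verit))
    have "\<phi> (k - p n) = \<phi> k" for n using per'[of "k - p n" n] by simp
    then have "(\<Sum>n\<in>unit_shifts. h n (k - p n)) = (\<Sum>n\<in>unit_shifts. indicator ?T (k - p n)) *\<^sub>R (indicator ?T (k - u) *\<^sub>R \<phi> k)"
      unfolding h_def scaleR_sum_left by (simp add: algebra_simps)
    then show ?thesis using sum_indicator_shifts_minus[OF rng] by (simp add: p_def)
  qed (simp add: h_def)
  have hs_int: "integrable lborel (\<lambda>k. h n (k - p n))" for n
    using h_int[of n] integrable_lborel_translate_iff[of "h n" "- p n"] by simp
  have "integrable lborel (\<lambda>k. indicator ?T (k - u) *\<^sub>R \<phi> k)"
    unfolding sum2[symmetric] by (intro Bochner_Integration.integrable_sum hs_int)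
  then have "integrable lborel (\<lambda>k. indicator ?T k *\<^sub>R \<phi> (k + u))"
    using integrable_lborel_translate_iff[of "\<lambda>k. indicator ?T (k - u) *\<^sub>R \<phi> k" u] by simp
  then show "integrable torus_measure (\<lambda>k. \<phi> (k + u))"
    by (simp add: integrable_torus_iff set_integrable_def)
  have "(\<integral>k. indicator ?T k *\<^sub>R \<phi> (k + u) \<partial>lborel) = (\<integral>k. indicator ?T (k - u) *\<^sub>R \<phi> k \<partial>lborel)"
    using integral_lborel_translate[of "\<lambda>k. indicator ?T (k - u) *\<^sub>R \<phi> k" u] by simp
  also have "\<dots> = (\<Sum>n\<in>unit_shifts. \<integral>k. h n (k - p n) \<partial>lborel)"
    unfolding sum2[symmetric] by (intro Bochner_Integration.integral_sum hs_int)
  also have "\<dots> = (\<Sum>n\<in>unit_shifts. \<integral>k. h n k \<partial>lborel)"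
    using integral_lborel_translate[of "h n" "- p n" for n] by simp
  also have "\<dots> = (\<integral>k. indicator ?T k *\<^sub>R \<phi> k \<partial>lborel)"
    unfolding sum1[symmetric] by (intro Bochner_Integration.integral_sum[symmetric] h_int)
  finally show "(\<integral>k. \<phi> (k + u) \<partial>torus_measure) = (\<integral>k. \<phi> k \<partial>torus_measure)"
    by (simp add: integral_torus_eq set_lebesgue_integral_def)
qed

section \<open>Fourier series\<close>

definition wave :: "int^'d::finite \<Rightarrow> real^'d \<Rightarrow> complex" where
  "wave x k = exp (\<i> * complex_of_real (k \<bullet> rvec x))"

lemma norm_wave [simp]: "norm (wave x k) = 1"
  by (simp add: wave_def)

lemma wave_add: "wave x (k + l) = wave x k * wave x l"
  by (simp add: wave_def inner_add_left exp_add[symmetric] algebra_simps)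

lemma wave_plus: "wave (x + y) k = wave x k * wave y k"
  using rvec_diff[of x "-y"] by (simp add: wave_def rvec_minus inner_add_right exp_add[symmetric] algebra_simps)

lemma wave_0 [simp]: "wave 0 k = 1"
  by (simp add: wave_def)

lemma wave_minus: "wave (- x) k = cnj (wave x k)"
  by (simp add: wave_def rvec_minus exp_cnj)

lemma wave_minus_eq: "wave (- x) k = exp (- \<i> * complex_of_real (k \<bullet> rvec x))"
  by (simp add: wave_def rvec_minus)

lemma continuous_on_wave [continuous_intros]: "continuous_on S (wave x)"
  unfolding wave_def by (intro continuous_intros)

lemma borel_measurable_wave [measurable]: "wave x \<in> borel_measurable borel"
  by (intro borel_measurable_continuous_onI continuous_on_wave)

lemma periodic_wave: "periodic (wave x)"
proof -
  have "wave x ((2 * pi) *\<^sub>R rvec n) = 1" for n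
  proof -
    have "rvec n \<bullet> rvec x = of_int (\<Sum>i\<in>UNIV. n $ i * x $ i)"
      by (simp add: inner_vec_def)
    then have "\<i> * complex_of_real ((2 * pi) *\<^sub>R rvec n \<bullet> rvec x) = of_int (2 * (\<Sum>i\<in>UNIV. n $ i * x $ i)) * pi * \<i>"
      by (simp del: of_int_sum)
    then show ?thesis unfolding wave_def
      by (subst exp_eq_1) (auto simp del: of_int_sum intro!: exI[of _ "\<Sum>i\<in>UNIV. n $ i * x $ i"])
  qed
  then show ?thesis by (simp add: periodic_def wave_add)
qed

section \<open>Half-period translations and Fourier integrals\<close>

definition half_period :: "int^'d::finite \<Rightarrow> real^'d" where
  "half_period x = (pi / (enorm x)\<^sup>2) *\<^sub>R rvec x"

lemma wave_half_period:
  assumes "x \<noteq> 0" shows "wave x (half_period x) = - 1"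
proof -
  have "enorm x \<noteq> 0" using enorm_ge_1[OF assms] by auto
  then have "half_period x \<bullet> rvec x = pi"
    by (simp add: half_period_def enorm_def power2_norm_eq_inner[symmetric] del: norm_eq_zero)
  then show ?thesis by (simp add: wave_def)
qed

lemma norm_half_period:
  assumes "x \<noteq> 0" shows "norm (half_period x) = pi / enorm x"
  using enorm_ge_1[OF assms] by (simp add: half_period_def enorm_def power2_eq_square)

lemma abs_half_period_nth:
  assumes "x \<noteq> 0" shows "\<bar>half_period x $ i\<bar> \<le> 2 * pi"
proof -
  have "\<bar>half_period x $ i\<bar> \<le> pi / enorm x"
    using component_le_norm_cart[of "half_period x" i] norm_half_period[OF assms] by simp
  also have "\<dots> \<le> 2 * pi" using enorm_ge_1[OF assms] by (simp add: field_simps)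
  finally show ?thesis .
qed

lemma integrable_wave_mult:
  assumes "integrable M \<phi>" "wave x \<in> borel_measurable M"
  shows "integrable M (\<lambda>k. \<phi> k * wave x k)"
  by (rule Bochner_Integration.integrable_bound[OF assms(1)]) (use assms in \<open>auto simp: norm_mult\<close>)

text \<open>Translating by the half-period leaves the integral of a periodic function unchanged and
  flips the sign of the wave. Each difference therefore contributes the shifted term with factor -1
  and the unshifted one with another -1, in total -2.\<close>

lemma findiff_torus_integral:
  fixes \<phi> :: "real^'d::finite \<Rightarrow> complex"
  assumes per: "periodic \<phi>" and int: "integrable torus_measure \<phi>" and x: "x \<noteq> 0"
  shows integrable_torus_findiff: "integrable torus_measure (findiff (half_period x) m \<phi>)"
    and integral_torus_findiff: "(\<integral>k. findiff (half_period x) m \<phi> k * wave (- x) k \<partial>torus_measure)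
      = (-2) ^ m * (\<integral>k. \<phi> k * wave (- x) k \<partial>torus_measure)"
proof (induction m)
  case 0
  { case 1 then show ?case using int by (simp add: fun_eq_iff cong: Bochner_Integration.integrable_cong) }
  { case 2 then show ?case by simp }
next
  case (Suc m)
  let ?u = "half_period x"
  note u = abs_half_period_nth[OF x]
  have per': "periodic (findiff ?u m \<phi>)" by (rule periodic_findiff[OF per])
  have int': "integrable torus_measure (findiff ?u m \<phi>)" by (rule Suc.IH(1))
  have sint: "integrable torus_measure (\<lambda>k. findiff ?u m \<phi> (k + ?u))"
    by (rule integrable_torus_translate[OF per' int' u])
  { case 1
    show ?case using Bochner_Integration.integrable_diff[OF sint int'] by simp }
  { case 2
    have wm: "wave (- x) \<in> borel_measurable torus_measure" by measurable
    have per2: "periodic (\<lambda>k. findiff ?u m \<phi> k * wave (- x) k)"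
      using per' periodic_wave[of "- x"] by (auto simp: periodic_def)
    have tr: "(\<integral>k. findiff ?u m \<phi> (k + ?u) * wave (- x) (k + ?u) \<partial>torus_measure)
       = (\<integral>k. findiff ?u m \<phi> k * wave (- x) k \<partial>torus_measure)"
      by (rule integral_torus_translate[OF per2 integrable_wave_mult[OF int' wm] u])
    have w: "wave (- x) (k + ?u) = - wave (- x) k" for k
      by (simp add: wave_minus wave_add wave_half_period[OF x])
    have "(\<integral>k. findiff ?u (Suc m) \<phi> k * wave (- x) k \<partial>torus_measure)
      = (\<integral>k. findiff ?u m \<phi> (k + ?u) * wave (- x) k - findiff ?u m \<phi> k * wave (- x) k \<partial>torus_measure)"
      by (simp add: left_diff_distrib)
    also have "\<dots> = (\<integral>k. findiff ?u m \<phi> (k + ?u) * wave (- x) k \<partial>torus_measure)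
        - (\<integral>k. findiff ?u m \<phi> k * wave (- x) k \<partial>torus_measure)"
      by (intro Bochner_Integration.integral_diff integrable_wave_mult sint int' wm)
    also have "(\<integral>k. findiff ?u m \<phi> (k + ?u) * wave (- x) k \<partial>torus_measure)
       = - (\<integral>k. findiff ?u m \<phi> k * wave (- x) k \<partial>torus_measure)"
      using tr[unfolded w mult_minus_right Bochner_Integration.integral_minus, THEN minus_equation_iff[THEN iffD1], symmetric] .
    finally show ?case using Suc.IH(2) by simp }
qed

text \<open>The same computation with translation invariance of Lebesgue measure in place of
  periodicity. It is applied to Gaussians, since 1 / |k|^2 itself is not integrable over the whole
  space.\<close>

lemma findiff_lborel_integral:
  fixes \<phi> :: "real^'d::finite \<Rightarrow> complex"
  assumes int: "integrable lborel \<phi>" and x: "x \<noteq> 0"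
  shows integrable_lborel_findiff: "integrable lborel (findiff (half_period x) m \<phi>)"
    and integral_lborel_findiff: "(\<integral>k. findiff (half_period x) m \<phi> k * wave (- x) k \<partial>lborel)
      = (-2) ^ m * (\<integral>k. \<phi> k * wave (- x) k \<partial>lborel)"
proof (induction m)
  case 0
  { case 1 then show ?case using int by (simp add: fun_eq_iff cong: Bochner_Integration.integrable_cong) }
  { case 2 then show ?case by simp }
next
  case (Suc m)
  let ?u = "half_period x"
  have int': "integrable lborel (findiff ?u m \<phi>)" by (rule Suc.IH(1))
  have sint: "integrable lborel (\<lambda>k. findiff ?u m \<phi> (k + ?u))"
    using int' by (subst integrable_lborel_translate_iff)
  { case 1
    show ?case using Bochner_Integration.integrable_diff[OF sint int'] by simp }
  { case 2
    have wm: "wave (- x) \<in> borel_measurable lborel" by measurable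
    have tr: "(\<integral>k. findiff ?u m \<phi> (k + ?u) * wave (- x) (k + ?u) \<partial>lborel)
       = (\<integral>k. findiff ?u m \<phi> k * wave (- x) k \<partial>lborel)"
      by (rule integral_lborel_translate)
    have w: "wave (- x) (k + ?u) = - wave (- x) k" for k
      by (simp add: wave_minus wave_add wave_half_period[OF x])
    have "(\<integral>k. findiff ?u (Suc m) \<phi> k * wave (- x) k \<partial>lborel)
      = (\<integral>k. findiff ?u m \<phi> (k + ?u) * wave (- x) k - findiff ?u m \<phi> k * wave (- x) k \<partial>lborel)"
      by (simp add: left_diff_distrib)
    also have "\<dots> = (\<integral>k. findiff ?u m \<phi> (k + ?u) * wave (- x) k \<partial>lborel)
        - (\<integral>k. findiff ?u m \<phi> k * wave (- x) k \<partial>lborel)"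
      by (intro Bochner_Integration.integral_diff integrable_wave_mult sint int' wm)
    also have "(\<integral>k. findiff ?u m \<phi> (k + ?u) * wave (- x) k \<partial>lborel)
       = - (\<integral>k. findiff ?u m \<phi> k * wave (- x) k \<partial>lborel)"
      using tr[unfolded w mult_minus_right Bochner_Integration.integral_minus, THEN minus_equation_iff[THEN iffD1], symmetric] .
    finally show ?case using Suc.IH(2) by simp }
qed

lemma integrable_torus_bounded:
  fixes \<phi> :: "real^'d::finite \<Rightarrow> 'b::{banach, second_countable_topology}"
  assumes "\<phi> \<in> borel_measurable torus_measure" "\<And>k. norm (\<phi> k) \<le> B"
  shows "integrable torus_measure \<phi>"
  using finite_measure.integrable_const_bound[OF finite_measure_torus, of \<phi> B] assms by auto

text \<open>For nonzero x a half-period translation turns the integral into its own negative; no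
  product formula is involved.\<close>

lemma integral_wave_torus:
  "(\<integral>k. wave x k \<partial>(torus_measure :: (real^'d::finite) measure)) = (if x = 0 then (2 * pi) ^ CARD('d) else 0)"
proof (cases "x = 0")
  case True
  have "measure (torus_measure :: (real^'d) measure) torus = (2 * pi) ^ CARD('d)"
    unfolding measure_def by (simp add: torus_measure_def emeasure_restrict_space emeasure_torus)
  then show ?thesis using True by (simp add: scaleR_conv_of_real)
next
  case False
  have int: "integrable torus_measure (wave x)"
    by (rule integrable_torus_bounded[where B=1]) ((measurable)[1], simp)
  have "(\<integral>k. wave x (k + half_period x) \<partial>torus_measure) = (\<integral>k. wave x k \<partial>torus_measure)"
    by (rule integral_torus_translate[OF periodic_wave int abs_half_period_nth[OF False]])
  then show ?thesis using False by (simp add: wave_add wave_half_period)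
qed

section \<open>Absolutely convergent Fourier series\<close>

definition fseries :: "(int^'d::finite \<Rightarrow> complex) \<Rightarrow> real^'d \<Rightarrow> complex" where
  "fseries c k = (\<Sum>\<^sub>\<infinity>x. c x * wave x k)"

lemma fourier_eq_fseries: "fourier f = fseries (\<lambda>x. complex_of_real (f x))"
  by (simp add: fourier_def fseries_def wave_def fun_eq_iff)

text \<open>Absolute summability permits integration term by term, and orthogonality of the waves
  leaves a single term. The auxiliary facts carry an extra factor \<open>wave y\<close> so that they
  serve both the series itself, where y = 0, and its coefficients.\<close>

lemma fseries_measurable:
  fixes c :: "int^'d::finite \<Rightarrow> complex"
  assumes c: "(\<lambda>x. norm (c x)) summable_on UNIV"
  shows integrable_fseries: "integrable torus_measure (fseries c)"
    and norm_fseries_le: "norm (fseries c k) \<le> (\<Sum>\<^sub>\<infinity>x. norm (c x))"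
    and fseries_has_sum: "((\<lambda>x. c x * wave x k) has_sum fseries c k) UNIV"
    and fseries_coeff: "(\<integral>k. fseries c k * wave (- y) k \<partial>torus_measure) = (2 * pi) ^ CARD('d) * c y"
proof -
  interpret finite_measure "torus_measure :: (real^'d) measure" by (rule finite_measure_torus)
  have wint: "integrable torus_measure (\<lambda>k. c x * wave x k * wave y k)" for x y
    by (rule integrable_torus_bounded[where B="norm (c x)"]) ((measurable)[1], simp add: norm_mult)
  have s1: "(\<lambda>x. \<integral>k. norm (c x * wave x k * wave y k) \<partial>torus_measure) summable_on UNIV" for y
    using summable_on_cmult_right[OF c] by (simp add: norm_mult)
  have s2: "(\<lambda>x. norm (c x * wave x k * wave y k)) summable_on UNIV" for k y
    using c by (simp add: norm_mult)
  have "integrable torus_measure (\<lambda>k. \<Sum>\<^sub>\<infinity>x. c x * wave x k * wave 0 k)"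
    by (rule integrable_infsum[OF wint s1 s2])
  then show "integrable torus_measure (fseries c)" by (simp add: fseries_def[abs_def])
  have summ: "(\<lambda>x. c x * wave x k) summable_on UNIV" for k
    by (rule abs_summable_summable) (use c in \<open>simp add: norm_mult\<close>)
  show "((\<lambda>x. c x * wave x k) has_sum fseries c k) UNIV"
    unfolding fseries_def using summ by simp
  show "norm (fseries c k) \<le> (\<Sum>\<^sub>\<infinity>x. norm (c x))"
    using norm_infsum_bound[of "\<lambda>x. c x * wave x k" UNIV] s2[of k 0] by (simp add: fseries_def norm_mult)
  have eq: "(\<Sum>\<^sub>\<infinity>x. c x * wave x k * wave (- y) k) = fseries c k * wave (- y) k" for k
    unfolding fseries_def by (rule infsum_cmult_left')
  have "((\<lambda>x. \<integral>k. c x * wave x k * wave (- y) k \<partial>torus_measure) has_sum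
      (\<integral>k. fseries c k * wave (- y) k \<partial>torus_measure)) UNIV"
    using integral_has_sum[OF wint s1 s2, of "- y"] unfolding eq .
  moreover have "(\<integral>k. c x * wave x k * wave (- y) k \<partial>torus_measure) = (if x = y then (2 * pi) ^ CARD('d) * c y else 0)" for x
  proof -
    have "(\<integral>k. c x * wave x k * wave (- y) k \<partial>torus_measure) = (\<integral>k. c x * wave (x + - y) k \<partial>torus_measure)"
      by (simp only: wave_plus mult.assoc)
    also have "\<dots> = c x * (if x + - y = 0 then (2 * pi) ^ CARD('d) else 0)"
      by (simp only: integral_mult_right_zero integral_wave_torus)
    finally show ?thesis by auto
  qed
  ultimately have "((\<lambda>x. if x = y then (2 * pi) ^ CARD('d) * c y else 0) has_sum
      (\<integral>k. fseries c k * wave (- y) k \<partial>torus_measure)) UNIV" by simp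
  moreover have "((\<lambda>x. if x = y then (2 * pi) ^ CARD('d) * c y else 0) has_sum ((2 * pi) ^ CARD('d) * c y)) UNIV"
    using has_sum_finite[of "{y}" "\<lambda>x. if x = y then (2 * pi) ^ CARD('d) * c y else 0"]
    by (subst has_sum_cong_neutral[where T="{y}"]) auto
  ultimately show "(\<integral>k. fseries c k * wave (- y) k \<partial>torus_measure) = (2 * pi) ^ CARD('d) * c y"
    by (rule has_sum_unique)
qed

text \<open>For absolutely summable coefficients Parseval needs no completeness argument: |f|^2 is
  the sum of the terms c x * wave x times the conjugate of f, which can be integrated one by one,
  and each integral is a conjugated coefficient.\<close>

lemma fseries_parseval:
  fixes c :: "int^'d::finite \<Rightarrow> complex"
  assumes c: "(\<lambda>x. norm (c x)) summable_on UNIV"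
  shows "integrable torus_measure (\<lambda>k. (norm (fseries c k))\<^sup>2)"
    and "((\<lambda>x. (2 * pi) ^ CARD('d) * (norm (c x))\<^sup>2) has_sum (\<integral>k. (norm (fseries c k))\<^sup>2 \<partial>torus_measure)) UNIV"
proof -
  interpret finite_measure "torus_measure :: (real^'d) measure" by (rule finite_measure_torus)
  define B where "B = (\<Sum>\<^sub>\<infinity>x. norm (c x))"
  note fm[measurable] = borel_measurable_integrable[OF integrable_fseries[OF c]]
  have [measurable]: "(\<lambda>k. cnj (fseries c k)) \<in> borel_measurable torus_measure"
    by (rule measurable_compose[OF fm borel_measurable_continuous_onI]) (intro continuous_intros)
  have fB: "norm (fseries c k) \<le> B" for k unfolding B_def by (rule norm_fseries_le[OF c])
  show int: "integrable torus_measure (\<lambda>k. (norm (fseries c k))\<^sup>2)"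
    by (rule integrable_torus_bounded[where B="B\<^sup>2"]) ((measurable)[1], simp add: fB power_mono)
  have 1: "integrable torus_measure (\<lambda>k. c x * wave x k * cnj (fseries c k))" for x
  proof (rule integrable_torus_bounded[where B="norm (c x) * B"])
    show "(\<lambda>k. c x * wave x k * cnj (fseries c k)) \<in> borel_measurable torus_measure" by measurable
    show "norm (c x * wave x k * cnj (fseries c k)) \<le> norm (c x) * B" for k
      using mult_left_mono[OF fB[of k] norm_ge_zero[of "c x"]] by (simp add: norm_mult)
  qed
  have 2: "(\<lambda>x. \<integral>k. norm (c x * wave x k * cnj (fseries c k)) \<partial>torus_measure) summable_on UNIV"
  proof -
    have "(\<integral>k. norm (c x * wave x k * cnj (fseries c k)) \<partial>torus_measure) = norm (c x) * (\<integral>k. norm (fseries c k) \<partial>torus_measure)" for x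
      by (simp add: norm_mult)
    then show ?thesis using summable_on_cmult_left[OF c] by simp
  qed
  have 3: "(\<lambda>x. norm (c x * wave x k * cnj (fseries c k))) summable_on UNIV" for k
    using summable_on_cmult_left[OF c] by (simp add: norm_mult)
  have eq: "(\<Sum>\<^sub>\<infinity>x. c x * wave x k * cnj (fseries c k)) = complex_of_real ((norm (fseries c k))\<^sup>2)" for k
    by (simp only: infsum_cmult_left' fseries_def[symmetric] complex_norm_square)
  have "((\<lambda>x. \<integral>k. c x * wave x k * cnj (fseries c k) \<partial>torus_measure) has_sum
      (\<integral>k. complex_of_real ((norm (fseries c k))\<^sup>2) \<partial>torus_measure)) UNIV"
    using integral_has_sum[OF 1 2 3] unfolding eq .
  moreover have "(\<integral>k. c x * wave x k * cnj (fseries c k) \<partial>torus_measure) = complex_of_real ((2 * pi) ^ CARD('d) * (norm (c x))\<^sup>2)" for x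
  proof -
    have "(\<integral>k. c x * wave x k * cnj (fseries c k) \<partial>torus_measure) = c x * (\<integral>k. cnj (fseries c k * wave (- x) k) \<partial>torus_measure)"
      unfolding Bochner_Integration.integral_mult_right_zero[symmetric]
      by (intro Bochner_Integration.integral_cong refl) (simp add: wave_minus)
    also have "\<dots> = c x * cnj (\<integral>k. fseries c k * wave (- x) k \<partial>torus_measure)"
      by (subst Bochner_Integration.integral_cnj) simp
    also have "\<dots> = complex_of_real ((2 * pi) ^ CARD('d) * (norm (c x))\<^sup>2)"
      unfolding fseries_coeff[OF c] of_real_mult complex_norm_square by (simp add: mult.left_commute)
    finally show ?thesis .
  qed
  ultimately have "((\<lambda>x. complex_of_real ((2 * pi) ^ CARD('d) * (norm (c x))\<^sup>2)) has_sum
      complex_of_real (\<integral>k. (norm (fseries c k))\<^sup>2 \<partial>torus_measure)) UNIV"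
    by (simp only: integral_complex_of_real)
  then show "((\<lambda>x. (2 * pi) ^ CARD('d) * (norm (c x))\<^sup>2) has_sum (\<integral>k. (norm (fseries c k))\<^sup>2 \<partial>torus_measure)) UNIV"
    using has_sum_Re by fastforce
qed

text \<open>A difference acts on coefficients as multiplication by exp (i u.x) - 1, of size at most
  |u| |x|. This is how decay of the coefficients is converted into powers of |u|.\<close>

lemma findiff_fseries:
  assumes c: "(\<lambda>x. norm (c x)) summable_on UNIV"
  shows "findiff u m (fseries c) k = fseries (\<lambda>x. c x * (wave x u - 1) ^ m) k"
    and "(\<lambda>x. norm (c x * (wave x u - 1) ^ m)) summable_on UNIV"
proof -
  have s: "(\<lambda>x. norm (c x * (wave x u - 1) ^ m)) summable_on UNIV" for m
  proof (rule summable_on_comparison_test[OF summable_on_cmult_left[OF c, of "2 ^ m"]])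
    fix x
    have "norm (wave x u - 1) \<le> 2" using norm_triangle_ineq4[of "wave x u" 1] by simp
    then show "norm (c x * (wave x u - 1) ^ m) \<le> norm (c x) * 2 ^ m"
      by (auto simp: norm_mult norm_power intro!: mult_left_mono power_mono)
  qed simp
  then show "(\<lambda>x. norm (c x * (wave x u - 1) ^ m)) summable_on UNIV" .
  show "findiff u m (fseries c) k = fseries (\<lambda>x. c x * (wave x u - 1) ^ m) k"
  proof (induction m arbitrary: k)
    case 0
    then show ?case by simp
  next
    case (Suc m)
    let ?c = "\<lambda>x. c x * (wave x u - 1) ^ m"
    have "((\<lambda>x. - (?c x * wave x k)) has_sum - fseries ?c k) UNIV"
      using fseries_has_sum[OF s, of m k] by (simp add: has_sum_uminus)
    from has_sum_add[OF fseries_has_sum[OF s, of m "k + u"] this]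
    have "((\<lambda>x. ?c x * wave x (k + u) - ?c x * wave x k) has_sum fseries ?c (k + u) - fseries ?c k) UNIV"
      by simp
    then have "((\<lambda>x. c x * (wave x u - 1) ^ Suc m * wave x k) has_sum fseries ?c (k + u) - fseries ?c k) UNIV"
      by (rule has_sum_cong[THEN iffD1, rotated]) (simp add: wave_add algebra_simps)
    then show ?case using infsumI by (fastforce simp: Suc.IH fseries_def[of "\<lambda>x. c x * (wave x u - 1) ^ Suc m"] simp del: power_Suc)
  qed
qed

lemma has_sum_sum_finite:
  fixes f :: "'i \<Rightarrow> 'a \<Rightarrow> real"
  assumes "finite I" "\<And>i. i \<in> I \<Longrightarrow> f i summable_on A"
  shows "((\<lambda>x. \<Sum>i\<in>I. f i x) has_sum (\<Sum>i\<in>I. infsum (f i) A)) A"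
  using assms by (induction I) (auto intro!: has_sum_add has_sum_infsum)

lemma infsum_minus:
  fixes f g :: "'a \<Rightarrow> real"
  assumes "f summable_on A" "g summable_on A"
  shows "infsum (\<lambda>x. f x - g x) A = infsum f A - infsum g A"
  using infsum_add[of f A "\<lambda>x. - g x"] assms by (simp add: infsum_uminus summable_on_uminus)

section \<open>The symbol of a lattice kernel\<close>

text \<open>Interpolates between the orders 2 and 4: for |a| <= 1 the fourth-order remainder is at
  most |a|^(2 + s), and for larger |a| the trivial bounds on the cosine suffice. The constant 3 is
  crude but covers both.\<close>

lemma cos_taylor_bound:
  fixes a s :: real
  assumes "0 \<le> s" "s \<le> 2"
  shows "\<bar>cos a - 1 + a\<^sup>2 / 2\<bar> \<le> 3 * \<bar>a\<bar> powr (2 + s)"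
proof (cases "\<bar>a\<bar> \<le> 1")
  case True
  obtain t where "cos a = (\<Sum>m<4. cos_coeff m * a ^ m) + (cos t / fact 4) * a ^ 4"
    using Maclaurin_cos_expansion[of a 4] by auto
  moreover have "(\<Sum>m<4. cos_coeff m * a ^ m) = 1 - a\<^sup>2 / 2"
    by (simp add: cos_coeff_def eval_nat_numeral) (simp flip: numeral_2_eq_2 numeral_3_eq_3)
  ultimately have "\<bar>cos a - 1 + a\<^sup>2 / 2\<bar> = \<bar>cos t\<bar> / 24 * a ^ 4"
    by (simp add: abs_mult fact_numeral)
  also have "\<dots> \<le> 3 * a ^ 4"
    using abs_cos_le_one[of t] by (intro mult_right_mono) (linarith, simp)
  also have "a ^ 4 \<le> \<bar>a\<bar> powr (2 + s)"
  proof (cases "a = 0")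
    case False
    have "a ^ 4 = \<bar>a\<bar> powr 4" using False by (simp add: powr_numeral)
    also have "\<dots> \<le> \<bar>a\<bar> powr (2 + s)" by (rule powr_mono') (use True assms in auto)
    finally show ?thesis .
  qed simp
  finally show ?thesis by simp
next
  case False
  have "a\<^sup>2 = \<bar>a\<bar> powr 2" using False by (simp add: powr_numeral)
  also have "\<dots> \<le> \<bar>a\<bar> powr (2 + s)" by (rule powr_mono) (use False assms in auto)
  finally have 1: "a\<^sup>2 \<le> \<bar>a\<bar> powr (2 + s)" .
  have "1 \<le> a\<^sup>2" using False by (metis abs_le_square_iff abs_one linorder_linear one_power2)
  then show ?thesis using 1 cos_ge_minus_one[of a] cos_le_one[of a] unfolding abs_le_iff by linarith
qed

text \<open>The sum-to-product formula leaves two sines. With a = k.x and b = u.x the bound is (|k|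
  + |u|) |u| |x|^2: it keeps a factor of the size of k, which the Lipschitz bound |b| would lose,
  and still costs just a second moment.\<close>

lemma abs_cos_add_diff_le:
  fixes a b :: real
  shows "\<bar>cos (a + b) - cos a\<bar> \<le> (\<bar>a\<bar> + \<bar>b\<bar>) * \<bar>b\<bar>"
proof -
  have "\<bar>cos (a + b) - cos a\<bar> = 2 * (\<bar>sin ((a + b + a) / 2)\<bar> * \<bar>sin (b / 2)\<bar>)"
    by (subst cos_diff_cos) (simp add: abs_mult)
  also have "\<dots> \<le> 2 * (\<bar>(a + b + a) / 2\<bar> * \<bar>b / 2\<bar>)"
    by (intro mult_left_mono mult_mono abs_sin_x_le_abs_x) auto
  also have "\<dots> = \<bar>a + b + a\<bar> / 2 * \<bar>b\<bar>" by (simp add: abs_mult)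
  also have "\<dots> \<le> (\<bar>a\<bar> + \<bar>b\<bar>) * \<bar>b\<bar>" by (intro mult_right_mono) auto
  finally show ?thesis .
qed

lemma norm_wave_diff_one:
  shows "norm (wave x u - 1) \<le> 2" and "norm (wave x u - 1) \<le> norm u * enorm x"
proof -
  show "norm (wave x u - 1) \<le> 2" using norm_triangle_ineq4[of "wave x u" 1] by simp
  have "norm (wave x u - 1) = 2 * \<bar>sin (u \<bullet> rvec x / 2)\<bar>"
    unfolding wave_def by (rule dist_exp_i_1)
  also have "\<dots> \<le> 2 * \<bar>u \<bullet> rvec x / 2\<bar>" by (intro mult_left_mono abs_sin_x_le_abs_x) auto
  also have "\<dots> \<le> norm u * enorm x" unfolding enorm_def using Cauchy_Schwarz_ineq2[of u "rvec x"] by simp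
  finally show "norm (wave x u - 1) \<le> norm u * enorm x" .
qed

section \<open>Consequences of the lattice symmetry\<close>

lemma lattice_symmetric_uminus:
  assumes "lattice_symmetric f" shows "f (- x) = f x"
proof -
  have "f (\<chi> i. (-1) * x $ id i) = f x"
    by (rule assms[unfolded lattice_symmetric_def, rule_format], rule bij_id) simp
  moreover have "(\<chi> i. (-1) * x $ id i) = - x" by (simp add: vec_eq_iff)
  ultimately show ?thesis by simp
qed

lemma infsum_involution:
  assumes "\<And>x. h (h x) = x"
  shows "(\<Sum>\<^sub>\<infinity>x. f (h x)) = (\<Sum>\<^sub>\<infinity>x. f x)"
  by (rule infsum_reindex_bij_witness[of _ h h]) (use assms in auto)

text \<open>Reflecting coordinate i flips the sign of the summand, so the sum is its own
  negative.\<close>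

lemma symmetric_moment_cross:
  fixes F :: "int^'d::finite \<Rightarrow> real"
  assumes "lattice_symmetric F" "i \<noteq> j"
  shows "(\<Sum>\<^sub>\<infinity>x. F x * (real_of_int (x $ i) * real_of_int (x $ j))) = 0" (is "infsum ?f UNIV = 0")
proof -
  define h :: "int^'d \<Rightarrow> int^'d" where "h x = (\<chi> l. (if l = i then -1 else 1) * x $ id l)" for x
  have Fh: "F (h x) = F x" for x
    using assms(1) unfolding lattice_symmetric_def h_def
    by (elim allE[of _ id] allE[of _ "\<lambda>l. if l = i then -1 else 1"]) auto
  have "infsum ?f UNIV = (\<Sum>\<^sub>\<infinity>x. ?f (h x))"
    by (rule infsum_involution[symmetric]) (simp add: h_def vec_eq_iff)
  also have "\<dots> = (\<Sum>\<^sub>\<infinity>x. - ?f x)" using assms(2) by (simp add: Fh) (simp add: h_def)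
  also have "\<dots> = - infsum ?f UNIV" by (rule infsum_uminus)
  finally show ?thesis by simp
qed

lemma symmetric_moment_diag:
  fixes F :: "int^'d::finite \<Rightarrow> real"
  assumes "lattice_symmetric F"
  shows "(\<Sum>\<^sub>\<infinity>x. F x * (real_of_int (x $ i) * real_of_int (x $ i))) = (\<Sum>\<^sub>\<infinity>x. F x * (real_of_int (x $ j) * real_of_int (x $ j)))"
proof -
  define p where "p = Transposition.transpose i j"
  define h :: "int^'d \<Rightarrow> int^'d" where "h x = (\<chi> l. 1 * x $ p l)" for x
  have Fh: "F (h x) = F x" for x
    using assms(1) unfolding lattice_symmetric_def h_def
    by (elim allE[of _ p] allE[of _ "\<lambda>l. 1"]) (auto simp: p_def)
  have "(\<Sum>\<^sub>\<infinity>x. F x * (real_of_int (x $ i) * real_of_int (x $ i))) = (\<Sum>\<^sub>\<infinity>x. F (h x) * (real_of_int (h x $ i) * real_of_int (h x $ i)))"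
    by (rule infsum_involution[symmetric]) (simp add: h_def vec_eq_iff p_def)
  then show ?thesis by (simp add: Fh) (simp add: h_def p_def)
qed

text \<open>The transform of an even function is real. Working with this cosine series keeps lower
  bounds, reciprocals and differences within real analysis; waves reappear only in the
  integrals.\<close>

definition symbol :: "(int^'d::finite \<Rightarrow> real) \<Rightarrow> real^'d \<Rightarrow> real" where
  "symbol F k = (\<Sum>\<^sub>\<infinity>x. F x * cos (k \<bullet> rvec x))"

lemma fourier_eq_symbol:
  fixes F :: "int^'d::finite \<Rightarrow> real"
  assumes sym: "lattice_symmetric F" and F: "(\<lambda>x. \<bar>F x\<bar>) summable_on UNIV"
  shows "fourier F k = complex_of_real (symbol F k)"
proof -
  have c: "(\<lambda>x. norm (complex_of_real (F x))) summable_on UNIV" using F by simp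
  have hs: "((\<lambda>x. complex_of_real (F x) * wave x k) has_sum fourier F k) UNIV"
    unfolding fourier_eq_fseries by (rule fseries_has_sum[OF c])
  have "fourier F k = (\<Sum>\<^sub>\<infinity>x. complex_of_real (F (- x)) * wave (- x) k)"
    unfolding fourier_eq_fseries fseries_def
    by (rule infsum_involution[symmetric]) simp
  also have "\<dots> = (\<Sum>\<^sub>\<infinity>x. cnj (complex_of_real (F x) * wave x k))"
    by (simp add: lattice_symmetric_uminus[OF sym] wave_minus)
  also have "\<dots> = cnj (fourier F k)"
    unfolding fourier_eq_fseries fseries_def by (rule infsum_cnj)
  finally have "fourier F k \<in> \<real>" by (simp add: Reals_cnj_iff)
  moreover have "((\<lambda>x. F x * cos (k \<bullet> rvec x)) has_sum Re (fourier F k)) UNIV"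
    using has_sum_Re[OF hs] by (simp add: wave_def Re_exp)
  then have "symbol F k = Re (fourier F k)" unfolding symbol_def by (rule infsumI)
  ultimately show ?thesis by (simp add: complex_is_Real_iff complex_eq_iff)
qed

lemma infsum_bounded_by:
  fixes f g :: "'a \<Rightarrow> real"
  assumes g: "g summable_on UNIV" and le: "\<And>x. \<bar>f x\<bar> \<le> g x"
  shows "f summable_on UNIV" and "\<bar>infsum f UNIV\<bar> \<le> infsum g UNIV"
proof -
  have s: "(\<lambda>x. norm (f x)) summable_on UNIV"
    by (rule summable_on_comparison_test[OF g]) (use le in auto)
  then show "f summable_on UNIV" by (rule abs_summable_summable)
  have "\<bar>infsum f UNIV\<bar> \<le> (\<Sum>\<^sub>\<infinity>x. norm (f x))" using norm_infsum_bound[OF s] by simp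
  also have "\<dots> \<le> infsum g UNIV" by (rule infsum_mono[OF s g]) (use le in auto)
  finally show "\<bar>infsum f UNIV\<bar> \<le> infsum g UNIV" .
qed

text \<open>K1, K2 and \<rho> are parameters, so that an estimate can choose its constant first and
  then quantify over all kernels. Only \<rho> > 0 is recorded; the condition special to d > 8 first
  enters through the exponent s in \<open>torus_difference_bound\<close>.\<close>

locale lattice_kernel =
  fixes F :: "int^'d::finite \<Rightarrow> real" and K1 K2 \<rho> :: real
  assumes sym: "lattice_symmetric F" and zero: "fourier F 0 = 0"
    and K1: "K1 > 0" and K2: "K2 > 0" and rho: "\<rho> > 0"
    and decay: "\<And>x. \<bar>F x\<bar> \<le> K1 / xnorm x powr (real CARD('d) + 2 + \<rho>)"
    and lower: "\<And>k. k \<in> torus \<Longrightarrow> Re (fourier F k) \<ge> K2 * (norm k)\<^sup>2"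
begin

definition moment_bound :: "real \<Rightarrow> real" where
  "moment_bound p = K1 * lattice_zeta TYPE('d) (real CARD('d) + 2 + \<rho> - p)"

lemma moment_bound_nonneg: "0 \<le> moment_bound p"
  unfolding moment_bound_def by (intro mult_nonneg_nonneg lattice_zeta_nonneg) (use K1 in simp)

lemma moment:
  assumes "p < 2 + \<rho>"
  shows moment_summable: "(\<lambda>x. \<bar>F x\<bar> * xnorm x powr p) summable_on UNIV"
    and moment_le: "(\<Sum>\<^sub>\<infinity>x. \<bar>F x\<bar> * xnorm x powr p) \<le> moment_bound p"
  unfolding moment_bound_def
  by (rule weighted_summable[OF decay] weighted_sum_le[OF decay]; use assms in simp)+

lemma abs_summable: "(\<lambda>x. \<bar>F x\<bar>) summable_on UNIV"
  using moment_summable[of 0] rho by simp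

lemma moment_bounded_by:
  assumes p: "p < 2 + \<rho>" and c: "0 \<le> c" and le: "\<And>x. \<bar>f x\<bar> \<le> c * (\<bar>F x\<bar> * xnorm x powr p)"
  shows "f summable_on UNIV" and "\<bar>infsum f UNIV\<bar> \<le> c * moment_bound p"
proof -
  have s: "(\<lambda>x. c * (\<bar>F x\<bar> * xnorm x powr p)) summable_on UNIV"
    by (intro summable_on_cmult_right moment_summable p)
  show "f summable_on UNIV" by (rule infsum_bounded_by(1)[OF s le])
  have "\<bar>infsum f UNIV\<bar> \<le> c * (\<Sum>\<^sub>\<infinity>x. \<bar>F x\<bar> * xnorm x powr p)"
    using infsum_bounded_by(2)[OF s le] by (simp add: infsum_cmult_right')
  also have "\<dots> \<le> c * moment_bound p" by (intro mult_left_mono moment_le p c)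
  finally show "\<bar>infsum f UNIV\<bar> \<le> c * moment_bound p" .
qed

lemma fourier_symbol: "fourier F k = complex_of_real (symbol F k)"
  by (rule fourier_eq_symbol[OF sym abs_summable])

lemma symbol_lower: "k \<in> torus \<Longrightarrow> symbol F k \<ge> K2 * (norm k)\<^sup>2"
  using lower[of k] by (simp add: fourier_symbol)

lemma infsum_F: "(\<Sum>\<^sub>\<infinity>x. F x) = 0"
  using zero fourier_symbol[of 0] by (simp add: symbol_def)

lemma enorm_power2_le: "(enorm x)\<^sup>2 \<le> xnorm x powr 2"
  using power_mono[OF enorm_le_xnorm[of x] enorm_nonneg, of 2] by simp

lemma abs_inner_rvec_le: "\<bar>k \<bullet> rvec x\<bar> \<le> norm k * xnorm x"
  using Cauchy_Schwarz_ineq2[of k "rvec x"] mult_left_mono[OF enorm_le_xnorm[of x] norm_ge_zero[of k]]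
  by (simp add: enorm_def)

lemma second_moment_summable: "(\<lambda>x. F x * (real_of_int (x $ i) * real_of_int (x $ j))) summable_on UNIV"
proof (rule moment_bounded_by(1)[of 2 1])
  fix x
  have "\<bar>real_of_int (x $ i)\<bar> * \<bar>real_of_int (x $ j)\<bar> \<le> enorm x * enorm x"
    by (intro mult_mono abs_nth_le_enorm) auto
  also have "\<dots> \<le> xnorm x powr 2" using enorm_power2_le[of x] by (simp add: power2_eq_square)
  finally show "\<bar>F x * (real_of_int (x $ i) * real_of_int (x $ j))\<bar> \<le> 1 * (\<bar>F x\<bar> * xnorm x powr 2)"
    by (simp add: abs_mult mult_left_mono)
qed (use rho in auto)

lemma second_moment_diag:
  "(\<Sum>\<^sub>\<infinity>x. F x * (real_of_int (x $ i) * real_of_int (x $ i))) = - kappa0 F / real CARD('d)"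
proof -
  have "- kappa0 F = (\<Sum>\<^sub>\<infinity>x. \<Sum>j\<in>UNIV. F x * (real_of_int (x $ j) * real_of_int (x $ j)))"
    by (simp add: kappa0_def enorm_def power2_norm_eq_inner inner_vec_def sum_distrib_left mult.commute)
  also have "\<dots> = (\<Sum>j\<in>UNIV. \<Sum>\<^sub>\<infinity>x. F x * (real_of_int (x $ j) * real_of_int (x $ j)))"
    by (rule infsumI, rule has_sum_sum_finite) (auto intro: second_moment_summable)
  also have "\<dots> = (\<Sum>j\<in>(UNIV::'d set). \<Sum>\<^sub>\<infinity>x. F x * (real_of_int (x $ i) * real_of_int (x $ i)))"
    by (intro sum.cong symmetric_moment_diag[OF sym] refl)
  finally show ?thesis by (simp add: field_simps)
qed

text \<open>By symmetry the second-moment matrix of F is a multiple of the identity: reflections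
  kill the off-diagonal entries, transpositions equate the diagonal ones, and the trace is -
  \<kappa>.\<close>

lemma infsum_quadratic:
  shows "(\<lambda>x. F x * (k \<bullet> rvec x)\<^sup>2) summable_on UNIV"
    and "(\<Sum>\<^sub>\<infinity>x. F x * (k \<bullet> rvec x)\<^sup>2) = - kappa0 F * (norm k)\<^sup>2 / real CARD('d)"
proof -
  let ?m = "\<lambda>i j x. F x * (real_of_int (x $ i) * real_of_int (x $ j))"
  have eq: "F x * (k \<bullet> rvec x)\<^sup>2 = (\<Sum>i\<in>UNIV. \<Sum>j\<in>UNIV. (k $ i * k $ j) * ?m i j x)" for x
    by (simp add: inner_vec_def power2_eq_square sum_product sum_distrib_left algebra_simps)
  have s1: "(\<lambda>x. (k $ i * k $ j) * ?m i j x) summable_on UNIV" for i j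
    by (intro summable_on_cmult_right second_moment_summable)
  have s2: "((\<lambda>x. \<Sum>j\<in>UNIV. (k $ i * k $ j) * ?m i j x) has_sum (\<Sum>j\<in>UNIV. (k $ i * k $ j) * infsum (?m i j) UNIV)) UNIV" for i
    unfolding infsum_cmult_right'[symmetric] by (rule has_sum_sum_finite) (auto intro: s1)
  have s3: "((\<lambda>x. F x * (k \<bullet> rvec x)\<^sup>2) has_sum (\<Sum>i\<in>UNIV. \<Sum>j\<in>UNIV. (k $ i * k $ j) * infsum (?m i j) UNIV)) UNIV"
    unfolding eq infsumI[OF s2, symmetric]
    by (rule has_sum_sum_finite) (auto intro: has_sum_imp_summable[OF s2])
  then show "(\<lambda>x. F x * (k \<bullet> rvec x)\<^sup>2) summable_on UNIV" by (rule has_sum_imp_summable)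
  have m: "infsum (?m i j) UNIV = (if i = j then - kappa0 F / real CARD('d) else 0)" for i j
    using second_moment_diag symmetric_moment_cross[OF sym] by auto
  have "(\<Sum>\<^sub>\<infinity>x. F x * (k \<bullet> rvec x)\<^sup>2) = (\<Sum>i\<in>UNIV. \<Sum>j\<in>UNIV. (k $ i * k $ j) * infsum (?m i j) UNIV)"
    by (rule infsumI[OF s3])
  also have "\<dots> = (\<Sum>i\<in>UNIV. k $ i * k $ i * (- kappa0 F / real CARD('d)))"
    by (simp add: m if_distrib cong: if_cong)
  also have "\<dots> = - kappa0 F * (norm k)\<^sup>2 / real CARD('d)"
    by (simp add: power2_norm_eq_inner inner_vec_def sum_distrib_right[symmetric] sum_negf sum_divide_distrib[symmetric] mult.commute sum_distrib_left)
  finally show "(\<Sum>\<^sub>\<infinity>x. F x * (k \<bullet> rvec x)\<^sup>2) = - kappa0 F * (norm k)\<^sup>2 / real CARD('d)" .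
qed

definition quad :: "real^'d \<Rightarrow> real" where
  "quad k = kappa0 F / (2 * real CARD('d)) * (norm k)\<^sup>2"

text \<open>The constant term vanishes because F sums to 0, and the quadratic term is
  \<open>quad\<close>. The remainder is at most |k|^(2 + s) times a moment of order 2 + s, which is
  finite because s < \<rho>.\<close>

lemma symbol_taylor:
  assumes s: "0 \<le> s" "s \<le> 2" "s < \<rho>"
  shows "\<bar>symbol F k - quad k\<bar> \<le> 3 * moment_bound (2 + s) * norm k powr (2 + s)"
proof -
  let ?f = "\<lambda>x. F x * (cos (k \<bullet> rvec x) - 1 + (k \<bullet> rvec x)\<^sup>2 / 2)"
  have b: "\<bar>?f x\<bar> \<le> (3 * norm k powr (2 + s)) * (\<bar>F x\<bar> * xnorm x powr (2 + s))" for x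
  proof -
    have "\<bar>cos (k \<bullet> rvec x) - 1 + (k \<bullet> rvec x)\<^sup>2 / 2\<bar> \<le> 3 * \<bar>k \<bullet> rvec x\<bar> powr (2 + s)"
      by (rule cos_taylor_bound) (use s in auto)
    also have "\<dots> \<le> 3 * (norm k * xnorm x) powr (2 + s)"
      by (intro mult_left_mono powr_mono2 abs_inner_rvec_le) (use s in auto)
    also have "\<dots> = 3 * (norm k powr (2 + s) * xnorm x powr (2 + s))"
      by (subst powr_mult) auto
    finally have "\<bar>cos (k \<bullet> rvec x) - 1 + (k \<bullet> rvec x)\<^sup>2 / 2\<bar> \<le> 3 * (norm k powr (2 + s) * xnorm x powr (2 + s))" .
    from mult_left_mono[OF this abs_ge_zero[of "F x"]] show ?thesis
      unfolding abs_mult by (simp only: mult_ac)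
  qed
  have sum0: "F summable_on UNIV" by (rule abs_summable_summable) (use abs_summable in simp)
  have sumc: "(\<lambda>x. F x * cos (k \<bullet> rvec x)) summable_on UNIV"
    by (rule infsum_bounded_by(1)[OF abs_summable]) (simp add: abs_mult mult_left_le)
  have "infsum ?f UNIV = (\<Sum>\<^sub>\<infinity>x. F x * cos (k \<bullet> rvec x) + (- 1) * F x + (1/2) * (F x * (k \<bullet> rvec x)\<^sup>2))"
    by (simp add: algebra_simps)
  also have "\<dots> = symbol F k + (- 1) * infsum F UNIV + (1/2) * (\<Sum>\<^sub>\<infinity>x. F x * (k \<bullet> rvec x)\<^sup>2)"
    unfolding symbol_def
    by (intro infsumI has_sum_add has_sum_cmult_right has_sum_infsum sumc sum0 infsum_quadratic)
  also have "\<dots> = symbol F k - quad k"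
    by (simp add: infsum_F infsum_quadratic quad_def field_simps)
  finally have "symbol F k - quad k = infsum ?f UNIV" ..
  then show ?thesis using moment_bounded_by(2)[of "2 + s" "3 * norm k powr (2 + s)", OF _ _ b] s
    by (simp add: mult.commute mult.left_commute)
qed

lemma kappa0_le: "kappa0 F \<le> moment_bound 2"
proof -
  have "\<bar>\<Sum>\<^sub>\<infinity>x. (enorm x)\<^sup>2 * F x\<bar> \<le> 1 * moment_bound 2"
  proof (rule moment_bounded_by(2))
    fix x
    show "\<bar>(enorm x)\<^sup>2 * F x\<bar> \<le> 1 * (\<bar>F x\<bar> * xnorm x powr 2)"
      using mult_left_mono[OF enorm_power2_le[of x] abs_ge_zero[of "F x"]] by (simp add: abs_mult mult.commute)
  qed (use rho in auto)
  then show ?thesis by (simp add: kappa0_def)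
qed

text \<open>Along a coordinate axis at distance t the lower bound K2 t^2 is compared with the Taylor
  expansion; division by t^2 and t tending to 0 from the right leave the inequality between the
  coefficients.\<close>

lemma kappa0_ge: "kappa0 F \<ge> 2 * real CARD('d) * K2"
proof -
  define s where "s = min (\<rho> / 2) 1"
  have s: "0 < s" "s \<le> 2" "s < \<rho>" using rho by (auto simp: s_def)
  define C where "C = 3 * moment_bound (2 + s)"
  have le: "K2 \<le> kappa0 F / (2 * real CARD('d)) + C * t powr s" if t: "0 < t" "t < pi" for t
  proof -
    obtain i :: 'd where True by blast
    define k :: "real^'d" where "k = axis i t"
    have nk: "norm k = t" using t by (simp add: k_def norm_eq_sqrt_inner inner_axis_axis)
    have "k \<in> torus" using t by (auto simp: torus_def k_def axis_def)
    then have "K2 * t\<^sup>2 \<le> symbol F k" using symbol_lower nk by metis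
    also have "\<dots> \<le> quad k + C * t powr (2 + s)"
      using symbol_taylor[of s k] s nk by (simp add: C_def)
    also have "t powr (2 + s) = t\<^sup>2 * t powr s" using t by (simp add: powr_add powr_numeral)
    finally have "t\<^sup>2 * K2 \<le> t\<^sup>2 * (kappa0 F / (2 * real CARD('d)) + C * t powr s)"
      by (simp add: quad_def nk algebra_simps)
    then show ?thesis using t by (subst (asm) mult_le_cancel_left_pos) auto
  qed
  have "K2 \<le> kappa0 F / (2 * real CARD('d)) + C * 0"
  proof (rule tendsto_lowerbound)
    show "((\<lambda>t. kappa0 F / (2 * real CARD('d)) + C * t powr s) \<longlongrightarrow> kappa0 F / (2 * real CARD('d)) + C * 0) (at_right 0)"
      using tendsto_powr'[of "\<lambda>t. t" 0 "at_right 0" "\<lambda>_. s" s] s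
      by (intro tendsto_intros) (auto simp: eventually_at_right_less intro!: tendsto_eq_intros eventually_mono[OF eventually_at_right_less])
    show "\<forall>\<^sub>F t in at_right 0. K2 \<le> kappa0 F / (2 * real CARD('d)) + C * t powr s"
      unfolding eventually_at_right_field by (rule exI[of _ pi]) (use le in auto)
  qed simp
  then show ?thesis by (simp add: field_simps)
qed

text \<open>The basic pointwise gain: for |u| <= |k| a difference of f has size |k| |u|, which is
  |u| / |k| relative to |k|^2. It rests on the second moment alone and also gives continuity of the
  symbol.\<close>

lemma symbol_diff_le:
  "\<bar>symbol F (k + u) - symbol F k\<bar> \<le> moment_bound 2 * ((norm k + norm u) * norm u)"
proof -
  have sc: "(\<lambda>x. F x * cos (k \<bullet> rvec x)) summable_on UNIV" for k
    by (rule infsum_bounded_by(1)[OF abs_summable]) (simp add: abs_mult mult_left_le)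
  have "symbol F (k + u) - symbol F k = (\<Sum>\<^sub>\<infinity>x. F x * cos ((k + u) \<bullet> rvec x) - F x * cos (k \<bullet> rvec x))"
    unfolding symbol_def by (rule infsum_minus[OF sc sc, symmetric])
  moreover have "\<bar>F x * cos ((k + u) \<bullet> rvec x) - F x * cos (k \<bullet> rvec x)\<bar>
      \<le> ((norm k + norm u) * norm u) * (\<bar>F x\<bar> * xnorm x powr 2)" for x
  proof -
    have "\<bar>cos (k \<bullet> rvec x + u \<bullet> rvec x) - cos (k \<bullet> rvec x)\<bar> \<le> (\<bar>k \<bullet> rvec x\<bar> + \<bar>u \<bullet> rvec x\<bar>) * \<bar>u \<bullet> rvec x\<bar>"
      by (rule abs_cos_add_diff_le)
    also have "\<dots> \<le> (norm k * xnorm x + norm u * xnorm x) * (norm u * xnorm x)"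
      by (intro mult_mono add_mono abs_inner_rvec_le) (auto simp: less_imp_le)
    also have "\<dots> = ((norm k + norm u) * norm u) * xnorm x powr 2"
      by (simp add: powr_numeral power2_eq_square algebra_simps)
    finally have "\<bar>F x\<bar> * \<bar>cos (k \<bullet> rvec x + u \<bullet> rvec x) - cos (k \<bullet> rvec x)\<bar> \<le> \<bar>F x\<bar> * (((norm k + norm u) * norm u) * xnorm x powr 2)"
      by (intro mult_left_mono) auto
    then show ?thesis
      by (simp add: abs_mult[symmetric] right_diff_distrib inner_add_left mult.commute mult.left_commute)
  qed
  ultimately show ?thesis
    using moment_bounded_by(2)[of 2 "(norm k + norm u) * norm u"] rho
    by (simp add: mult.commute mult.left_commute)
qed

lemma periodic_symbol: "periodic (symbol F)"
proof -
  have "periodic (fourier F)"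
    by (simp add: fourier_eq_fseries fseries_def periodic_def periodic_wave[unfolded periodic_def, rule_format])
  then show ?thesis unfolding periodic_def fourier_symbol of_real_eq_iff .
qed

lemma continuous_symbol: "continuous_on UNIV (symbol F)"
proof (rule continuous_at_imp_continuous_on, safe)
  fix k :: "real^'d"
  have "((\<lambda>u. symbol F (k + u) - symbol F k) \<longlongrightarrow> 0) (at 0)"
  proof (rule Lim_null_comparison)
    show "\<forall>\<^sub>F u in at 0. norm (symbol F (k + u) - symbol F k) \<le> moment_bound 2 * ((norm k + norm u) * norm u)"
      using symbol_diff_le by (intro always_eventually allI) simp
    show "((\<lambda>u. moment_bound 2 * ((norm k + norm u) * norm u)) \<longlongrightarrow> 0) (at 0)"
      by (auto intro!: tendsto_eq_intros)
  qed
  then show "isCont (symbol F) k" by (simp add: isCont_iff LIM_zero_iff)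
qed

text \<open>The squared coefficients of the difference are F^2 |exp (i u.x) - 1|^(2 m), at most 4^m
  F^2 (|u| |x|)^(2 a) for any a up to m. They are summable for 2 a < d + 4 + 2 \<rho>: squaring F
  makes room for d / 2 more powers than the pointwise moments have. The offset l only multiplies
  coefficients by a phase.\<close>

lemma findiff_symbol_L2:
  assumes a: "0 < m" "0 \<le> a" "a \<le> real m" "2 * a < real CARD('d) + 4 + 2 * \<rho>"
  shows "integrable torus_measure (\<lambda>k. (findiff u m (symbol F) (k + l))\<^sup>2)"
    and "(\<integral>k. (findiff u m (symbol F) (k + l))\<^sup>2 \<partial>torus_measure)
      \<le> (2 * pi) ^ CARD('d) * 4 ^ m * (K1\<^sup>2 * lattice_zeta TYPE('d) (2 * (real CARD('d) + 2 + \<rho>) - 2 * a)) * norm u powr (2 * a)"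
proof -
  let ?F = "\<lambda>x. complex_of_real (F x)"
  have c: "(\<lambda>x. norm (?F x)) summable_on UNIV" using abs_summable by simp
  define c' where "c' x = ?F x * (wave x u - 1) ^ m * wave x l" for x
  have c's: "(\<lambda>x. norm (c' x)) summable_on UNIV"
    using findiff_fseries(2)[OF c] by (simp add: c'_def norm_mult)
  have eq0: "complex_of_real (findiff u m (symbol F) (k + l)) = fseries c' k" for k
  proof -
    have "complex_of_real (findiff u m (symbol F) (k + l)) = findiff u m (fseries ?F) (k + l)"
      unfolding findiff_of_real[symmetric] fourier_symbol[symmetric] fourier_eq_fseries ..
    also have "\<dots> = fseries c' k"
      by (simp add: findiff_fseries(1)[OF c] fseries_def c'_def wave_add mult.assoc mult.commute mult.left_commute)
    finally show ?thesis .
  qed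
  have eq: "(findiff u m (symbol F) (k + l))\<^sup>2 = (norm (fseries c' k))\<^sup>2" for k
    unfolding eq0[symmetric] by simp
  show "integrable torus_measure (\<lambda>k. (findiff u m (symbol F) (k + l))\<^sup>2)"
    unfolding eq by (rule fseries_parseval(1)[OF c's])
  let ?\<gamma> = "2 * (real CARD('d) + 2 + \<rho>)"
  have F2: "\<bar>(F x)\<^sup>2\<bar> \<le> K1\<^sup>2 / xnorm x powr ?\<gamma>" for x
  proof -
    have "\<bar>F x\<bar>\<^sup>2 \<le> (K1 / xnorm x powr (real CARD('d) + 2 + \<rho>))\<^sup>2" by (intro power_mono decay) auto
    moreover have "(xnorm x powr (real CARD('d) + 2 + \<rho>))\<^sup>2 = xnorm x powr ?\<gamma>"
      by (simp add: power2_eq_square powr_add[symmetric] algebra_simps)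
    ultimately show ?thesis by (simp add: power_divide)
  qed
  have p: "real CARD('d) + 2 * a < ?\<gamma>" using a by simp
  let ?G = "\<lambda>x. ((2 * pi) ^ CARD('d) * 4 ^ m * norm u powr (2 * a)) * (\<bar>(F x)\<^sup>2\<bar> * xnorm x powr (2 * a))"
  have G: "?G summable_on UNIV" by (intro summable_on_cmult_right weighted_summable[OF F2 p])
  have "(norm (c' x))\<^sup>2 \<le> 4 ^ m * norm u powr (2 * a) * (\<bar>(F x)\<^sup>2\<bar> * xnorm x powr (2 * a))" for x
  proof -
    have "((norm (wave x u - 1)) ^ m)\<^sup>2 \<le> 4 ^ m * (norm u * xnorm x) powr (2 * a)"
    proof (cases "norm u * xnorm x \<ge> 1")
      case True
      have "((norm (wave x u - 1)) ^ m)\<^sup>2 \<le> ((2::real) ^ m)\<^sup>2"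
        by (intro power_mono norm_wave_diff_one) auto
      also have "\<dots> = 4 ^ m" by (metis power2_eq_square power_mult_distrib[symmetric] four_x_squared mult.commute power_even_eq num_double numeral_times_numeral)
      also have "\<dots> \<le> 4 ^ m * (norm u * xnorm x) powr (2 * a)"
        using ge_one_powr_ge_zero[OF True, of "2 * a"] a by simp
      finally show ?thesis .
    next
      case False
      show ?thesis
      proof (cases "u = 0")
        case True
        \<comment> \<open>Here \<open>0 powr (2 * a)\<close> is 0 even for a = 0, so the left side
          has to vanish as well; it does because m > 0.\<close>
        then show ?thesis by (cases m) (use a in \<open>auto simp: wave_def\<close>)
      next
        case u: False
        have pos: "norm u * xnorm x > 0" using u by simp
        have "norm (wave x u - 1) \<le> norm u * xnorm x"
          using norm_wave_diff_one(2)[of x u] mult_left_mono[OF enorm_le_xnorm[of x] norm_ge_zero[of u]] by linarith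
        then have "((norm (wave x u - 1)) ^ m)\<^sup>2 \<le> ((norm u * xnorm x) ^ m)\<^sup>2"
          by (intro power_mono) auto
        also have "\<dots> = (norm u * xnorm x) ^ (2 * m)" by (simp add: power_even_eq)
        also have "\<dots> = (norm u * xnorm x) powr (2 * real m)"
          using powr_realpow[OF pos, of "2 * m"] by simp
        also have "\<dots> \<le> (norm u * xnorm x) powr (2 * a)"
          by (rule powr_mono') (use a False pos in auto)
        also have "\<dots> \<le> 4 ^ m * (norm u * xnorm x) powr (2 * a)" by (simp add: mult_le_cancel_right1)
        finally show ?thesis .
      qed
    qed
    then have "(F x)\<^sup>2 * ((norm (wave x u - 1)) ^ m)\<^sup>2 \<le> (F x)\<^sup>2 * (4 ^ m * (norm u * xnorm x) powr (2 * a))"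
      by (intro mult_left_mono) auto
    then show ?thesis by (simp add: c'_def norm_mult norm_power power_mult_distrib powr_mult mult.commute mult.left_commute)
  qed
  then have le: "(2 * pi) ^ CARD('d) * (norm (c' x))\<^sup>2 \<le> ?G x" for x
    by (simp add: mult.assoc mult_left_mono)
  have "(\<integral>k. (findiff u m (symbol F) (k + l))\<^sup>2 \<partial>torus_measure) = (\<Sum>\<^sub>\<infinity>x. (2 * pi) ^ CARD('d) * (norm (c' x))\<^sup>2)"
    unfolding eq by (rule infsumI[symmetric, OF fseries_parseval(2)[OF c's]])
  also have "\<dots> \<le> infsum ?G UNIV"
    by (rule infsum_mono) (use fseries_parseval(2)[OF c's] G le in \<open>auto simp: summable_on_def\<close>)
  also have "\<dots> = ((2 * pi) ^ CARD('d) * 4 ^ m * norm u powr (2 * a)) * (\<Sum>\<^sub>\<infinity>x. \<bar>(F x)\<^sup>2\<bar> * xnorm x powr (2 * a))"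
    by (rule infsum_cmult_right')
  also have "\<dots> \<le> ((2 * pi) ^ CARD('d) * 4 ^ m * norm u powr (2 * a)) * (K1\<^sup>2 * lattice_zeta TYPE('d) (?\<gamma> - 2 * a))"
    by (intro mult_left_mono weighted_sum_le[OF F2 p]) auto
  finally show "(\<integral>k. (findiff u m (symbol F) (k + l))\<^sup>2 \<partial>torus_measure)
      \<le> (2 * pi) ^ CARD('d) * 4 ^ m * (K1\<^sup>2 * lattice_zeta TYPE('d) (?\<gamma> - 2 * a)) * norm u powr (2 * a)"
    by (simp only: mult_ac)
qed

end

section \<open>Powers of the norm and Gaussian integrals\<close>

text \<open>The function lies below the sum over j of c j times the indicator of the ball of radius
  r j, whose integral is the given series times the volume of the unit ball. This handles radial
  powers without polar coordinates.\<close>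

lemma integrable_dyadic:
  fixes f :: "'a::euclidean_space \<Rightarrow> real"
  assumes f [measurable]: "f \<in> borel_measurable borel" and nn: "\<And>k. 0 \<le> f k"
    and c: "\<And>j. 0 \<le> c j" and r: "\<And>j. 0 \<le> r j"
    and summ: "summable (\<lambda>j. c j * r j ^ DIM('a))"
    and dom: "\<And>k. f k \<noteq> 0 \<Longrightarrow> \<exists>j::nat. norm k \<le> r j \<and> f k \<le> c j"
  shows "integrable lborel f"
proof (rule integrableI_bounded)
  let ?V = "unit_ball_vol (real DIM('a))"
  have V: "?V \<ge> 0" by simp
  have le: "ennreal (norm (f k)) \<le> (\<Sum>j. ennreal (c j) * indicator (cball 0 (r j)) k)" for k
  proof (cases "f k = 0")
    case False
    then obtain j where j: "norm k \<le> r j" "f k \<le> c j" using dom by blast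
    define g where "g j = ennreal (c j) * indicator (cball 0 (r j)) k" for j
    have "ennreal (norm (f k)) \<le> g j"
      using j nn[of k] by (simp add: g_def ennreal_leI)
    also have "\<dots> \<le> suminf g" using sum_le_suminf[OF summableI, of "{j}" g] by simp
    also have "\<dots> = (\<Sum>j. ennreal (c j) * indicator (cball 0 (r j)) k)" by (simp add: g_def[abs_def])
    finally show ?thesis .
  qed simp
  have "(\<integral>\<^sup>+k. ennreal (norm (f k)) \<partial>lborel) \<le> (\<integral>\<^sup>+k. (\<Sum>j. ennreal (c j) * indicator (cball 0 (r j)) k) \<partial>(lborel :: 'a measure))"
    by (intro nn_integral_mono le)
  also have "\<dots> = (\<Sum>j. \<integral>\<^sup>+k. ennreal (c j) * indicator (cball 0 (r j)) k \<partial>(lborel :: 'a measure))"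
    by (rule nn_integral_suminf) (auto intro!: borel_measurable_times_ennreal borel_measurable_indicator)
  also have "\<dots> = (\<Sum>j. ennreal (?V * (c j * r j ^ DIM('a))))"
  proof (rule suminf_cong)
    fix j
    have "(\<integral>\<^sup>+k. ennreal (c j) * indicator (cball 0 (r j)) k \<partial>(lborel :: 'a measure)) = ennreal (c j) * ennreal (?V * r j ^ DIM('a))"
      by (subst nn_integral_cmult_indicator) (simp_all add: emeasure_cball r)
    also have "\<dots> = ennreal (c j * (?V * r j ^ DIM('a)))"
      by (rule ennreal_mult[symmetric]) (simp_all add: c r)
    also have "c j * (?V * r j ^ DIM('a)) = ?V * (c j * r j ^ DIM('a))" by simp
    finally show "(\<integral>\<^sup>+k. ennreal (c j) * indicator (cball 0 (r j)) k \<partial>(lborel :: 'a measure)) = ennreal (?V * (c j * r j ^ DIM('a)))" .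
  qed
  also have "\<dots> < \<infinity>"
    unfolding infinity_ennreal_def
    by (rule less_top[THEN iffD1], rule ennreal_suminf_neq_top[OF summable_mult[OF summ]]) (simp add: c r)
  finally show "(\<integral>\<^sup>+k. ennreal (norm (f k)) \<partial>lborel) < \<infinity>" .
qed simp

lemma dyadic_shell:
  fixes t :: real
  assumes "1 \<le> t"
  shows "\<exists>j::nat. 2 ^ j \<le> t \<and> t < 2 ^ Suc j"
proof -
  obtain n where n: "t < 2 ^ n" using real_arch_pow[of 2 t] by auto
  define j where "j = (LEAST n. t < 2 ^ n)"
  have j: "t < 2 ^ j" unfolding j_def by (rule LeastI[of _ n]) (rule n)
  then have "j \<noteq> 0" using assms by (intro notI) simp
  then obtain i where i: "j = Suc i" using not0_implies_Suc by blast
  have "\<not> t < 2 ^ i" using not_less_Least[of i "\<lambda>n. t < 2 ^ n"] i unfolding j_def by simp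
  then show ?thesis using j i by (intro exI[of _ i]) simp
qed

text \<open>On the shell where |k| is between R / 2^(j + 1) and R / 2^j the power is nearly
  constant, and the contributions form a geometric series of ratio 2^(\<gamma> - d). The origin
  causes no trouble, as \<open>0 powr - \<gamma>\<close> is 0.\<close>

lemma set_integrable_norm_powr_cball:
  assumes "0 \<le> \<gamma>" "\<gamma> < real DIM('a)" "0 < R"
  shows "set_integrable lborel (cball 0 R) (\<lambda>k::'a::euclidean_space. norm k powr - \<gamma>)"
  unfolding set_integrable_def
proof (rule integrable_dyadic)
  let ?d = "DIM('a)"
  let ?r = "\<lambda>j::nat. R / 2 ^ j" and ?c = "\<lambda>j::nat. (R / 2 ^ Suc j) powr - \<gamma>"
  show "(\<lambda>k::'a. indicator (cball 0 R) k *\<^sub>R norm k powr - \<gamma>) \<in> borel_measurable borel"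
  proof -
    have [measurable]: "cball (0::'a) R \<in> sets borel" by simp
    show ?thesis by measurable
  qed
  have eq: "?c j * ?r j ^ ?d = ((R / 2) powr - \<gamma> * R ^ ?d) * (2 powr (\<gamma> - real ?d)) ^ j" for j
  proof -
    have "?c j = (R / 2) powr - \<gamma> * (2 ^ j) powr \<gamma>"
      using assms by (simp add: powr_divide powr_mult powr_minus field_simps)
    moreover have "?r j ^ ?d = R ^ ?d * (2 ^ j) powr - real ?d"
      by (simp add: power_divide powr_minus powr_realpow divide_inverse power_mult_distrib power_inverse)
    moreover have "(2 powr (\<gamma> - real ?d)) ^ j = (2 ^ j) powr \<gamma> * (2 ^ j) powr - real ?d"
      by (simp add: powr_power powr_realpow[symmetric] powr_powr powr_add[symmetric] algebra_simps del: powr_realpow)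
    ultimately show ?thesis by (simp only: mult_ac)
  qed
  have "(2::real) powr (\<gamma> - real ?d) < 2 powr 0" by (rule powr_less_mono) (use assms in auto)
  then show "summable (\<lambda>j. ?c j * ?r j ^ ?d)"
    unfolding eq by (intro summable_mult summable_geometric) simp
  fix k :: 'a assume nz: "indicator (cball 0 R) k *\<^sub>R norm k powr - \<gamma> \<noteq> (0::real)"
  then have k: "0 < norm k" "norm k \<le> R" by (auto split: split_indicator_asm)
  then have "1 \<le> R / norm k" by simp
  then obtain j where j: "2 ^ j \<le> R / norm k" "R / norm k < 2 ^ Suc j" using dyadic_shell by blast
  have "R / 2 ^ Suc j \<le> norm k" using j(2) k by (simp add: field_simps)
  then have "norm k powr - \<gamma> \<le> ?c j" by (intro powr_mono2') (use assms k \<open>0 < R\<close> in \<open>auto simp: divide_pos_pos\<close>)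
  moreover have "norm k \<le> ?r j" using j(1) k by (simp add: field_simps)
  ultimately show "\<exists>j. norm k \<le> ?r j \<and> indicator (cball 0 R) k *\<^sub>R norm k powr - \<gamma> \<le> ?c j"
    using k by (intro exI[of _ j]) simp
qed (use assms in auto)

lemma set_integrable_norm_powr_outside:
  assumes "real DIM('a) < \<gamma>"
  shows "set_integrable lborel {k. 1 \<le> norm k} (\<lambda>k::'a::euclidean_space. norm k powr - \<gamma>)"
  unfolding set_integrable_def
proof (rule integrable_dyadic)
  let ?d = "DIM('a)"
  let ?r = "\<lambda>j::nat. 2 ^ Suc j :: real" and ?c = "\<lambda>j::nat. (2 ^ j) powr - \<gamma> :: real"
  show "(\<lambda>k::'a. indicator {k. 1 \<le> norm k} k *\<^sub>R norm k powr - \<gamma>) \<in> borel_measurable borel" by measurable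
  have eq: "?c j * ?r j ^ ?d = 2 ^ ?d * (2 powr (real ?d - \<gamma>)) ^ j" for j
  proof -
    have "?r j ^ ?d = 2 ^ ?d * (2 ^ j) powr real ?d"
      by (simp add: power_mult_distrib powr_realpow)
    moreover have "(2 powr (real ?d - \<gamma>)) ^ j = (2 ^ j) powr real ?d * (2 ^ j) powr - \<gamma>"
      by (simp add: powr_power powr_realpow[symmetric] powr_powr powr_add[symmetric] algebra_simps del: powr_realpow)
    ultimately show ?thesis by (simp only: mult_ac)
  qed
  have "(2::real) powr (real ?d - \<gamma>) < 2 powr 0" by (rule powr_less_mono) (use assms in auto)
  then show "summable (\<lambda>j. ?c j * ?r j ^ ?d)"
    unfolding eq by (intro summable_mult summable_geometric) simp
  fix k :: 'a assume nz: "indicator {k. 1 \<le> norm k} k *\<^sub>R norm k powr - \<gamma> \<noteq> (0::real)"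
  then have k: "1 \<le> norm k" by (auto split: split_indicator_asm)
  then obtain j where j: "2 ^ j \<le> norm k" "norm k < 2 ^ Suc j" using dyadic_shell by blast
  have "0 < \<gamma>" using assms by (meson of_nat_0_le_iff order_le_less_trans)
  then have "norm k powr - \<gamma> \<le> ?c j" by (intro powr_mono2') (use k j in auto)
  then show "\<exists>j. norm k \<le> ?r j \<and> indicator {k. 1 \<le> norm k} k *\<^sub>R norm k powr - \<gamma> \<le> ?c j"
    using k j by (intro exI[of _ j]) auto
qed auto

section \<open>Fourier transforms of Gaussians\<close>

lemma lborel_prod_integral:
  fixes f :: "'a::euclidean_space \<Rightarrow> real \<Rightarrow> complex"
  assumes int: "\<And>b. b \<in> Basis \<Longrightarrow> integrable lborel (f b)"
  shows "integrable lborel (\<lambda>k::'a. \<Prod>b\<in>Basis. f b (k \<bullet> b))"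
    and "(\<integral>k. (\<Prod>b\<in>Basis. f b (k \<bullet> b)) \<partial>lborel) = (\<Prod>b\<in>(Basis::'a set). \<integral>y. f b y \<partial>lborel)"
proof -
  interpret product_sigma_finite "\<lambda>b::'a. lborel :: real measure" by standard
  let ?P = "\<Pi>\<^sub>M b\<in>(Basis :: 'a set). (lborel :: real measure)"
  let ?S = "\<lambda>y. \<Sum>b\<in>Basis. y b *\<^sub>R b :: 'a"
  have m: "?S \<in> measurable ?P borel" by measurable
  have fm: "f b \<in> borel_measurable borel" if "b \<in> Basis" for b
    using borel_measurable_integrable[OF int[OF that]] by simp
  have mp: "(\<lambda>k. \<Prod>b\<in>Basis. f b (k \<bullet> b)) \<in> borel_measurable borel"
    by (intro borel_measurable_prod measurable_compose[OF _ fm]) auto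
  have eq: "(\<Prod>b\<in>Basis. f b (?S y \<bullet> b)) = (\<Prod>b\<in>Basis. f b (y b))" for y
    by (intro prod.cong refl) (simp add: inner_sum_left inner_Basis if_distrib cong: if_cong)
  have "integrable (distr ?P borel ?S) (\<lambda>k. \<Prod>b\<in>Basis. f b (k \<bullet> b))"
    by (subst integrable_distr_eq[OF m mp], unfold eq, rule product_integrable_prod) (use int in auto)
  then show "integrable lborel (\<lambda>k::'a. \<Prod>b\<in>Basis. f b (k \<bullet> b))"
    by (simp flip: lborel_eq)
  have "(\<integral>k. (\<Prod>b\<in>Basis. f b (k \<bullet> b)) \<partial>lborel) = (\<integral>k. (\<Prod>b\<in>Basis. f b (k \<bullet> b)) \<partial>distr ?P borel ?S)"
    by (simp flip: lborel_eq)
  also have "\<dots> = (\<integral>y. (\<Prod>b\<in>Basis. f b (y b)) \<partial>?P)"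
    by (subst integral_distr[OF m mp]) (simp only: eq)
  also have "\<dots> = (\<Prod>b\<in>(Basis::'a set). \<integral>y. f b y \<partial>lborel)"
    by (rule product_integral_prod) (use int in auto)
  finally show "(\<integral>k. (\<Prod>b\<in>Basis. f b (k \<bullet> b)) \<partial>lborel) = (\<Prod>b\<in>(Basis::'a set). \<integral>y. f b y \<partial>lborel)" .
qed

text \<open>A rescaled characteristic function of the standard normal law: with c = sqrt (2 t) one
  has (c y)^2 / 2 = t y^2, and the frequency becomes - a / c.\<close>

lemma gaussian_fourier_1d:
  fixes t a :: real
  assumes t: "t > 0"
  shows "integrable lborel (\<lambda>y. complex_of_real (exp (- t * y\<^sup>2)) * exp (- \<i> * complex_of_real (y * a)))"
    and "(\<integral>y. complex_of_real (exp (- t * y\<^sup>2)) * exp (- \<i> * complex_of_real (y * a)) \<partial>lborel)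
      = complex_of_real ((pi / t) powr (1/2) * exp (- a\<^sup>2 / (4 * t)))"
proof -
  define c where "c = sqrt (2 * t)"
  have c: "c > 0" "c\<^sup>2 = 2 * t" using t by (auto simp: c_def)
  define \<tau> where "\<tau> = - a / c"
  define h where "h x = std_normal_density x *\<^sub>R iexp (\<tau> * x)" for x
  have hint: "integrable lborel h"
  proof (rule Bochner_Integration.integrable_bound)
    show "integrable lborel std_normal_density" by simp
    show "h \<in> borel_measurable lborel" unfolding h_def by measurable
  qed (auto simp: h_def)
  have hval: "(\<integral>x. h x \<partial>lborel) = complex_of_real (exp (- \<tau>\<^sup>2 / 2))"
  proof -
    have "char std_normal_distribution \<tau> = (\<integral>x. h x \<partial>lborel)"
      unfolding char_def h_def by (subst integral_density) (auto simp: normal_density_nonneg)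
    then show ?thesis by (simp add: char_std_normal_distribution)
  qed
  have hc: "h (0 + c * y) = (1 / sqrt (2 * pi)) *\<^sub>R (complex_of_real (exp (- t * y\<^sup>2)) * exp (- \<i> * complex_of_real (y * a)))" for y
  proof -
    have "\<tau> * (c * y) = - (y * a)" using c by (simp add: \<tau>_def)
    moreover have "(c * y)\<^sup>2 / 2 = t * y\<^sup>2" using c by (simp add: power_mult_distrib)
    ultimately show ?thesis
      unfolding h_def normal_density_def by (simp add: scaleR_conv_of_real exp_of_real[symmetric] del: exp_of_real)
  qed
  let ?f = "\<lambda>y. complex_of_real (exp (- t * y\<^sup>2)) * exp (- \<i> * complex_of_real (y * a))"
  have fh: "?f y = sqrt (2 * pi) *\<^sub>R h (0 + c * y)" for y
    unfolding hc by simp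
  have "integrable lborel (\<lambda>y. h (0 + c * y))" using lborel_integrable_real_affine[OF hint, of c 0] c by simp
  then show "integrable lborel ?f" unfolding fh by (rule integrable_scaleR_right)
  have "(\<integral>x. h x \<partial>lborel) = c *\<^sub>R (\<integral>y. h (0 + c * y) \<partial>lborel)"
    using lborel_integral_real_affine[of c h 0] c by simp
  then have "(\<integral>y. h (0 + c * y) \<partial>lborel) = (1 / c) *\<^sub>R complex_of_real (exp (- \<tau>\<^sup>2 / 2))"
    using c hval by simp
  then have "(\<integral>y. ?f y \<partial>lborel) = sqrt (2 * pi) *\<^sub>R (1 / c) *\<^sub>R complex_of_real (exp (- \<tau>\<^sup>2 / 2))"
    unfolding fh by simp
  also have "sqrt (2 * pi) *\<^sub>R (1 / c) *\<^sub>R complex_of_real (exp (- \<tau>\<^sup>2 / 2)) = complex_of_real (sqrt (2 * pi) / c * exp (- \<tau>\<^sup>2 / 2))"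
    by (simp add: scaleR_conv_of_real)
  also have "sqrt (2 * pi) / c = (pi / t) powr (1/2)"
    using t by (simp add: c_def powr_half_sqrt real_sqrt_divide[symmetric])
  also have "- \<tau>\<^sup>2 / 2 = - a\<^sup>2 / (4 * t)" using c by (simp add: \<tau>_def power_divide)
  finally show "(\<integral>y. ?f y \<partial>lborel) = complex_of_real ((pi / t) powr (1/2) * exp (- a\<^sup>2 / (4 * t)))" .
qed

lemma gaussian_fourier:
  fixes X :: "'a::euclidean_space"
  assumes t: "t > 0"
  shows "integrable lborel (\<lambda>k::'a. complex_of_real (exp (- t * (norm k)\<^sup>2)) * exp (- \<i> * complex_of_real (k \<bullet> X)))"
    and "(\<integral>k. complex_of_real (exp (- t * (norm k)\<^sup>2)) * exp (- \<i> * complex_of_real (k \<bullet> X)) \<partial>lborel)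
      = complex_of_real ((pi / t) powr (real DIM('a) / 2) * exp (- (norm X)\<^sup>2 / (4 * t)))"
proof -
  define f where "f b y = complex_of_real (exp (- t * y\<^sup>2)) * exp (- \<i> * complex_of_real (y * (X \<bullet> b)))" for b :: 'a and y
  have nrm: "(norm v)\<^sup>2 = (\<Sum>b\<in>Basis. (v \<bullet> b)\<^sup>2)" for v :: 'a
    by (subst power2_norm_eq_inner, subst euclidean_inner) (simp add: power2_eq_square)
  have eq: "complex_of_real (exp (- t * (norm k)\<^sup>2)) * exp (- \<i> * complex_of_real (k \<bullet> X)) = (\<Prod>b\<in>Basis. f b (k \<bullet> b))" for k
  proof -
    have "(\<Prod>b\<in>Basis. f b (k \<bullet> b)) = complex_of_real (\<Prod>b\<in>Basis. exp (- t * (k \<bullet> b)\<^sup>2)) * (\<Prod>b\<in>Basis. exp (- \<i> * complex_of_real ((k \<bullet> b) * (X \<bullet> b))))"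
      unfolding f_def by (simp add: prod.distrib)
    also have "(\<Prod>b\<in>Basis. exp (- t * (k \<bullet> b)\<^sup>2)) = exp (- t * (norm k)\<^sup>2)"
      by (simp add: exp_sum[symmetric] nrm sum_distrib_left sum_negf)
    also have "(\<Prod>b\<in>Basis. exp (- \<i> * complex_of_real ((k \<bullet> b) * (X \<bullet> b)))) = exp (- \<i> * complex_of_real (k \<bullet> X))"
      by (subst exp_sum[symmetric]) (simp_all add: euclidean_inner[of k X] sum_distrib_left sum_negf)
    finally show ?thesis ..
  qed
  have fint: "integrable lborel (f b)" for b unfolding f_def[abs_def] by (rule gaussian_fourier_1d(1)[OF t])
  have fval: "(\<integral>y. f b y \<partial>lborel) = complex_of_real ((pi / t) powr (1/2) * exp (- (X \<bullet> b)\<^sup>2 / (4 * t)))" for b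
    unfolding f_def by (rule gaussian_fourier_1d(2)[OF t])
  show "integrable lborel (\<lambda>k::'a. complex_of_real (exp (- t * (norm k)\<^sup>2)) * exp (- \<i> * complex_of_real (k \<bullet> X)))"
    unfolding eq by (rule lborel_prod_integral(1)) (rule fint)
  have "(\<integral>k. (\<Prod>b\<in>Basis. f b (k \<bullet> b)) \<partial>lborel) = (\<Prod>b\<in>(Basis :: 'a set). complex_of_real ((pi / t) powr (1/2) * exp (- (X \<bullet> b)\<^sup>2 / (4 * t))))"
    by (subst lborel_prod_integral(2)[OF fint]) (simp only: fval)
  also have "\<dots> = complex_of_real ((\<Prod>b\<in>(Basis :: 'a set). (pi / t) powr (1/2)) * (\<Prod>b\<in>(Basis :: 'a set). exp (- (X \<bullet> b)\<^sup>2 / (4 * t))))"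
    by (simp add: prod.distrib)
  also have "(\<Prod>b\<in>(Basis :: 'a set). (pi / t) powr (1/2)) = (pi / t) powr (real DIM('a) / 2)"
    using t by (subst prod_constant, subst powr_power) auto
  also have "(\<Prod>b\<in>(Basis :: 'a set). exp (- (X \<bullet> b)\<^sup>2 / (4 * t))) = exp (- (norm X)\<^sup>2 / (4 * t))"
    by (simp add: exp_sum[symmetric] nrm sum_divide_distrib sum_negf)
  finally show "(\<integral>k. complex_of_real (exp (- t * (norm k)\<^sup>2)) * exp (- \<i> * complex_of_real (k \<bullet> X)) \<partial>lborel)
      = complex_of_real ((pi / t) powr (real DIM('a) / 2) * exp (- (norm X)\<^sup>2 / (4 * t)))"
    unfolding eq .
qed

lemma gaussian_integral:
  assumes t: "t > 0"
  shows "integrable lborel (\<lambda>k::'a::euclidean_space. exp (- t * (norm k)\<^sup>2))"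
    and "(\<integral>k. exp (- t * (norm (k::'a::euclidean_space))\<^sup>2) \<partial>lborel) = (pi / t) powr (real DIM('a) / 2)"
proof -
  have i: "integrable lborel (\<lambda>k::'a. complex_of_real (exp (- t * (norm k)\<^sup>2)))"
    using gaussian_fourier(1)[OF t, of "0::'a"] by simp
  then show "integrable lborel (\<lambda>k::'a. exp (- t * (norm k)\<^sup>2))"
    using integrable_Re[OF i] by simp
  have "complex_of_real (\<integral>k. exp (- t * (norm (k::'a))\<^sup>2) \<partial>lborel) = complex_of_real ((pi / t) powr (real DIM('a) / 2))"
    using gaussian_fourier(2)[OF t, of "0::'a"] by simp
  then show "(\<integral>k. exp (- t * (norm (k::'a))\<^sup>2) \<partial>lborel) = (pi / t) powr (real DIM('a) / 2)"
    by (simp only: of_real_eq_iff)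
qed

text \<open>
  A difference of the Gaussian brings down powers of \<open>exp (- i u z) - 1\<close> in its Fourier
  representation, so no derivatives are needed.
\<close>
lemma findiff_gaussian_le:
  fixes u k :: "'a::euclidean_space"
  assumes t: "t > 0"
  shows "\<bar>findiff u (2 * m) (\<lambda>k. exp (- t * (norm k)\<^sup>2)) k\<bar>
    \<le> 2 powr (real DIM('a) / 2) * fact m * 8 ^ m * t ^ m * norm u ^ (2 * m)"
proof -
  \<comment> \<open>The dual parameter: exp (- t |k|^2) is, up to the factor \<open>A\<close>, the
    Fourier transform of exp (- t' |z|^2).\<close>
  define t' where "t' = 1 / (4 * t)"
  have t': "t' > 0" using t by (simp add: t'_def)
  define A where "A = (pi / t') powr (real DIM('a) / 2)"
  have A: "A > 0" using t' by (simp add: A_def)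
  define e where "e z k = exp (- \<i> * complex_of_real (z \<bullet> k))" for z k :: 'a
  define h where "h z = complex_of_real (exp (- t' * (norm z)\<^sup>2))" for z :: 'a
  have ne: "norm (e z k) = 1" for z k by (simp add: e_def)
  have em [measurable]: "(\<lambda>z. e z k) \<in> borel_measurable borel" for k unfolding e_def by measurable
  have hm [measurable]: "h \<in> borel_measurable borel" unfolding h_def[abs_def] by measurable
  have hi: "integrable lborel h"
    using gaussian_fourier(1)[OF t', of "0::'a"] by (simp add: h_def[abs_def])
  have bi: "integrable lborel (\<lambda>z. h z * (e z u - 1) ^ n * e z k)" for n k
  proof (rule Bochner_Integration.integrable_bound)
    show "integrable lborel (\<lambda>z. 2 ^ n * h z)" using hi by simp
    have "norm (e z u - 1) \<le> 2" for z using norm_triangle_ineq4[of "e z u" 1] by (simp add: ne)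
    then show "AE z in lborel. norm (h z * (e z u - 1) ^ n * e z k) \<le> norm (2 ^ n * h z)"
      by (auto simp: norm_mult norm_power ne mult.commute intro!: mult_left_mono power_mono)
  qed measurable
  have g: "(\<integral>z. h z * e z k \<partial>lborel) = complex_of_real (A * exp (- t * (norm k)\<^sup>2))" for k
    using gaussian_fourier(2)[OF t', of k] t unfolding h_def e_def A_def[symmetric] by (simp add: t'_def)
  have fd: "findiff u n (\<lambda>k. \<integral>z. h z * e z k \<partial>lborel) k = (\<integral>z. h z * (e z u - 1) ^ n * e z k \<partial>lborel)" for n k
  proof (induction n arbitrary: k)
    case (Suc n)
    have "findiff u (Suc n) (\<lambda>k. \<integral>z. h z * e z k \<partial>lborel) k
      = (\<integral>z. h z * (e z u - 1) ^ n * e z (k + u) \<partial>lborel) - (\<integral>z. h z * (e z u - 1) ^ n * e z k \<partial>lborel)"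
      by (simp add: Suc.IH)
    also have "\<dots> = (\<integral>z. h z * (e z u - 1) ^ n * e z (k + u) - h z * (e z u - 1) ^ n * e z k \<partial>lborel)"
      by (rule Bochner_Integration.integral_diff[symmetric]) (rule bi)+
    also have "\<dots> = (\<integral>z. h z * (e z u - 1) ^ Suc n * e z k \<partial>lborel)"
    proof (rule Bochner_Integration.integral_cong[OF refl])
      fix z
      have "e z (k + u) = e z u * e z k" by (simp add: e_def inner_add_right exp_add[symmetric] algebra_simps)
      then show "h z * (e z u - 1) ^ n * e z (k + u) - h z * (e z u - 1) ^ n * e z k = h z * (e z u - 1) ^ Suc n * e z k"
        by (simp add: algebra_simps)
    qed
    finally show ?case .
  qed simp
  let ?B = "\<lambda>z::'a. (fact m * (2 / t') ^ m * norm u ^ (2 * m)) * exp (- (t' / 2) * (norm z)\<^sup>2)"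
  have Bi: "integrable lborel ?B" using gaussian_integral(1)[where 'a='a, of "t' / 2"] t' by simp
  have le: "norm (h z * (e z u - 1) ^ (2 * m) * e z k) \<le> ?B z" for z
  proof -
    \<comment> \<open>Half of the Gaussian exponent t' |z|^2 = 2 y. The factor |z|^(2 m) is paid
      with y^m <= m! exp y, and exp (- y) remains to be integrated; halving the exponent is what
      produces the constant 2^(d / 2).\<close>
    define y where "y = t' / 2 * (norm z)\<^sup>2"
    have y0: "y \<ge> 0" using t' by (simp add: y_def)
    have "norm (e z u - 1) \<le> norm u * norm z"
    proof -
      have "norm (e z u - 1) = 2 * \<bar>sin (- (z \<bullet> u) / 2)\<bar>"
        using dist_exp_i_1[of "- (z \<bullet> u)"] by (simp add: e_def)
      also have "\<dots> \<le> 2 * \<bar>- (z \<bullet> u) / 2\<bar>" by (intro mult_left_mono abs_sin_x_le_abs_x) auto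
      also have "\<dots> \<le> norm u * norm z" using Cauchy_Schwarz_ineq2[of z u] by (simp add: mult.commute)
      finally show ?thesis .
    qed
    then have "norm (e z u - 1) ^ (2 * m) \<le> (norm u * norm z) ^ (2 * m)" by (intro power_mono) auto
    also have "\<dots> = norm u ^ (2 * m) * (2 / t') ^ m * y ^ m"
      using t' by (simp add: y_def power_mult_distrib power_mult power_divide)
    also have "\<dots> \<le> norm u ^ (2 * m) * (2 / t') ^ m * (fact m * exp y)"
    proof (intro mult_left_mono)
      have "y ^ m / fact m \<le> exp y"
        using sum_le_suminf[OF summable_exp_generic[of y], of "{m}"] y0
        by (simp add: exp_def divide_inverse mult.commute)
      then show "y ^ m \<le> fact m * exp y" by (simp add: field_simps)
    qed (use t' in auto)
    finally have "norm (e z u - 1) ^ (2 * m) \<le> norm u ^ (2 * m) * (2 / t') ^ m * (fact m * exp y)" .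
    then have "norm (h z * (e z u - 1) ^ (2 * m) * e z k) \<le> exp (- t' * (norm z)\<^sup>2) * (norm u ^ (2 * m) * (2 / t') ^ m * (fact m * exp y))"
      by (simp add: h_def norm_mult norm_power ne)
    also have "\<dots> = fact m * (2 / t') ^ m * norm u ^ (2 * m) * (exp (- t' * (norm z)\<^sup>2) * exp y)"
      by (simp only: mult_ac)
    also have "exp (- t' * (norm z)\<^sup>2) * exp y = exp (- (t' / 2) * (norm z)\<^sup>2)"
      by (simp add: y_def exp_add[symmetric] field_simps)
    finally show ?thesis .
  qed
  have "A * \<bar>findiff u (2 * m) (\<lambda>k. exp (- t * (norm k)\<^sup>2)) k\<bar>
      = norm (findiff u (2 * m) (\<lambda>k. complex_of_real (A * exp (- t * (norm k)\<^sup>2))) k)"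
    unfolding findiff_of_real findiff_cmult using A by (simp add: norm_mult)
  also have "\<dots> = norm (\<integral>z. h z * (e z u - 1) ^ (2 * m) * e z k \<partial>lborel)"
    unfolding g[symmetric] fd ..
  also have "\<dots> \<le> (\<integral>z. ?B z \<partial>lborel)"
    by (rule order_trans[OF integral_norm_bound integral_mono[OF integrable_norm[OF bi] Bi]]) (rule le)
  also have "\<dots> = (fact m * (2 / t') ^ m * norm u ^ (2 * m)) * (pi / (t' / 2)) powr (real DIM('a) / 2)"
    using gaussian_integral(2)[where 'a='a, of "t' / 2"] t' by simp
  also have "(pi / (t' / 2)) powr (real DIM('a) / 2) = 2 powr (real DIM('a) / 2) * A"
    using t' unfolding A_def by (subst powr_mult[symmetric]) (auto simp: mult.commute)
  also have "(2 / t') ^ m = 8 ^ m * t ^ m" by (simp add: t'_def power_mult_distrib)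
  finally have "A * \<bar>findiff u (2 * m) (\<lambda>k. exp (- t * (norm k)\<^sup>2)) k\<bar>
     \<le> A * (2 powr (real DIM('a) / 2) * fact m * 8 ^ m * t ^ m * norm u ^ (2 * m))"
    by (simp only: mult_ac)
  then show ?thesis using A by simp
qed

text \<open>The antiderivative is exp (- a / s) / a. The heat time is taken as 1 / s because exp (-
  |k|^2 / s) transforms into a multiple of s^(d / 2) exp (- s |x|^2 / 4), after which the integral
  over s is literally a Gamma integral.\<close>

lemma integral_exp_inverse:
  fixes a :: real
  assumes a: "a > 0"
  shows "integrable lborel (\<lambda>s. indicator {0<..} s * (exp (- (1 / s) * a) / s\<^sup>2))"
    and "(\<integral>s. indicator {0<..} s * (exp (- (1 / s) * a) / s\<^sup>2) \<partial>lborel) = 1 / a"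
proof -
  let ?f = "\<lambda>s. exp (- (1 / s) * a) / s\<^sup>2" and ?F = "\<lambda>s. exp (- (1 / s) * a) / a"
  have ein: "einterval 0 \<infinity> = {0::real<..}" by (auto simp: einterval_def)
  have D: "DERIV ?F s :> ?f s" if "0 < s" for s
    using that a by (auto intro!: derivative_eq_intros simp: power2_eq_square field_simps)
  have lim0: "((?F \<circ> real_of_ereal) \<longlongrightarrow> 0) (at_right 0)"
  proof -
    have "filterlim (\<lambda>s. - a * inverse s) at_bot (at_right 0)"
      using filterlim_tendsto_neg_mult_at_bot[OF tendsto_const[of "- a"] _ filterlim_inverse_at_top_right] a by simp
    from filterlim_compose[OF exp_at_bot this] have "((\<lambda>s. exp (- a * inverse s) / a) \<longlongrightarrow> 0 / a) (at_right 0)"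
      by (rule tendsto_divide) (use a in auto)
    then have "(?F \<longlongrightarrow> 0) (at_right 0)" by (simp add: divide_inverse mult.commute)
    then show ?thesis unfolding zero_ereal_def by (simp add: ereal_tendsto_simps)
  qed
  have limi: "((?F \<circ> real_of_ereal) \<longlongrightarrow> 1 / a) (at_left \<infinity>)"
  proof -
    have "((\<lambda>s. exp (- a * inverse s) / a) \<longlongrightarrow> exp (- a * 0) / a) at_top"
      by (intro tendsto_intros tendsto_inverse_0_at_top filterlim_ident) (use a in auto)
    then have "(?F \<longlongrightarrow> 1 / a) at_top" by (simp add: divide_inverse mult.commute)
    then show ?thesis by (simp add: ereal_tendsto_simps)
  qed
  have c: "isCont ?f s" if "0 < s" for s using that by (intro continuous_intros) auto
  have "set_integrable lborel (einterval 0 \<infinity>) ?f"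
    by (rule interval_integral_FTC_nonneg(1)[OF _ _ _ _ lim0 limi]) (use D c in auto)
  then show "integrable lborel (\<lambda>s. indicator {0<..} s * ?f s)"
    by (simp add: set_integrable_def ein)
  have "(LBINT s=0..\<infinity>. ?f s) = 1 / a - 0"
    by (rule interval_integral_FTC_nonneg(2)[OF _ _ _ _ lim0 limi]) (use D c in auto)
  then show "(\<integral>s. indicator {0<..} s * ?f s \<partial>lborel) = 1 / a"
    by (simp add: interval_lebesgue_integral_def set_lebesgue_integral_def ein)
qed

lemma Gamma_integral_scaled:
  fixes b z :: real
  assumes b: "b > 0" and z: "z > 0"
  shows "(\<integral>s. indicator {0<..} s * (s powr (z - 1) * exp (- b * s)) \<partial>lborel) = Gamma z * b powr - z"
proof -
  let ?g = "\<lambda>s::real. indicator {0..} s * s powr (z - 1) / exp s"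
  have G: "Gamma z > 0" by (rule Gamma_real_pos[OF z])
  have "has_bochner_integral lborel ?g (Gamma z)"
    by (rule has_bochner_integral_nn_integral) (use G Gamma_conv_nn_integral_real[OF z] in auto)
  then have "(\<integral>s. ?g s \<partial>lborel) = Gamma z" by (rule has_bochner_integral_integral_eq)
  moreover have "(\<integral>s. ?g s \<partial>lborel) = b * (\<integral>s. ?g (0 + b * s) \<partial>lborel)"
    using lborel_integral_real_affine[of b ?g 0] b by simp
  moreover have "?g (0 + b * s) = b powr (z - 1) * (indicator {0<..} s * (s powr (z - 1) * exp (- b * s)))" for s
    using b by (cases "s = 0") (auto simp: indicator_def powr_mult exp_minus field_simps zero_le_mult_iff)
  ultimately have "Gamma z = b * b powr (z - 1) * (\<integral>s. indicator {0<..} s * (s powr (z - 1) * exp (- b * s)) \<partial>lborel)"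
    by simp
  moreover have "b * b powr (z - 1) = b powr z" using b by (simp add: powr_mult_base)
  ultimately show ?thesis using b by (simp add: powr_minus field_simps)
qed

lemma findiff_integral:
  fixes G :: "'s \<Rightarrow> 'a::real_vector \<Rightarrow> 'b::{banach, second_countable_topology}"
  assumes "\<And>j. j \<le> n \<Longrightarrow> integrable M (\<lambda>s. G s (k + real j *\<^sub>R u))"
  shows "integrable M (\<lambda>s. findiff u n (G s) k)"
    and "findiff u n (\<lambda>k. \<integral>s. G s k \<partial>M) k = (\<integral>s. findiff u n (G s) k \<partial>M)"
  using assms
proof (induction n arbitrary: k)
  case 0
  { case 1 then show ?case using 0[of 0] by simp }
  { case 2 then show ?case by simp }
next
  case (Suc n)
  have a: "integrable M (\<lambda>s. G s (k + u + real j *\<^sub>R u))" if "j \<le> n"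
    and "\<And>j. j \<le> Suc n \<Longrightarrow> integrable M (\<lambda>s. G s (k + real j *\<^sub>R u))" for j k
    using that(2)[of "Suc j"] that(1) by (simp add: scaleR_add_left add.assoc)
  { case 1
    show ?case using Suc.IH(1)[of "k + u"] Suc.IH(1)[of k] a 1 by simp }
  { case 2
    show ?case using Suc.IH[of "k + u"] Suc.IH[of k] a 2 by simp }
qed

lemma measurable_findiff_pair:
  fixes g :: "real \<Rightarrow> 'a::euclidean_space \<Rightarrow> real"
  assumes "(\<lambda>(s, k). g s k) \<in> borel_measurable (borel \<Otimes>\<^sub>M borel)"
  shows "(\<lambda>(s, k). findiff u n (g s) k) \<in> borel_measurable (borel \<Otimes>\<^sub>M borel)"
proof (induction n)
  case 0
  then show ?case using assms by simp
next
  case (Suc n)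
  have "(\<lambda>p. (fst p, snd p + u)) \<in> (borel \<Otimes>\<^sub>M borel) \<rightarrow>\<^sub>M ((borel :: real measure) \<Otimes>\<^sub>M (borel :: 'a measure))"
    by measurable
  from borel_measurable_diff[OF measurable_compose[OF this Suc] Suc] show ?case
    by (simp add: case_prod_beta)
qed

section \<open>The Fourier transform of the inverse square of the norm\<close>

text \<open>Tailored to the heat integral: - 1 / 2 is the worst exponent d / 2 - 2 near s = 0,
  reached for d = 3, and - 2 is what the differences guarantee for large s.\<close>

lemma integrable_split_powr:
  fixes h :: "real \<Rightarrow> real"
  assumes m: "h \<in> borel_measurable borel" and C: "C \<ge> 0"
    and small: "\<And>s. \<bar>s\<bar> \<le> 1 \<Longrightarrow> \<bar>h s\<bar> \<le> C * \<bar>s\<bar> powr (- 1/2)"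
    and large: "\<And>s. 1 < \<bar>s\<bar> \<Longrightarrow> \<bar>h s\<bar> \<le> C * \<bar>s\<bar> powr - 2"
  shows "integrable lborel h"
proof -
  let ?A = "\<lambda>s::real. indicator (cball 0 1) s *\<^sub>R norm s powr - (1/2)"
  let ?B = "\<lambda>s::real. indicator {s. 1 \<le> norm s} s *\<^sub>R norm s powr - 2"
  have "integrable lborel ?A"
    using set_integrable_norm_powr_cball[where 'a=real, of "1/2" 1] by (simp add: set_integrable_def)
  moreover have "integrable lborel ?B"
    using set_integrable_norm_powr_outside[where 'a=real, of 2] by (simp add: set_integrable_def)
  ultimately have int: "integrable lborel (\<lambda>s. C * (?A s + ?B s))" by simp
  show ?thesis
  proof (rule Bochner_Integration.integrable_bound[OF int])
    show "h \<in> borel_measurable lborel" using m by simp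
    have "norm (h s) \<le> C * (?A s + ?B s)" for s
    proof (cases "\<bar>s\<bar> \<le> 1")
      case True
      have "C * \<bar>s\<bar> powr (- 1/2) \<le> C * (?A s + ?B s)"
        by (intro mult_left_mono C) (use True in \<open>auto split: split_indicator\<close>)
      then show ?thesis using small[OF True] by simp
    next
      case False
      have "C * \<bar>s\<bar> powr - 2 \<le> C * (?A s + ?B s)"
        by (intro mult_left_mono C) (use False in \<open>auto split: split_indicator\<close>)
      then show ?thesis using large[of s] False by simp
    qed
    then show "AE s in lborel. norm (h s) \<le> norm (C * (?A s + ?B s))"
      by (intro always_eventually allI) (smt (verit) real_norm_def)
  qed
qed

text \<open>
  The \<open>n\<close>-th difference makes \<open>1 / |k|\<^sup>2\<close> integrable at infinity; the heat kernel representation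
  \<open>1 / |k|\<^sup>2 = \<integral> exp (- |k|\<^sup>2 / s) / s\<^sup>2 ds\<close> then gives its Fourier transform.
\<close>
lemma riesz_fourier:
  fixes x :: "int^'d::finite"
  assumes d: "CARD('d) \<ge> 3" and x: "x \<noteq> 0" and m: "CARD('d) \<le> m"
  defines "w \<equiv> \<lambda>k::real^'d. 1 / (norm k)\<^sup>2"
  shows "integrable lborel (findiff (half_period x) (2 * m) w)"
    and "(\<integral>k. complex_of_real (findiff (half_period x) (2 * m) w k) * wave (- x) k \<partial>lborel)
      = complex_of_real ((-2) ^ (2 * m) * (pi powr (real CARD('d) / 2) * Gamma (real CARD('d) / 2 - 1)
          * ((enorm x)\<^sup>2 / 4) powr (1 - real CARD('d) / 2)))"
proof -
  let ?u = "half_period x" and ?n = "2 * m" and ?d = "real CARD('d)"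
  define g where "g s k = exp (- (1 / s) * (norm k)\<^sup>2)" for s and k :: "real^'d"
  define fd where "fd s k = findiff ?u ?n (g s) k" for s k
  \<comment> \<open>Gaussians with half the exponent, so that their squares are the values of
    \<open>g s\<close> at the sampled points; the square root taken below then stays integrable in
    k.\<close>
  define Q where "Q s k = (\<Sum>j\<le>?n. exp (- (1 / (2 * s)) * (norm (k + real j *\<^sub>R ?u))\<^sup>2))" for s and k :: "real^'d"
  define A where "A = 2 powr (?d / 2) * fact m * 8 ^ m * norm ?u ^ (2 * m)"
  define C where "C = max (2 ^ ?n) (sqrt (A * 2 ^ ?n))"
  have A0: "A \<ge> 0" by (simp add: A_def)
  have C0: "C \<ge> 0" by (simp add: C_def max.coboundedI1)
  have Q0: "Q s k \<ge> 0" for s k unfolding Q_def by (intro sum_nonneg) auto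
  define h where "h s = (if s \<le> 1 then 1 else s powr (- real m / 2))" for s :: real
  have gQ: "\<bar>fd s k\<bar> \<le> 2 ^ ?n * (\<Sum>j\<le>?n. (exp (- (1 / (2 * s)) * (norm (k + real j *\<^sub>R ?u))\<^sup>2))\<^sup>2)" for s k
  proof -
    have "(exp (- (1 / (2 * s)) * (norm y)\<^sup>2))\<^sup>2 = g s y" for y :: "real^'d"
      unfolding g_def by (simp add: exp_double[symmetric] flip: exp_of_nat_mult)
    then show ?thesis using findiff_norm_le_sum[of ?u ?n "g s" k] by (simp add: fd_def g_def)
  qed
  have fd_le: "\<bar>fd s k\<bar> \<le> C * (h s * Q s k)" if s: "s > 0" for s k
  proof -
    let ?q = "\<lambda>j. exp (- (1 / (2 * s)) * (norm (k + real j *\<^sub>R ?u))\<^sup>2)"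
    have q1: "?q j \<le> 1" for j using s by simp
    have q2: "(?q j)\<^sup>2 = ?q j * ?q j" for j by (rule power2_eq_square)
    show ?thesis
    proof (cases "s \<le> 1")
      case True
      have "(\<Sum>j\<le>?n. (?q j)\<^sup>2) \<le> Q s k"
        unfolding Q_def q2 by (intro sum_mono mult_left_le q1 exp_ge_zero)
      then have "\<bar>fd s k\<bar> \<le> 2 ^ ?n * Q s k" using gQ[of s k] by (smt (verit) mult_left_mono zero_le_power)
      also have "\<dots> \<le> C * Q s k" by (intro mult_right_mono Q0) (simp add: C_def)
      finally show ?thesis using True by (simp add: h_def)
    next
      case False
      have "(\<Sum>j\<le>?n. (?q j)\<^sup>2) \<le> (\<Sum>j\<le>?n. ?q j * Q s k)"
        unfolding q2 Q_def by (intro sum_mono mult_left_mono member_le_sum) auto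
      also have "\<dots> = Q s k * Q s k" by (simp add: Q_def sum_distrib_right)
      finally have 1: "\<bar>fd s k\<bar> \<le> 2 ^ ?n * (Q s k)\<^sup>2" using gQ[of s k] unfolding power2_eq_square
        by (smt (verit) mult_left_mono zero_le_power)
      have 2: "\<bar>fd s k\<bar> \<le> A * (1 / s) ^ m"
        using findiff_gaussian_le[of "1 / s" ?u m k] s unfolding fd_def g_def A_def by (simp add: mult_ac)
      \<comment> \<open>A geometric mean of two bounds: the trivial one is integrable in k but does
        not decay in s, the Gaussian difference bound decays like s^(- m) but is constant in k. The
        mean keeps half of each.\<close>
      have "\<bar>fd s k\<bar>\<^sup>2 \<le> (A * (1 / s) ^ m) * (2 ^ ?n * (Q s k)\<^sup>2)"
        unfolding power2_eq_square[of "\<bar>fd s k\<bar>"] using 1 2 by (intro mult_mono) auto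
      also have "\<dots> = (A * 2 ^ ?n) * (1 / s) ^ m * (Q s k)\<^sup>2" by simp
      also have "\<dots> = (sqrt (A * 2 ^ ?n) * (s powr (- real m / 2) * Q s k))\<^sup>2"
      proof -
        have "(s powr (- real m / 2))\<^sup>2 = s powr (- real m)"
          unfolding power2_eq_square by (simp add: powr_add[symmetric])
        also have "\<dots> = (1 / s) ^ m" using s by (simp add: powr_minus powr_realpow power_divide divide_inverse power_inverse)
        finally show ?thesis using A0 by (simp add: power_mult_distrib)
      qed
      finally have "\<bar>fd s k\<bar> \<le> sqrt (A * 2 ^ ?n) * (s powr (- real m / 2) * Q s k)"
        by (rule power2_le_imp_le) (use A0 Q0 in simp)
      also have "\<dots> \<le> C * (s powr (- real m / 2) * Q s k)"
        by (intro mult_right_mono) (use Q0 in \<open>auto simp: C_def\<close>)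
      finally show ?thesis using False by (simp add: h_def)
    qed
  qed
  have gm: "(\<lambda>(s, k). g s k) \<in> borel_measurable (borel \<Otimes>\<^sub>M borel)"
    unfolding g_def by measurable
  have fdm [measurable]: "(\<lambda>p. fd (fst p) (snd p)) \<in> borel_measurable (borel \<Otimes>\<^sub>M borel)"
    using measurable_findiff_pair[OF gm, of ?u ?n] by (simp add: fd_def case_prod_beta)
  define f where "f s k = complex_of_real (indicator {0<..} s * (fd s k / s\<^sup>2)) * wave (- x) k" for s k
  have fm: "(\<lambda>(s, k). f s k) \<in> borel_measurable (lborel \<Otimes>\<^sub>M lborel)"
    unfolding f_def by measurable
  have Qint: "integrable lborel (Q s)" "(\<integral>k. Q s k \<partial>lborel) = real (Suc ?n) * (2 * pi * s) powr (?d / 2)" if s: "s > 0" for s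
  proof -
    have t: "1 / (2 * s) > 0" using s by simp
    have 1: "integrable lborel (\<lambda>k::real^'d. exp (- (1 / (2 * s)) * (norm (k + real j *\<^sub>R ?u))\<^sup>2))" for j
      using gaussian_integral(1)[OF t] integrable_lborel_translate_iff[of "\<lambda>k::real^'d. exp (- (1 / (2 * s)) * (norm k)\<^sup>2)"] by blast
    then show "integrable lborel (Q s)" unfolding Q_def[abs_def] by (intro Bochner_Integration.integrable_sum)
    have v: "(\<integral>k. exp (- (1 / (2 * s)) * (norm (k + real j *\<^sub>R ?u))\<^sup>2) \<partial>(lborel :: (real^'d) measure)) = (2 * pi * s) powr (?d / 2)" for j
      using gaussian_integral(2)[where 'a="real^'d", OF t] s
      by (subst integral_lborel_translate[of "\<lambda>k. exp (- (1 / (2 * s)) * (norm k)\<^sup>2)"]) (simp add: mult_ac)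
    show "(\<integral>k. Q s k \<partial>lborel) = real (Suc ?n) * (2 * pi * s) powr (?d / 2)"
      unfolding Q_def by (subst Bochner_Integration.integral_sum[OF 1]) (simp only: v, simp)
  qed
  have f_le: "norm (f s k) \<le> indicator {0<..} s * (C * h s / s\<^sup>2) * Q s k" for s k
  proof (cases "s > 0")
    case True
    then have "norm (f s k) = \<bar>fd s k\<bar> / s\<^sup>2" by (simp add: f_def norm_mult norm_divide norm_power)
    also have "\<dots> \<le> C * (h s * Q s k) / s\<^sup>2" by (intro divide_right_mono fd_le True) auto
    finally show ?thesis using True by simp
  qed (simp add: f_def)
  have domint: "integrable lborel (\<lambda>k. indicator {0<..} s * (C * h s / s\<^sup>2) * Q s k)" for s
    by (cases "s > 0") (auto intro!: integrable_mult_right Qint(1))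
  have fk: "integrable lborel (f s)" for s
  proof (rule Bochner_Integration.integrable_bound)
    show "integrable lborel (\<lambda>k. indicator {0<..} s * (C * h s / s\<^sup>2) * Q s k)"
      by (rule domint)
    show "f s \<in> borel_measurable lborel" using fm by measurable
    show "AE k in lborel. norm (f s k) \<le> norm (indicator {0<..} s * (C * h s / s\<^sup>2) * Q s k)"
      using f_le[of s] by (intro always_eventually allI) (smt (verit) real_norm_def)
  qed
  have fnorm: "integrable lborel (\<lambda>s. \<integral>k. norm (f s k) \<partial>lborel)"
  proof (rule integrable_split_powr)
    show "(\<lambda>s. \<integral>k. norm (f s k) \<partial>lborel) \<in> borel_measurable borel"
      using lborel.borel_measurable_lebesgue_integral[of "\<lambda>s k. norm (f s k)" lborel] fm by simp
    define D where "D = C * real (Suc ?n) * (2 * pi) powr (?d / 2)"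
    show D0: "D \<ge> 0" using C0 by (simp add: D_def)
    have le: "\<bar>\<integral>k. norm (f s k) \<partial>lborel\<bar> \<le> D * (indicator {0<..} s * (h s * \<bar>s\<bar> powr (?d / 2 - 2)))" for s
    proof -
      have "\<bar>\<integral>k. norm (f s k) \<partial>lborel\<bar> = (\<integral>k. norm (f s k) \<partial>lborel)" by simp
      also have "\<dots> \<le> (\<integral>k. indicator {0<..} s * (C * h s / s\<^sup>2) * Q s k \<partial>lborel)"
        by (rule integral_mono[OF integrable_norm[OF fk] domint f_le])
      also have "\<dots> \<le> D * (indicator {0<..} s * (h s * \<bar>s\<bar> powr (?d / 2 - 2)))"
      proof (cases "s > 0")
        case True
        have "s powr (?d / 2 - 2) = s powr (?d / 2) / s\<^sup>2" using True by (simp add: powr_diff powr_numeral)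
        then show ?thesis using True by (simp add: Qint D_def powr_mult mult_ac)
      qed simp
      finally show ?thesis .
    qed
    show "\<bar>\<integral>k. norm (f s k) \<partial>lborel\<bar> \<le> D * \<bar>s\<bar> powr (- 1/2)" if "\<bar>s\<bar> \<le> 1" for s
    proof -
      have "indicator {0<..} s * (h s * \<bar>s\<bar> powr (?d / 2 - 2)) \<le> \<bar>s\<bar> powr (- 1/2)"
      proof (cases "s > 0")
        case True
        \<comment> \<open>Here d >= 3 enters: integrating \<open>Q s\<close> gives s^(d / 2), and
          with 1 / s^2 the singularity at s = 0 is integrable.\<close>
        have "s powr (?d / 2 - 2) \<le> s powr (- 1/2)" by (rule powr_mono') (use True that d in auto)
        then show ?thesis using True that by (simp add: h_def)
      qed simp
      then show ?thesis using le[of s] D0 by (smt (verit) mult_left_mono)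
    qed
    show "\<bar>\<integral>k. norm (f s k) \<partial>lborel\<bar> \<le> D * \<bar>s\<bar> powr - 2" if "1 < \<bar>s\<bar>" for s
    proof -
      have "indicator {0<..} s * (h s * \<bar>s\<bar> powr (?d / 2 - 2)) \<le> \<bar>s\<bar> powr - 2"
      proof (cases "s > 0")
        case True
        then have s1: "1 < s" using that by simp
        have "h s * s powr (?d / 2 - 2) = s powr (- real m / 2 + (?d / 2 - 2))"
          using s1 unfolding h_def powr_add by simp
        \<comment> \<open>The decay s^(- m / 2) beats the growth s^(d / 2) because m >= d.\<close>
        also have "\<dots> \<le> s powr - 2" by (rule powr_mono) (use s1 m in auto)
        finally show ?thesis using True by simp
      qed simp
      then show ?thesis using le[of s] D0 by (smt (verit) mult_left_mono)
    qed
  qed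
  have pair: "integrable (lborel \<Otimes>\<^sub>M lborel) (\<lambda>(s, k). f s k)"
    by (rule lborel_pair.Fubini_integrable[OF fm]) (use fnorm fk in auto)
  have fub: "(\<integral>k. \<integral>s. f s k \<partial>lborel \<partial>lborel) = (\<integral>s. \<integral>k. f s k \<partial>lborel \<partial>lborel)"
    by (rule lborel_pair.Fubini_integral[OF pair])
  have ik: "integrable lborel (\<lambda>k. \<integral>s. f s k \<partial>lborel)"
    using lborel_pair.integrable_snd[OF pair] .
  \<comment> \<open>The heat representation of 1 / |y|^2 fails at y = 0, hence finitely many k are
    excluded, those for which some sampled point is the origin.\<close>
  have "AE k in lborel. \<forall>j\<in>{..?n}. k \<noteq> - (real j *\<^sub>R ?u)"
    by (rule AE_finite_allI) (auto intro: AE_lborel_singleton)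
  then have AE: "AE k in lborel. (\<integral>s. f s k \<partial>lborel) = complex_of_real (findiff ?u ?n w k) * wave (- x) k"
  proof eventually_elim
    case (elim k)
    let ?G = "\<lambda>s y::real^'d. indicator {0<..} s * (exp (- (1 / s) * (norm y)\<^sup>2) / s\<^sup>2)"
    have nz: "(norm (k + real j *\<^sub>R ?u))\<^sup>2 > 0" if "j \<le> ?n" for j
      using elim that by (simp add: add_eq_0_iff2)
    have Gi: "integrable lborel (\<lambda>s. ?G s (k + real j *\<^sub>R ?u))" if "j \<le> ?n" for j
      by (rule integral_exp_inverse(1)[OF nz[OF that]])
    have "findiff ?u ?n w k = findiff ?u ?n (\<lambda>y. \<integral>s. ?G s y \<partial>lborel) k"
      by (rule findiff_cong) (simp only: w_def integral_exp_inverse(2)[OF nz])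
    also have "\<dots> = (\<integral>s. findiff ?u ?n (?G s) k \<partial>lborel)"
      by (rule findiff_integral(2)) (rule Gi)
    also have "\<dots> = (\<integral>s. indicator {0<..} s * (fd s k / s\<^sup>2) \<partial>lborel)"
    proof (rule Bochner_Integration.integral_cong[OF refl])
      fix s
      have "?G s = (\<lambda>y. (indicator {0<..} s / s\<^sup>2) * g s y)" by (simp add: g_def fun_eq_iff)
      then show "findiff ?u ?n (?G s) k = indicator {0<..} s * (fd s k / s\<^sup>2)"
        by (simp only: findiff_cmult fd_def) simp
    qed
    finally show ?case unfolding f_def by (simp del: of_real_mult of_real_divide add: integral_complex_of_real)
  qed
  have wm [measurable]: "findiff ?u n w \<in> borel_measurable borel" for n
  proof (induction n)
    case 0
    have "w \<in> borel_measurable borel" unfolding w_def by measurable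
    then show ?case by (simp add: fun_eq_iff cong: measurable_cong)
  next
    case (Suc n)
    have "(\<lambda>k. findiff ?u n w (k + ?u) - findiff ?u n w k) \<in> borel_measurable borel"
      using measurable_compose[OF _ Suc, of "\<lambda>k. k + ?u" borel] Suc by simp
    then show ?case by (simp cong: measurable_cong)
  qed
  have iw: "integrable lborel (\<lambda>k. complex_of_real (findiff ?u ?n w k) * wave (- x) k)"
    by (rule integrable_cong_AE_imp[OF ik]) (use AE in \<open>auto elim: eventually_mono\<close>)
  from integrable_norm[OF this] have "integrable lborel (\<lambda>k. \<bar>findiff ?u ?n w k\<bar>)"
    by (simp add: norm_mult)
  then show "integrable lborel (findiff ?u ?n w)"
    by (subst (asm) integrable_abs_iff) auto
  \<comment> \<open>Integrating over k first: each Gaussian is integrable, so the difference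
    identity applies to it and yields (-2)^n times its explicit transform.\<close>
  have inner: "(\<integral>k. f s k \<partial>lborel) = complex_of_real (((-2) ^ ?n * pi powr (?d / 2)) *
      (indicator {0<..} s * (s powr (?d / 2 - 1 - 1) * exp (- ((enorm x)\<^sup>2 / 4) * s))))" for s
  proof (cases "s > 0")
    case True
    then have t: "1 / s > 0" by simp
    have gi: "integrable lborel (\<lambda>k::real^'d. complex_of_real (g s k))"
      using gaussian_integral(1)[where 'a="real^'d", OF t] unfolding g_def by simp
    have "(\<integral>k. f s k \<partial>lborel) = complex_of_real (1 / s\<^sup>2) * (\<integral>k. findiff ?u ?n (\<lambda>k. complex_of_real (g s k)) k * wave (- x) k \<partial>lborel)"
      unfolding f_def fd_def findiff_of_real integral_mult_right_zero[symmetric] using True by simp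
    also have "(\<integral>k. findiff ?u ?n (\<lambda>k. complex_of_real (g s k)) k * wave (- x) k \<partial>lborel)
        = (-2) ^ ?n * (\<integral>k. complex_of_real (g s k) * wave (- x) k \<partial>lborel)"
      by (rule integral_lborel_findiff[OF gi x])
    also have "(\<integral>k. complex_of_real (g s k) * wave (- x) k \<partial>lborel) =
        complex_of_real ((pi / (1 / s)) powr (?d / 2) * exp (- (norm (rvec x))\<^sup>2 / (4 * (1 / s))))"
      using gaussian_fourier(2)[OF t, of "rvec x"] unfolding g_def wave_minus_eq by simp
    also have "(pi / (1 / s)) powr (?d / 2) * exp (- (norm (rvec x))\<^sup>2 / (4 * (1 / s)))
       = pi powr (?d / 2) * s powr (?d / 2) * exp (- ((enorm x)\<^sup>2 / 4) * s)"
      using True by (simp add: powr_mult enorm_def)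
    also have "s powr (?d / 2) = s\<^sup>2 * s powr (?d / 2 - 1 - 1)"
      using True by (simp add: powr_diff power2_eq_square)
    finally show ?thesis using True by simp
  qed (simp add: f_def)
  have "(\<integral>k. complex_of_real (findiff ?u ?n w k) * wave (- x) k \<partial>lborel) = (\<integral>k. \<integral>s. f s k \<partial>lborel \<partial>lborel)"
    by (rule integral_cong_AE) (use ik iw AE in \<open>auto elim: eventually_mono\<close>)
  also have "\<dots> = complex_of_real (\<integral>s. ((-2) ^ ?n * pi powr (?d / 2)) *
      (indicator {0<..} s * (s powr (?d / 2 - 1 - 1) * exp (- ((enorm x)\<^sup>2 / 4) * s))) \<partial>lborel)"
    unfolding fub inner integral_complex_of_real ..
  also have "(\<integral>s. ((-2) ^ ?n * pi powr (?d / 2)) *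
      (indicator {0<..} s * (s powr (?d / 2 - 1 - 1) * exp (- ((enorm x)\<^sup>2 / 4) * s))) \<partial>lborel)
      = ((-2) ^ ?n * pi powr (?d / 2)) * (Gamma (?d / 2 - 1) * ((enorm x)\<^sup>2 / 4) powr - (?d / 2 - 1))"
    unfolding integral_mult_right_zero
    by (subst Gamma_integral_scaled) (use d enorm_ge_1[OF x] in \<open>auto intro!: divide_pos_pos\<close>)
  finally show "(\<integral>k. complex_of_real (findiff ?u ?n w k) * wave (- x) k \<partial>lborel)
      = complex_of_real ((-2) ^ ?n * (pi powr (?d / 2) * Gamma (?d / 2 - 1) * ((enorm x)\<^sup>2 / 4) powr (1 - ?d / 2)))"
    by (simp only: mult.assoc minus_diff_eq)
qed

section \<open>Differences of reciprocals\<close>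

lemma norm_shift_bounds:
  fixes k u :: "'a::real_normed_vector"
  assumes u: "2 * real n * norm u \<le> norm k" and j: "j \<le> n"
  shows "norm k / 2 \<le> norm (k + real j *\<^sub>R u)" and "norm (k + real j *\<^sub>R u) \<le> 3 / 2 * norm k"
proof -
  have "real j * norm u \<le> real n * norm u" using j by (intro mult_right_mono) auto
  then have ju: "norm (real j *\<^sub>R u) \<le> norm k / 2" using u by simp
  show "norm (k + real j *\<^sub>R u) \<le> 3 / 2 * norm k" using norm_triangle_ineq[of k "real j *\<^sub>R u"] ju by simp
  show "norm k / 2 \<le> norm (k + real j *\<^sub>R u)" using norm_diff_ineq[of k "real j *\<^sub>R u"] ju by simp
qed

text \<open>All orders m >= 1 receive the bound of the first difference: the remaining m - 1
  differences only take signed sums of first differences at points of size comparable with |k|, so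
  no further gain is claimed.\<close>

lemma findiff_le_of_first_difference:
  fixes \<phi> :: "'a::real_normed_vector \<Rightarrow> real"
  assumes D: "\<And>y. \<bar>\<phi> (y + u) - \<phi> y\<bar> \<le> B * ((norm y + norm u) * norm u)" and B: "0 \<le> B"
    and u: "2 * real n * norm u \<le> norm k" and m: "1 \<le> m" "m + j \<le> n"
  shows "\<bar>findiff u m \<phi> (k + real j *\<^sub>R u)\<bar> \<le> 2 ^ n * (2 * B) * (norm k * norm u)"
proof -
  obtain m' where m': "m = Suc m'" using m by (cases m) auto
  have "\<bar>findiff u m \<phi> (k + real j *\<^sub>R u)\<bar> = norm (findiff u m' (\<lambda>y. \<phi> (y + u) - \<phi> y) (k + real j *\<^sub>R u))"
    unfolding m' findiff_Suc_eq by simp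
  also have "\<dots> \<le> 2 ^ m' * (2 * B * (norm k * norm u))"
  proof (rule findiff_norm_le)
    fix i assume i: "i \<le> m'"
    let ?y = "k + real j *\<^sub>R u + real i *\<^sub>R u"
    have "norm ?y \<le> norm k + norm (real j *\<^sub>R u) + norm (real i *\<^sub>R u)"
      by (meson norm_triangle_ineq order_trans add_right_mono)
    then have "norm ?y + norm u \<le> norm k + (real j + real i + 1) * norm u" by (simp add: algebra_simps)
    also have "\<dots> \<le> norm k + real n * norm u"
      using i m m' by (intro add_left_mono mult_right_mono) auto
    also have "\<dots> \<le> 2 * norm k" using u norm_ge_zero[of k] by linarith
    finally have "(norm ?y + norm u) * norm u \<le> 2 * norm k * norm u" by (intro mult_right_mono) auto
    then have "B * ((norm ?y + norm u) * norm u) \<le> B * (2 * norm k * norm u)" by (intro mult_left_mono B)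
    then show "norm (\<phi> (?y + u) - \<phi> ?y) \<le> 2 * B * (norm k * norm u)"
      using D[of ?y] by simp
  qed
  also have "\<dots> \<le> 2 ^ n * (2 * B * (norm k * norm u))"
    using B m m' by (intro mult_right_mono power_increasing) auto
  finally show ?thesis by (simp add: mult.assoc)
qed

lemma findiff_square_zero:
  fixes k u :: "'a::real_inner"
  assumes "m \<ge> 3"
  shows "findiff u m (\<lambda>k. c * (norm k)\<^sup>2) k = 0"
proof -
  have 3: "findiff u 3 (\<lambda>k. c * (norm k)\<^sup>2) y = 0" for y
    unfolding numeral_3_eq_3 by (simp add: power2_norm_eq_inner inner_simps inner_commute algebra_simps)
  obtain m' where "m = m' + 3" using assms by (metis add.commute le_Suc_ex)
  then have "findiff u m (\<lambda>k. c * (norm k)\<^sup>2) k = findiff u m' (findiff u 3 (\<lambda>k. c * (norm k)\<^sup>2)) k"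
    by (simp only: findiff_add_order)
  also have "\<dots> = findiff u m' (\<lambda>_. 0) k" by (rule findiff_cong) (rule 3)
  also have "\<dots> = 0" using findiff_const[of u _ 0 k] by (cases m') auto
  finally show ?thesis .
qed

lemma square_first_difference:
  fixes y u :: "'a::real_inner"
  assumes "0 \<le> c"
  shows "\<bar>c * (norm (y + u))\<^sup>2 - c * (norm y)\<^sup>2\<bar> \<le> 2 * c * ((norm y + norm u) * norm u)"
proof -
  have "(norm (y + u))\<^sup>2 - (norm y)\<^sup>2 = 2 * (y \<bullet> u) + norm u * norm u"
    by (simp add: power2_norm_eq_inner inner_simps inner_commute flip: power2_eq_square[of "norm u"])
  moreover have "\<bar>2 * (y \<bullet> u) + norm u * norm u\<bar> \<le> 2 * ((norm y + norm u) * norm u)"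
  proof -
    have aux: "\<bar>2 * X + Z\<bar> \<le> 2 * (Y + Z)" if "\<bar>X\<bar> \<le> Y" "0 \<le> Z" for X Y Z :: real
      using that by (auto simp: abs_if split: if_splits)
    show ?thesis unfolding distrib_right by (rule aux[OF Cauchy_Schwarz_ineq2]) simp
  qed
  ultimately have "c * \<bar>(norm (y + u))\<^sup>2 - (norm y)\<^sup>2\<bar> \<le> c * (2 * ((norm y + norm u) * norm u))"
    by (intro mult_left_mono assms) simp
  then show ?thesis using assms by (simp add: abs_mult right_diff_distrib[symmetric])
qed

text \<open>A single factor |u| / |k| shared among M orders. Since the value is at most 1, its M-th
  power is at most its m-th power for every m up to M, so a function that gains once for all these
  orders fits the geometric format of \<open>diff_bound\<close>; M N orders then add up to N
  gains.\<close>

definition gain :: "nat \<Rightarrow> 'a::real_normed_vector \<Rightarrow> 'a \<Rightarrow> real" where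
  "gain M u k = (norm u / norm k) powr (1 / real M)"

lemma gain:
  assumes "0 < M" "norm u \<le> norm k" "0 < norm k"
  shows "0 \<le> gain M u k" "gain M u k \<le> 1" "gain M u k ^ M = norm u / norm k"
proof -
  show "0 \<le> gain M u k" by (simp add: gain_def)
  show "gain M u k \<le> 1" unfolding gain_def using assms by (intro powr_le1) auto
  show "gain M u k ^ M = norm u / norm k" using assms
    by (cases "u = 0") (auto simp: gain_def powr_power)
qed

text \<open>Orders 1 and 2 gain |u| / |k| as a first difference does, which is enough as M >= 2, and
  differences of order 3 or more annihilate a quadratic form. Hence no \<delta> arises.\<close>

lemma diff_bound_quadratic:
  fixes k u :: "'a::real_inner"
  assumes M: "2 \<le> M" and c: "0 \<le> c" and u: "2 * real n * norm u \<le> norm k" "norm u \<le> norm k" and k: "0 < norm k"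
    and A: "2 ^ n * (4 * c) * (norm k)\<^sup>2 \<le> A"
  shows "diff_bound u k n (gain M u k) 0 0 A (\<lambda>k. c * (norm k)\<^sup>2)"
  unfolding diff_bound_def
proof (intro allI impI)
  fix m j assume mj: "m + j \<le> n"
  let ?q = "\<lambda>k. c * (norm k)\<^sup>2"
  have M0: "0 < M" using M by simp
  note g = gain[OF M0 u(2) k]
  have A0: "0 \<le> A" using A c by (meson mult_nonneg_nonneg order_trans zero_le_numeral zero_le_power zero_le_power2)
  have one: "(1::real) \<le> 2 ^ n" by simp
  show "\<bar>findiff u m ?q (k + real j *\<^sub>R u)\<bar> \<le> A * (gain M u k ^ (m - 0) + 0)"
  proof (cases "m = 0")
    case True
    have "(norm (k + real j *\<^sub>R u))\<^sup>2 \<le> (3 / 2 * norm k)\<^sup>2"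
      by (intro power_mono norm_shift_bounds[OF u(1)]) (use mj in auto)
    also have "\<dots> \<le> 4 * (norm k)\<^sup>2" by (simp add: power_mult_distrib power2_eq_square)
    also have "\<dots> \<le> 2 ^ n * (4 * (norm k)\<^sup>2)" using mult_right_mono[OF one, of "4 * (norm k)\<^sup>2"] by simp
    finally have "c * (norm (k + real j *\<^sub>R u))\<^sup>2 \<le> c * (2 ^ n * (4 * (norm k)\<^sup>2))" by (intro mult_left_mono c)
    also have "\<dots> \<le> A" using A by (simp add: mult_ac)
    finally show ?thesis using True c by simp
  next
    case False
    show ?thesis
    proof (cases "m \<ge> 3")
      case True
      then show ?thesis using A0 g by (simp add: findiff_square_zero)
    next
      case m3: False
      have "\<bar>findiff u m ?q (k + real j *\<^sub>R u)\<bar> \<le> 2 ^ n * (2 * (2 * c)) * (norm k * norm u)"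
        by (rule findiff_le_of_first_difference[OF square_first_difference[OF c]]) (use c u False mj in auto)
      also have "\<dots> = (2 ^ n * (4 * c) * (norm k)\<^sup>2) * gain M u k ^ M"
        unfolding g(3) using k by (simp add: power2_eq_square)
      also have "\<dots> \<le> A * gain M u k ^ m"
        by (intro mult_mono A power_decreasing) (use g M m3 A0 in auto)
      finally show ?thesis by simp
    qed
  qed
qed

lemma findiff_inverse_square_le:
  assumes M: "2 \<le> M"
  shows "\<exists>C\<ge>0. \<forall>k u :: 'a::real_inner. 0 < norm k \<longrightarrow> 2 * real (M * N) * norm u \<le> norm k \<longrightarrow> norm u \<le> norm k \<longrightarrow>
    \<bar>findiff u (M * N) (\<lambda>k. 1 / (norm k)\<^sup>2) k\<bar> \<le> C / (norm k)\<^sup>2 * (norm u / norm k) ^ N"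
proof -
  define n where "n = M * N"
  \<comment> \<open>Matched to the lower bound \<alpha> = |k|^2 / 4 at the shifted points: L
    \<alpha> is then exactly the constant 2^n * 4 |k|^2 which \<open>diff_bound_quadratic\<close>
    asks for.\<close>
  define L where "L = (2 ^ n * 16 :: real)"
  define C where "C = (1 + 3 * 2 ^ n * L) ^ n * 4"
  have "\<bar>findiff u n (\<lambda>k. 1 / (norm k)\<^sup>2) k\<bar> \<le> C / (norm k)\<^sup>2 * (norm u / norm k) ^ N"
    if k: "0 < norm k" and u: "2 * real n * norm u \<le> norm k" "norm u \<le> norm k" for k u :: 'a
  proof -
    let ?\<alpha> = "(norm k)\<^sup>2 / 4"
    have M0: "0 < M" using M by simp
    note g = gain[OF M0 u(2) k]
    have "diff_bound u k n (gain M u k) 0 0 (L * ?\<alpha>) (\<lambda>k. 1 * (norm k)\<^sup>2)"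
      by (rule diff_bound_quadratic[OF M _ u k]) (auto simp: L_def)
    then have "diff_bound u k n (gain M u k) 0 0 ((1 + 3 * 2 ^ n * L) ^ n / ?\<alpha>) (\<lambda>k. 1 / (1 * (norm k)\<^sup>2))"
    proof (rule diff_bound_inverse)
      fix j assume j: "j \<le> n"
      have "(norm k / 2)\<^sup>2 \<le> (norm (k + real j *\<^sub>R u))\<^sup>2"
        by (intro power_mono norm_shift_bounds[OF u(1) j]) auto
      then show "?\<alpha> \<le> 1 * (norm (k + real j *\<^sub>R u))\<^sup>2" by (simp add: power_divide)
    qed (use g k in \<open>auto simp: L_def\<close>)
    then have "\<bar>findiff u n (\<lambda>k. 1 / (norm k)\<^sup>2) (k + real 0 *\<^sub>R u)\<bar> \<le> (1 + 3 * 2 ^ n * L) ^ n / ?\<alpha> * (gain M u k ^ (n - 0) + 0)"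
      unfolding diff_bound_def mult_1 by (elim allE[of _ n] allE[of _ 0]) simp
    moreover have "gain M u k ^ n = (norm u / norm k) ^ N" unfolding n_def power_mult g(3) ..
    ultimately show ?thesis by (simp add: C_def)
  qed
  moreover have "C \<ge> 0" by (simp add: C_def L_def)
  ultimately show ?thesis unfolding n_def by blast
qed

section \<open>The difference of the reciprocals of a symbol and of its quadratic part\<close>

definition high_orders :: "nat \<Rightarrow> nat \<Rightarrow> (nat \<times> nat) set" where
  "high_orders M n = {(m, j). M < m \<and> m + j \<le> n}"

lemma finite_high_orders: "finite (high_orders M n)"
  by (rule finite_subset[of _ "{..n} \<times> {..n}"]) (auto simp: high_orders_def)

text \<open>A common pointwise majorant of all differences of order above M that can occur. Divided
  by the size of the function at hand it takes the place of \<delta> in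
  \<open>diff_bound\<close>.\<close>

definition high_sum :: "nat \<Rightarrow> nat \<Rightarrow> 'a::real_vector \<Rightarrow> ('a \<Rightarrow> real) \<Rightarrow> 'a \<Rightarrow> real" where
  "high_sum M n u f k = (\<Sum>(m, j)\<in>high_orders M n. \<bar>findiff u m f (k + real j *\<^sub>R u)\<bar>)"

lemma high_sum_nonneg: "0 \<le> high_sum M n u f k"
  unfolding high_sum_def by (intro sum_nonneg) auto

lemma high_sum_ge: "M < m \<Longrightarrow> m + j \<le> n \<Longrightarrow> \<bar>findiff u m f (k + real j *\<^sub>R u)\<bar> \<le> high_sum M n u f k"
  unfolding high_sum_def
  using member_le_sum[of "(m, j)" "high_orders M n" "\<lambda>(m, j). \<bar>findiff u m f (k + real j *\<^sub>R u)\<bar>"]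
  by (auto simp: finite_high_orders) (auto simp: high_orders_def)

text \<open>With q the quadratic part, 1 / f - 1 / q = - (f - q) (1 / q) (1 / f), and the sizes
  |k|^(2 + s), |k|^(-2), |k|^(-2) multiply to |k|^(s - 2). The remainder f - q may swallow M
  differences without any gain, so M (N + 1) differences are taken for N gains. A high-order
  difference of f meets reciprocals of joint size |k|^(-4).\<close>

lemma reciprocal_difference_bound:
  assumes M: "2 \<le> M" and pos: "0 < B0" "0 < B1" "0 < B2" "0 < c" "0 \<le> s" "0 < R0"
  shows "\<exists>C\<ge>0. \<forall>(k::'a::real_inner) u f \<kappa>. 0 < norm k \<longrightarrow> norm k \<le> R0 \<longrightarrow> 2 * real (M * Suc N) * norm u \<le> norm k \<longrightarrow> norm u \<le> norm k \<longrightarrow>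
    c \<le> \<kappa> \<longrightarrow> \<kappa> \<le> B0 \<longrightarrow>
    (\<forall>y. \<bar>f (y + u) - f y\<bar> \<le> B1 * ((norm y + norm u) * norm u)) \<longrightarrow>
    (\<forall>y. \<bar>f y\<bar> \<le> B1 * (norm y)\<^sup>2) \<longrightarrow>
    (\<forall>j\<le>M * Suc N. c * (norm (k + real j *\<^sub>R u))\<^sup>2 \<le> f (k + real j *\<^sub>R u)) \<longrightarrow>
    (\<forall>y. \<bar>f y - \<kappa> * (norm y)\<^sup>2\<bar> \<le> B2 * norm y powr (2 + s)) \<longrightarrow>
    \<bar>findiff u (M * Suc N) (\<lambda>y. 1 / f y - 1 / (\<kappa> * (norm y)\<^sup>2)) k\<bar>
      \<le> C * (norm k powr (s - 2) * (norm u / norm k) ^ N + high_sum M (M * Suc N) u f k / norm k ^ 4)"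
proof -
  define n where "n = M * Suc N"
  define b where "b = 2 ^ n * (4 * (B0 + B1))"
  \<comment> \<open>Arranged so that A = L \<alpha>, with \<alpha> = c |k|^2 / 4, dominates every
    difference of f as well as their sum H. Then H / A <= 1, as \<open>diff_bound_inverse\<close>
    demands of \<delta>.\<close>
  define L where "L = 4 * (b * (1 + real (card (high_orders M n)))) / c"
  define Q where "Q = (1 + 3 * 2 ^ n * L) ^ n"
  define b2 where "b2 = 2 ^ n * (B2 * 2 powr (2 + s))"
  define C1 where "C1 = 2 ^ n * 2 ^ n * (4 * Q / c)\<^sup>2"
  define C where "C = C1 * (b2 + 4 + b2 * R0 powr s / (L * (c / 4)))"
  have b0: "b > 0" using pos by (simp add: b_def)
  have l0: "L > 0" using pos b0 by (simp add: L_def)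
  have Q0: "Q \<ge> 0" using l0 by (simp add: Q_def)
  have b20: "b2 > 0" using pos by (simp add: b2_def)
  have C10: "C1 \<ge> 0" by (simp add: C1_def)
  have C0: "C \<ge> 0" using C10 b20 l0 pos by (simp add: C_def)
  have main: "\<bar>findiff u n (\<lambda>y. 1 / f y - 1 / (\<kappa> * (norm y)\<^sup>2)) k\<bar>
      \<le> C * (norm k powr (s - 2) * (norm u / norm k) ^ N + high_sum M n u f k / norm k ^ 4)"
    if k: "0 < norm k" "norm k \<le> R0" and u: "2 * real n * norm u \<le> norm k" "norm u \<le> norm k"
      and \<kappa>: "c \<le> \<kappa>" "\<kappa> \<le> B0"
      and f1: "\<And>y. \<bar>f (y + u) - f y\<bar> \<le> B1 * ((norm y + norm u) * norm u)"
      and f2: "\<And>y. \<bar>f y\<bar> \<le> B1 * (norm y)\<^sup>2"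
      and f3: "\<And>j. j \<le> n \<Longrightarrow> c * (norm (k + real j *\<^sub>R u))\<^sup>2 \<le> f (k + real j *\<^sub>R u)"
      and f4: "\<And>y. \<bar>f y - \<kappa> * (norm y)\<^sup>2\<bar> \<le> B2 * norm y powr (2 + s)"
    for k u :: 'a and f \<kappa>
  proof -
    define r where "r = norm k"
    have r: "r > 0" using k by (simp add: r_def)
    define \<eta> where "\<eta> = gain M u k"
    have M0: "0 < M" using M by simp
    note g = gain[OF M0 u(2) k(1), folded \<eta>_def r_def]
    define \<alpha> where "\<alpha> = c / 4 * r\<^sup>2"
    have a0: "\<alpha> > 0" using pos r by (simp add: \<alpha>_def)
    define A where "A = L * \<alpha>"
    have A_eq: "A = b * r\<^sup>2 * (1 + real (card (high_orders M n)))"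
      using pos by (simp add: A_def L_def \<alpha>_def)
    have A0: "A > 0" using l0 a0 by (simp add: A_def)
    have bA: "b * r\<^sup>2 \<le> A" unfolding A_eq using b0 by (simp add: distrib_left)
    define H where "H = high_sum M n u f k"
    have H0: "H \<ge> 0" by (simp add: H_def high_sum_nonneg)
    have fd: "\<bar>findiff u m f (k + real j *\<^sub>R u)\<bar> \<le> b * r\<^sup>2 * \<eta> ^ M" if "1 \<le> m" "m + j \<le> n" for m j
    proof -
      have "\<bar>findiff u m f (k + real j *\<^sub>R u)\<bar> \<le> 2 ^ n * (2 * B1) * (norm k * norm u)"
        by (rule findiff_le_of_first_difference[OF f1]) (use pos u that in auto)
      also have "\<dots> \<le> b * (norm k * norm u)"
        by (intro mult_right_mono) (use pos in \<open>auto simp: b_def\<close>)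
      also have "\<dots> = b * r\<^sup>2 * \<eta> ^ M" unfolding g(3) using r by (simp add: r_def power2_eq_square)
      finally show ?thesis .
    qed
    have HA: "H \<le> A"
    proof -
      have "H \<le> (\<Sum>(m, j)\<in>high_orders M n. b * r\<^sup>2)"
        unfolding H_def high_sum_def
      proof (rule sum_mono, clarify)
        fix m j assume "(m, j) \<in> high_orders M n"
        then have "\<bar>findiff u m f (k + real j *\<^sub>R u)\<bar> \<le> b * r\<^sup>2 * \<eta> ^ M"
          by (intro fd) (auto simp: high_orders_def)
        also have "\<dots> \<le> b * r\<^sup>2 * 1" by (intro mult_left_mono power_le_one) (use g b0 in auto)
        finally show "\<bar>findiff u m f (k + real j *\<^sub>R u)\<bar> \<le> b * r\<^sup>2" by simp
      qed
      also have "\<dots> \<le> A" unfolding A_eq using b0 by (simp add: case_prod_beta algebra_simps)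
      finally show ?thesis .
    qed
    have df: "diff_bound u k n \<eta> (H / A) 0 A f"
      unfolding diff_bound_def
    proof (intro allI impI)
      fix m j assume mj: "m + j \<le> n"
      consider "m = 0" | "1 \<le> m" "m \<le> M" | "M < m" by linarith
      then show "\<bar>findiff u m f (k + real j *\<^sub>R u)\<bar> \<le> A * (\<eta> ^ (m - 0) + H / A)"
      proof cases
        case 1
        have "\<bar>f (k + real j *\<^sub>R u)\<bar> \<le> B1 * (3 / 2 * norm k)\<^sup>2"
          by (rule order_trans[OF f2]) (intro mult_left_mono power_mono norm_shift_bounds[OF u(1)]; use mj pos in auto)
        also have "\<dots> \<le> (4 * B1) * r\<^sup>2" using pos by (simp add: r_def power_mult_distrib power2_eq_square)
        also have "\<dots> \<le> b * r\<^sup>2"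
        proof (rule mult_right_mono)
          have "1 * (4 * B1) \<le> 2 ^ n * (4 * (B0 + B1))" by (intro mult_mono) (use pos in auto)
          then show "4 * B1 \<le> b" by (simp add: b_def)
        qed simp
        also have "\<dots> \<le> A * (1 + H / A)" using bA A0 H0 by (simp add: distrib_left)
        finally show ?thesis using 1 by simp
      next
        case 2
        have "\<bar>findiff u m f (k + real j *\<^sub>R u)\<bar> \<le> b * r\<^sup>2 * \<eta> ^ M" by (rule fd[OF 2(1) mj])
        also have "\<dots> \<le> A * \<eta> ^ m"
          by (intro mult_mono bA power_decreasing) (use 2 g A0 r in auto)
        also have "\<dots> \<le> A * (\<eta> ^ m + H / A)" using A0 H0 by simp
        finally show ?thesis by simp
      next
        case 3
        have "\<bar>findiff u m f (k + real j *\<^sub>R u)\<bar> \<le> H" unfolding H_def by (rule high_sum_ge[OF 3 mj])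
        also have "\<dots> \<le> A * (\<eta> ^ m + H / A)" using A0 g by (simp add: distrib_left)
        finally show ?thesis by simp
      qed
    qed
    let ?q = "\<lambda>y. \<kappa> * (norm y)\<^sup>2"
    have k0: "\<kappa> > 0" using \<kappa> pos by simp
    have dq: "diff_bound u k n \<eta> 0 0 A ?q"
      unfolding \<eta>_def
    proof (rule diff_bound_quadratic[OF M _ u k(1)])
      have "2 ^ n * (4 * \<kappa>) \<le> b" unfolding b_def by (intro mult_left_mono) (use \<kappa> pos in auto)
      then have "2 ^ n * (4 * \<kappa>) * (norm k)\<^sup>2 \<le> b * (norm k)\<^sup>2" by (intro mult_right_mono) auto
      then show "2 ^ n * (4 * \<kappa>) * (norm k)\<^sup>2 \<le> A" using bA by (simp add: r_def)
    qed (use k0 in simp)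
    have al: "\<alpha> \<le> c * (norm (k + real j *\<^sub>R u))\<^sup>2" if j: "j \<le> n" for j
    proof -
      have "(norm k / 2)\<^sup>2 \<le> (norm (k + real j *\<^sub>R u))\<^sup>2"
        by (intro power_mono norm_shift_bounds[OF u(1) j]) auto
      then have "c * (norm k / 2)\<^sup>2 \<le> c * (norm (k + real j *\<^sub>R u))\<^sup>2" using pos by (intro mult_left_mono) auto
      then show ?thesis by (simp add: \<alpha>_def r_def power_divide)
    qed
    have alf: "\<alpha> \<le> f (k + real j *\<^sub>R u)" if "j \<le> n" for j
      using al[OF that] f3[OF that] by linarith
    have alq: "\<alpha> \<le> ?q (k + real j *\<^sub>R u)" if "j \<le> n" for j
      using al[OF that] mult_right_mono[OF \<kappa>(1), of "(norm (k + real j *\<^sub>R u))\<^sup>2"] by simp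
    have H1: "0 \<le> H / A" "H / A \<le> 1" using H0 HA A0 by auto
    have di: "diff_bound u k n \<eta> (H / A) 0 (Q / \<alpha>) (\<lambda>y. 1 / f y)"
      unfolding Q_def
    proof (rule diff_bound_inverse[where L=L and \<alpha>=\<alpha>])
      show "diff_bound u k n \<eta> (H / A) 0 (L * \<alpha>) f" unfolding A_def[symmetric] by (rule df)
    qed (use g H1 a0 l0 alf in auto)
    have dw: "diff_bound u k n \<eta> 0 0 (Q / \<alpha>) (\<lambda>y. 1 / ?q y)"
      unfolding Q_def
    proof (rule diff_bound_inverse[where L=L and \<alpha>=\<alpha>])
      show "diff_bound u k n \<eta> 0 0 (L * \<alpha>) ?q" unfolding A_def[symmetric] by (rule dq)
    qed (use g a0 l0 alq in auto)
    define A2 where "A2 = b2 * r powr (2 + s)"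
    have A20: "A2 > 0" using b20 r by (simp add: A2_def)
    \<comment> \<open>Up to order M only the size |k|^(2 + s) of the Taylor remainder is used, hence
      the offset c = M. Beyond M >= 2 the quadratic part is annihilated, and the difference of f is
      contained in H.\<close>
    have dR: "diff_bound u k n \<eta> (H / A2) M A2 (\<lambda>y. f y - ?q y)"
      unfolding diff_bound_def
    proof (intro allI impI)
      fix m j assume mj: "m + j \<le> n"
      show "\<bar>findiff u m (\<lambda>y. f y - ?q y) (k + real j *\<^sub>R u)\<bar> \<le> A2 * (\<eta> ^ (m - M) + H / A2)"
      proof (cases "m \<le> M")
        case True
        have "norm (findiff u m (\<lambda>y. f y - ?q y) (k + real j *\<^sub>R u)) \<le> 2 ^ m * (B2 * (2 * r) powr (2 + s))"
        proof (rule findiff_norm_le)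
          fix i assume "i \<le> m"
          then have ij: "j + i \<le> n" using mj by simp
          have "norm (k + real (j + i) *\<^sub>R u) \<le> 2 * r"
            using norm_shift_bounds(2)[OF u(1) ij] norm_ge_zero[of k] unfolding r_def by linarith
          then have "norm (k + real j *\<^sub>R u + real i *\<^sub>R u) \<le> 2 * r"
            by (simp add: scaleR_add_left add.assoc)
          then have "B2 * norm (k + real j *\<^sub>R u + real i *\<^sub>R u) powr (2 + s) \<le> B2 * (2 * r) powr (2 + s)"
            using pos by (intro mult_left_mono powr_mono2) auto
          then show "norm (f (k + real j *\<^sub>R u + real i *\<^sub>R u) - ?q (k + real j *\<^sub>R u + real i *\<^sub>R u)) \<le> B2 * (2 * r) powr (2 + s)"
            using f4[of "k + real j *\<^sub>R u + real i *\<^sub>R u"] by simp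
        qed
        also have "\<dots> \<le> 2 ^ n * (B2 * (2 * r) powr (2 + s))"
          using mj pos by (intro mult_right_mono power_increasing) auto
        also have "\<dots> = A2" using r by (simp add: A2_def b2_def powr_mult)
        also have "\<dots> \<le> A2 * (\<eta> ^ (m - M) + H / A2)" using True A20 H0 by (simp add: distrib_left)
        finally show ?thesis by simp
      next
        case False
        then have "findiff u m ?q (k + real j *\<^sub>R u) = 0" using M by (intro findiff_square_zero) simp
        then have "\<bar>findiff u m (\<lambda>y. f y - ?q y) (k + real j *\<^sub>R u)\<bar> = \<bar>findiff u m f (k + real j *\<^sub>R u)\<bar>"
          by (simp add: findiff_diff)
        also have "\<dots> \<le> H" unfolding H_def by (rule high_sum_ge) (use False mj in auto)
        also have "\<dots> \<le> A2 * (\<eta> ^ (m - M) + H / A2)" using A20 g by (simp add: distrib_left)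
        finally show ?thesis .
      qed
    qed
    have W0: "0 \<le> Q / \<alpha>" using Q0 a0 by simp
    have HA20: "0 \<le> H / A2" using H0 A20 by simp
    have p1: "diff_bound u k n \<eta> (2 * (H / A2) + 0) (M + 0) (2 ^ n * A2 * (Q / \<alpha>)) (\<lambda>y. (f y - ?q y) * (1 / ?q y))"
      by (rule diff_bound_mult[OF dR dw]) (use g HA20 W0 A20 Q0 a0 in auto)
    have p2: "diff_bound u k n \<eta> (2 * (2 * (H / A2) + 0) + H / A) (M + 0 + 0) (2 ^ n * (2 ^ n * A2 * (Q / \<alpha>)) * (Q / \<alpha>))
        (\<lambda>y. (f y - ?q y) * (1 / ?q y) * (1 / f y))"
      by (rule diff_bound_mult[OF p1 di]) (use g HA20 W0 A20 H1 Q0 a0 in auto)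
    have "\<bar>findiff u n (\<lambda>y. (f y - ?q y) * (1 / ?q y) * (1 / f y)) (k + real 0 *\<^sub>R u)\<bar>
      \<le> (2 ^ n * (2 ^ n * A2 * (Q / \<alpha>)) * (Q / \<alpha>)) * (\<eta> ^ (n - (M + 0 + 0)) + (2 * (2 * (H / A2) + 0) + H / A))"
      using p2 unfolding diff_bound_def by (elim allE[of _ n] allE[of _ 0]) simp
    moreover have "\<bar>findiff u n (\<lambda>y. 1 / f y - 1 / ?q y) k\<bar> = \<bar>findiff u n (\<lambda>y. (f y - ?q y) * (1 / ?q y) * (1 / f y)) (k + real 0 *\<^sub>R u)\<bar>"
    proof -
      have aux: "1 / a - 1 / b = (- 1) * ((a - b) * (1 / b) * (1 / a))" if "a > 0" "b > 0" for a b :: real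
        using that by (simp add: field_simps)
      have "findiff u n (\<lambda>y. 1 / f y - 1 / ?q y) k = findiff u n (\<lambda>y. (- 1) * ((f y - ?q y) * (1 / ?q y) * (1 / f y))) k"
      proof (rule findiff_cong)
        fix j assume j: "j \<le> n"
        have "f (k + real j *\<^sub>R u) > 0" "?q (k + real j *\<^sub>R u) > 0" using alf[OF j] alq[OF j] a0 by linarith+
        then show "1 / f (k + real j *\<^sub>R u) - 1 / ?q (k + real j *\<^sub>R u) =
          (- 1) * ((f (k + real j *\<^sub>R u) - ?q (k + real j *\<^sub>R u)) * (1 / ?q (k + real j *\<^sub>R u)) * (1 / f (k + real j *\<^sub>R u)))"
          by (rule aux)
      qed
      then show ?thesis unfolding findiff_cmult by simp
    qed
    moreover have "\<eta> ^ (n - (M + 0 + 0)) = (norm u / r) ^ N"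
      unfolding n_def by (simp add: power_mult g(3))
    ultimately have "\<bar>findiff u n (\<lambda>y. 1 / f y - 1 / ?q y) k\<bar>
      \<le> (2 ^ n * (2 ^ n * A2 * (Q / \<alpha>)) * (Q / \<alpha>)) * ((norm u / r) ^ N + 4 * (H / A2) + H / A)"
      by (simp add: add.assoc)
    also have "\<dots> = (2 ^ n * 2 ^ n * (Q / \<alpha>)\<^sup>2) * (A2 * (norm u / r) ^ N + 4 * H + A2 / A * H)"
    proof -
      have "A2 * ((norm u / r) ^ N + 4 * (H / A2) + H / A) = A2 * (norm u / r) ^ N + 4 * H + A2 / A * H"
        using A20 by (simp add: distrib_left)
      from this[symmetric] show ?thesis by (simp only:) (simp only: power2_eq_square mult_ac)
    qed
    also have "2 ^ n * 2 ^ n * (Q / \<alpha>)\<^sup>2 = C1 / r ^ 4"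
    proof -
      have "Q / \<alpha> = (4 * Q / c) / r\<^sup>2" by (simp add: \<alpha>_def)
      moreover have "((4 * Q / c) / r\<^sup>2)\<^sup>2 = (4 * Q / c)\<^sup>2 / r ^ 4"
        unfolding power_divide[of "4 * Q / c"] by (simp flip: power_mult)
      ultimately show ?thesis by (simp add: C1_def)
    qed
    also have "C1 / r ^ 4 * (A2 * (norm u / r) ^ N + 4 * H + A2 / A * H)
      = C1 * (b2 * (r powr (s - 2) * (norm u / r) ^ N) + 4 * (H / r ^ 4) + (b2 / (L * (c / 4))) * r powr s * (H / r ^ 4))"
    proof -
      have "r ^ 4 = r powr 4" "r\<^sup>2 = r powr 2" using r by simp_all
      then have e1: "r powr (2 + s) = r powr (s - 2) * r ^ 4" "r powr (2 + s) = r powr s * r\<^sup>2"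
        by (simp_all only: powr_add[symmetric]) (simp_all add: add.commute)
      have "A2 * (norm u / r) ^ N / r ^ 4 = b2 * (r powr (s - 2) * (norm u / r) ^ N)"
        unfolding A2_def e1(1) using r by simp
      moreover have "A2 / A = (b2 / (L * (c / 4))) * r powr s"
        unfolding A2_def A_def \<alpha>_def e1(2) using r by simp
      moreover have "C1 / r ^ 4 * (A2 * (norm u / r) ^ N + 4 * H + A2 / A * H)
        = C1 * (A2 * (norm u / r) ^ N / r ^ 4 + 4 * (H / r ^ 4) + A2 / A * (H / r ^ 4))"
        by (simp add: distrib_left add_divide_distrib)
      ultimately show ?thesis by (simp only:)
    qed
    also have "\<dots> \<le> C1 * ((b2 + 4 + b2 * R0 powr s / (L * (c / 4))) * (r powr (s - 2) * (norm u / r) ^ N + H / r ^ 4))"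
    proof (intro mult_left_mono C10)
      define X where "X = r powr (s - 2) * (norm u / r) ^ N"
      define Y where "Y = H / r ^ 4"
      define z where "z = b2 / (L * (c / 4))"
      have X0: "X \<ge> 0" using r by (simp add: X_def)
      have Y0: "Y \<ge> 0" using r H0 by (simp add: Y_def)
      have z0: "z \<ge> 0" using b20 l0 pos by (simp add: z_def)
      \<comment> \<open>A2 / A is of order |k|^s, so a high-order difference inside 1 / f costs no
        more than one of the remainder; the bound |k| <= R0 enters here.\<close>
      have "r powr s \<le> R0 powr s" using r k pos by (intro powr_mono2) (auto simp: r_def)
      then have "z * r powr s * Y \<le> z * R0 powr s * Y" by (intro mult_right_mono mult_left_mono z0 Y0)
      moreover have "0 \<le> b2 * Y" "0 \<le> 4 * X" "0 \<le> z * R0 powr s * X" using b20 X0 Y0 z0 by auto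
      ultimately have "b2 * X + 4 * Y + z * r powr s * Y \<le> (b2 + 4 + z * R0 powr s) * (X + Y)"
        by (simp add: algebra_simps)
      then show "b2 * (r powr (s - 2) * (norm u / r) ^ N) + 4 * (H / r ^ 4) + (b2 / (L * (c / 4))) * r powr s * (H / r ^ 4)
        \<le> (b2 + 4 + b2 * R0 powr s / (L * (c / 4))) * (r powr (s - 2) * (norm u / r) ^ N + H / r ^ 4)"
        by (simp add: X_def Y_def z_def mult_ac)
    qed
    also have "\<dots> = C * (r powr (s - 2) * (norm u / r) ^ N + H / r ^ 4)" by (simp add: C_def)
    finally show ?thesis by (simp add: r_def H_def)
  qed
  show ?thesis
    by (rule exI[of _ C], rule conjI[OF C0], intro allI impI, fold n_def, rule main) (auto simp: n_def)
qed

section \<open>Truncated powers of the norm on the torus\<close>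

lemma torus_integral_le_lborel:
  fixes h :: "real^'d::finite \<Rightarrow> real"
  assumes h: "integrable lborel h" and nn: "\<And>k. 0 \<le> h k"
  shows "integrable torus_measure h" and "(\<integral>k. h k \<partial>torus_measure) \<le> (\<integral>k. h k \<partial>lborel)"
proof -
  have i: "integrable lborel (\<lambda>k. indicator torus k *\<^sub>R h k)"
    by (rule integrable_mult_indicator) (use h in auto)
  then show "integrable torus_measure h" by (simp add: integrable_torus_iff set_integrable_def)
  show "(\<integral>k. h k \<partial>torus_measure) \<le> (\<integral>k. h k \<partial>lborel)"
    unfolding integral_torus_eq set_lebesgue_integral_def
    by (rule integral_mono[OF i h]) (use nn in \<open>auto split: split_indicator\<close>)
qed

text \<open>The torus lies in the ball of radius \<pi> d, by comparison with the sum of the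
  coordinates; the extra 1 leaves room for the shifts k + j u, whose displacement will be at most 1
  / 2.\<close>

definition torus_radius :: "'d::finite itself \<Rightarrow> real" where
  "torus_radius _ = pi * real CARD('d) + 1"

lemma torus_radius_ge_1: "1 \<le> torus_radius TYPE('d::finite)"
  by (simp add: torus_radius_def)

lemma norm_le_torus_radius:
  assumes "k \<in> torus" shows "norm (k :: real^'d::finite) \<le> torus_radius TYPE('d) - 1"
proof -
  have "norm k \<le> (\<Sum>i\<in>UNIV. \<bar>k $ i\<bar>)" by (rule norm_le_l1_cart)
  also have "\<dots> \<le> (\<Sum>i\<in>(UNIV::'d set). pi)"
    by (intro sum_mono) (use assms in \<open>auto simp: torus_def abs_le_iff less_imp_le minus_le_iff\<close>)
  finally show ?thesis by (simp add: torus_radius_def mult.commute)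
qed

text \<open>Cut off on a ball rather than on the torus, so that the function is integrable over the
  whole space and all its translates share one bound on their torus integrals.\<close>

definition radial :: "real \<Rightarrow> real^'d::finite \<Rightarrow> real" where
  "radial \<gamma> y = indicator (cball 0 (torus_radius TYPE('d))) y * norm y powr - \<gamma>"

lemma radial_nonneg: "0 \<le> radial \<gamma> y"
  by (simp add: radial_def)

lemma integrable_radial:
  assumes "0 \<le> \<gamma>" "\<gamma> < real CARD('d)"
  shows "integrable lborel (radial \<gamma> :: real^'d::finite \<Rightarrow> real)"
  using set_integrable_norm_powr_cball[where 'a="real^'d", of \<gamma> "torus_radius TYPE('d)"] assms
    torus_radius_ge_1[where 'd='d]
  by (simp add: set_integrable_def radial_def[abs_def])

lemma radial_translate_torus:
  fixes u :: "real^'d::finite"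
  assumes "0 \<le> \<gamma>" "\<gamma> < real CARD('d)"
  shows "integrable torus_measure (\<lambda>k. radial \<gamma> (k + u))"
    and "(\<integral>k. radial \<gamma> (k + u) \<partial>torus_measure) \<le> (\<integral>k. radial \<gamma> (k :: real^'d) \<partial>lborel)"
proof -
  have i: "integrable lborel (\<lambda>k. radial \<gamma> (k + u))"
    by (subst integrable_lborel_translate_iff) (rule integrable_radial[OF assms])
  show "integrable torus_measure (\<lambda>k. radial \<gamma> (k + u))"
    by (rule torus_integral_le_lborel(1)[OF i radial_nonneg])
  show "(\<integral>k. radial \<gamma> (k + u) \<partial>torus_measure) \<le> (\<integral>k. radial \<gamma> (k :: real^'d) \<partial>lborel)"
    using torus_integral_le_lborel(2)[OF i radial_nonneg] integral_lborel_translate[of "radial \<gamma>" u] by simp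
qed

section \<open>The reciprocal of the symbol\<close>

context lattice_kernel
begin

lemma symbol_0: "symbol F 0 = 0"
  using infsum_F by (simp add: symbol_def)

lemma abs_symbol_le: "\<bar>symbol F y\<bar> \<le> moment_bound 2 * (norm y)\<^sup>2"
  using symbol_diff_le[of 0 y] by (simp add: symbol_0 power2_eq_square)

text \<open>Shifted points k + j u may leave the torus, where alone the lower bound is assumed.
  Reducing a coordinate between \<pi> and 3 \<pi> / 2 modulo 2 \<pi> leaves at least \<pi> / 2 in
  absolute value, hence at least a third of it; squaring gives the 9.\<close>

lemma symbol_lower_wide:
  assumes y: "\<And>i. \<bar>y $ i\<bar> \<le> 3 / 2 * pi"
  shows "K2 / 9 * (norm y)\<^sup>2 \<le> symbol F y"
proof -
  have ex: "\<exists>m::int. m \<in> {-1, 0, 1} \<and> - pi < y $ i + 2 * pi * real_of_int m \<and> y $ i + 2 * pi * real_of_int m \<le> pi" for i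
    by (rule ex1_implies_ex, rule torus_residue_ex1) (use y[of i] pi_gt_zero in linarith)+
  then obtain m where m: "\<And>i. m i \<in> {-1, 0, 1::int}" "\<And>i. - pi < y $ i + 2 * pi * real_of_int (m i)"
    "\<And>i. y $ i + 2 * pi * real_of_int (m i) \<le> pi" by metis
  define z where "z = y + (2 * pi) *\<^sub>R rvec (vec_lambda m)"
  have zi: "z $ i = y $ i + 2 * pi * real_of_int (m i)" for i by (simp add: z_def)
  have "z \<in> torus" using m(2,3) by (simp add: torus_def zi)
  then have "K2 * (norm z)\<^sup>2 \<le> symbol F z" by (rule symbol_lower)
  also have "symbol F z = symbol F y" using periodic_symbol by (simp add: periodic_def z_def)
  finally have 1: "K2 * (norm z)\<^sup>2 \<le> symbol F y" .
  have "\<bar>y $ i\<bar> \<le> 3 * \<bar>z $ i\<bar>" for i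
    using m(1)[of i] y[of i] pi_gt_zero unfolding zi by (auto simp: abs_if split: if_splits)
  then have "\<bar>y $ i\<bar>\<^sup>2 \<le> (3 * \<bar>z $ i\<bar>)\<^sup>2" for i by (intro power_mono) auto
  then have c: "y $ i * y $ i \<le> 9 * (z $ i * z $ i)" for i by (simp add: power_mult_distrib power2_eq_square)
  have "(norm y)\<^sup>2 \<le> 9 * (norm z)\<^sup>2"
    unfolding power2_norm_eq_inner inner_vec_def sum_distrib_left by (intro sum_mono) (use c in simp)
  then have "K2 * (norm y)\<^sup>2 \<le> K2 * (9 * (norm z)\<^sup>2)" using K2 by (intro mult_left_mono) auto
  then show ?thesis using 1 by simp
qed

lemma symbol_inverse_le:
  assumes "k \<in> torus" shows "\<bar>1 / symbol F k\<bar> \<le> 1 / K2 * radial 2 k"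
proof (cases "k = 0")
  case True
  then show ?thesis by (simp add: symbol_0 radial_def)
next
  case False
  have "0 < K2 * (norm k)\<^sup>2" using False K2 by simp
  moreover have "K2 * (norm k)\<^sup>2 \<le> symbol F k" by (rule symbol_lower[OF assms])
  ultimately have "\<bar>1 / symbol F k\<bar> \<le> 1 / (K2 * (norm k)\<^sup>2)" by (simp add: frac_le)
  also have "\<dots> = 1 / K2 * radial 2 k"
    using False norm_le_torus_radius[OF assms] by (simp add: radial_def powr_minus divide_inverse)
  finally show ?thesis .
qed

lemma symbol_measurable [measurable]: "symbol F \<in> borel_measurable borel"
  by (intro borel_measurable_continuous_onI continuous_symbol)

lemma inverse_symbol_integrable:
  assumes d: "CARD('d) \<ge> 3"
  shows "integrable torus_measure (\<lambda>k. complex_of_real (1 / symbol F k))"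
    and "(\<integral>k. \<bar>1 / symbol F k\<bar> \<partial>torus_measure) \<le> 1 / K2 * (\<integral>k. radial 2 (k :: real^'d) \<partial>lborel)"
proof -
  have r: "integrable torus_measure (radial 2 :: real^'d \<Rightarrow> real)"
    "(\<integral>k. radial 2 (k :: real^'d) \<partial>torus_measure) \<le> (\<integral>k. radial 2 (k :: real^'d) \<partial>lborel)"
    using radial_translate_torus[of 2 "0 :: real^'d"] d by simp_all
  have AE: "AE k in torus_measure. norm (1 / symbol F k) \<le> norm (1 / K2 * radial 2 k)"
  proof (rule AE_I2)
    fix k :: "real^'d" assume "k \<in> space torus_measure"
    then have "\<bar>1 / symbol F k\<bar> \<le> 1 / K2 * radial 2 k" by (intro symbol_inverse_le) simp
    then show "norm (1 / symbol F k) \<le> norm (1 / K2 * radial 2 k)" by (smt (verit) real_norm_def)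
  qed
  have i: "integrable torus_measure (\<lambda>k. 1 / symbol F k)"
    by (rule Bochner_Integration.integrable_bound[OF _ _ AE]) (use r in \<open>simp, measurable\<close>)
  then show "integrable torus_measure (\<lambda>k. complex_of_real (1 / symbol F k))" by (rule integrable_of_real)
  have "(\<integral>k. \<bar>1 / symbol F k\<bar> \<partial>torus_measure) \<le> (\<integral>k. 1 / K2 * radial 2 (k :: real^'d) \<partial>torus_measure)"
    by (rule integral_mono[OF integrable_abs[OF i]]) (use r symbol_inverse_le in auto)
  also have "\<dots> = 1 / K2 * (\<integral>k. radial 2 (k :: real^'d) \<partial>torus_measure)" by simp
  also have "\<dots> \<le> 1 / K2 * (\<integral>k. radial 2 (k :: real^'d) \<partial>lborel)"
    by (intro mult_left_mono r) (use K2 in simp)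
  finally show "(\<integral>k. \<bar>1 / symbol F k\<bar> \<partial>torus_measure) \<le> 1 / K2 * (\<integral>k. radial 2 (k :: real^'d) \<partial>lborel)" .
qed

end

text \<open>Where |k| >= 2 n |u| the pointwise bound applies: its regular part trades (|u| / |k|)^d
  for (|u| / |k|)^p with p = d - 2 + s, and its high-order part is integrated by a weighted
  Cauchy-Schwarz inequality. For smaller |k| the size |k|^(s1 - 2) of the undifferenced error is
  enough.\<close>

lemma torus_difference_bound:
  fixes K1 K2 \<rho> s :: real
  assumes d: "CARD('d::finite) \<ge> 3" and K: "K1 > 0" "K2 > 0" and \<rho>: "\<rho> > 0"
    and s: "0 < s" "s < \<rho>" "s < 2" and s8: "CARD('d) > 8 \<Longrightarrow> s < \<rho> - (real CARD('d) - 8) / 2"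
    and M: "CARD('d) + 10 \<le> M"
  defines "n \<equiv> M * Suc CARD('d)"
  shows "\<exists>C\<ge>0. \<forall>(F :: int^'d \<Rightarrow> real) u. lattice_kernel F K1 K2 \<rho> \<longrightarrow> u \<noteq> 0 \<longrightarrow> 2 * real n * norm u \<le> 1 \<longrightarrow>
    integrable torus_measure (findiff u n (\<lambda>y. 1 / symbol F y - 1 / lattice_kernel.quad F y)) \<longrightarrow>
    (\<integral>k. \<bar>findiff u n (\<lambda>y. 1 / symbol F y - 1 / lattice_kernel.quad F y) k\<bar> \<partial>torus_measure)
      \<le> C * norm u powr (real CARD('d) - 2 + s)"
proof -
  define dd where "dd = real CARD('d)"
  have dd3: "dd \<ge> 3" using d by (simp add: dd_def)
  \<comment> \<open>Spending the Taylor bound at s itself would leave the critical power |k|^(- d);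
    an exponent s1 slightly above s leaves |k|^(- (d - e)), which is integrable.\<close>
  define s1 where "s1 = (s + min \<rho> 2) / 2"
  define e where "e = s1 - s"
  have s1: "s < s1" "s1 < \<rho>" "s1 < 2" using s by (auto simp: s1_def)
  have e0: "e > 0" "e < 1" using s1 s by (auto simp: e_def s1_def)
  \<comment> \<open>\<open>|k|\<close> to the power \<open>- (8 - \<beta>)\<close> has to be integrable near the origin\<close>
  define \<beta> where "\<beta> = (if CARD('d) > 8 then 0 else 8 - dd + 2 * e)"
  define p where "p = dd - 2 + s"
  define a where "a = p + \<beta> / 2"
  have b0: "\<beta> \<ge> 0" "\<beta> > 8 - dd" using e0 by (auto simp: \<beta>_def dd_def)
  have b8: "0 \<le> 8 - \<beta>" "8 - \<beta> < dd" using b0 dd3 e0 by (auto simp: \<beta>_def)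
  have p0: "p > 0" "p \<le> dd" using dd3 s by (auto simp: p_def)
  \<comment> \<open>The square-summability condition of \<open>findiff_symbol_L2\<close>. For d > 8
    it reads s < \<rho> - (d - 8) / 2. For d <= 8 the choice of \<beta> makes 2 a equal to d + 4 + 2
    s1, and s1 < \<rho> suffices.\<close>
  have a2: "2 * a < dd + 4 + 2 * \<rho>"
  proof (cases "CARD('d) > 8")
    case True then show ?thesis using s8[OF True] by (simp add: a_def p_def \<beta>_def dd_def field_simps)
  next
    case False then show ?thesis using s1 by (simp add: a_def p_def \<beta>_def e_def field_simps)
  qed
  have a0: "0 \<le> a" using p0 b0 by (simp add: a_def)
  have aM: "a \<le> real M"
  proof -
    have "real CARD('d) + 10 \<le> real M" using M by linarith
    moreover have "a \<le> dd + 10"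
    proof -
      have "\<beta> \<le> 12" using dd3 e0 by (simp add: \<beta>_def)
      then show ?thesis using s by (simp add: a_def p_def)
    qed
    ultimately show ?thesis by (simp add: dd_def)
  qed
  define mb where "mb q = K1 * lattice_zeta TYPE('d) (dd + 2 + \<rho> - q)" for q
  have mb0: "mb q \<ge> 0" for q unfolding mb_def using K by (intro mult_nonneg_nonneg lattice_zeta_nonneg) auto
  define B1 where "B1 = mb 2 + 1"
  define B2 where "B2 = 3 * mb (2 + s1) + 1"
  define c where "c = K2 / 9"
  define R where "R = torus_radius TYPE('d)"
  have R1: "R \<ge> 1" unfolding R_def by (rule torus_radius_ge_1)
  have pos: "0 < B1" "0 < B2" "0 < c" "0 < R" using mb0[of 2] mb0[of "2 + s1"] K R1 by (auto simp: B1_def B2_def c_def)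
  have M2: "2 \<le> M" using M by simp
  obtain C where C0: "C \<ge> 0" and C: "\<And>(k::real^'d) u f \<kappa>. \<lbrakk>0 < norm k; norm k \<le> R; 2 * real n * norm u \<le> norm k; norm u \<le> norm k;
    c \<le> \<kappa>; \<kappa> \<le> B1; \<forall>y. \<bar>f (y + u) - f y\<bar> \<le> B1 * ((norm y + norm u) * norm u);
    \<forall>y. \<bar>f y\<bar> \<le> B1 * (norm y)\<^sup>2;
    \<forall>j\<le>n. c * (norm (k + real j *\<^sub>R u))\<^sup>2 \<le> f (k + real j *\<^sub>R u);
    \<forall>y. \<bar>f y - \<kappa> * (norm y)\<^sup>2\<bar> \<le> B2 * norm y powr (2 + s1)\<rbrakk> \<Longrightarrow>
    \<bar>findiff u n (\<lambda>y. 1 / f y - 1 / (\<kappa> * (norm y)\<^sup>2)) k\<bar>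
      \<le> C * (norm k powr (s1 - 2) * (norm u / norm k) ^ CARD('d) + high_sum M n u f k / norm k ^ 4)"
    using reciprocal_difference_bound[where 'a="real^'d", OF M2 pos(1) pos(1) pos(2) pos(3), of s1 R "CARD('d)"] s s1 pos(4)
    unfolding n_def by auto
  define C3 where "C3 = C + 2 ^ n * (B2 / (c * c)) * (3 * real n) powr p"
  have C30: "C3 \<ge> 0" using C0 pos by (simp add: C3_def)
  define V0 where "V0 = (\<integral>k. radial (dd - e) (k :: real^'d) \<partial>lborel)"
  define V1 where "V1 = (\<integral>k. radial (8 - \<beta>) (k :: real^'d) \<partial>lborel)"
  let ?I = "high_orders M n"
  define L2 where "L2 = (2 * pi) ^ CARD('d) * 4 ^ n * (K1\<^sup>2 * lattice_zeta TYPE('d) (2 * (dd + 2 + \<rho>) - 2 * a))"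
  have L20: "L2 \<ge> 0" unfolding L2_def by (intro mult_nonneg_nonneg lattice_zeta_nonneg) auto
  define CC where "CC = C3 * (real (Suc n) * V0) + C * (1 / 2 * (real (card ?I) * (real (card ?I) * L2)) + 1 / 2 * V1)"
  have V00: "V0 \<ge> 0" "V1 \<ge> 0" unfolding V0_def V1_def by (rule Bochner_Integration.integral_nonneg, rule radial_nonneg)+
  have CC0: "CC \<ge> 0" unfolding CC_def using C30 C0 V00 L20 by (intro add_nonneg_nonneg mult_nonneg_nonneg) auto
  have main: "(\<integral>k. \<bar>findiff u n (\<lambda>y. 1 / symbol F y - 1 / lattice_kernel.quad F y) k\<bar> \<partial>torus_measure) \<le> CC * norm u powr p"
    if kern: "lattice_kernel F K1 K2 \<rho>" and u0: "u \<noteq> 0" and un: "2 * real n * norm u \<le> 1"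
      and int: "integrable torus_measure (findiff u n (\<lambda>y. 1 / symbol F y - 1 / lattice_kernel.quad F y))"
    for F :: "int^'d \<Rightarrow> real" and u
  proof -
    interpret lattice_kernel F K1 K2 \<rho> by (rule kern)
    have mbe: "moment_bound q = mb q" for q by (simp add: moment_bound_def mb_def dd_def)
    define f where "f = symbol F"
    define \<kappa> where "\<kappa> = kappa0 F / (2 * real CARD('d))"
    have quad: "quad y = \<kappa> * (norm y)\<^sup>2" for y by (simp add: quad_def \<kappa>_def)
    define E where "E y = 1 / f y - 1 / (\<kappa> * (norm y)\<^sup>2)" for y :: "real^'d"
    have Eeq: "(\<lambda>y. 1 / symbol F y - 1 / lattice_kernel.quad F y) = E"
      by (simp add: E_def f_def quad fun_eq_iff)
    have int': "integrable torus_measure (findiff u n E)"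
      by (rule back_subst[of "\<lambda>h. integrable torus_measure (findiff u n h)", OF int Eeq])
    have up: "norm u > 0" using u0 by simp
    have n1: "1 \<le> n" using M2 by (simp add: n_def)
    have kge: "\<kappa> \<ge> K2" using kappa0_ge by (simp add: \<kappa>_def field_simps)
    have kc: "c \<le> \<kappa>" using kge K by (simp add: c_def)
    have kB: "\<kappa> \<le> B1"
    proof -
      have "0 \<le> 2 * real CARD('d) * K2" using K by simp
      then have "0 \<le> kappa0 F" using kappa0_ge by linarith
      then have "\<kappa> \<le> kappa0 F" unfolding \<kappa>_def using d by (simp add: divide_le_eq mult_le_cancel_left1)
      then show ?thesis using kappa0_le by (simp add: B1_def mbe)
    qed
    have f1: "\<bar>f (y + u) - f y\<bar> \<le> B1 * ((norm y + norm u) * norm u)" for y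
      using symbol_diff_le[of y u] mult_right_mono[of "mb 2" B1 "(norm y + norm u) * norm u"]
      by (simp add: f_def mbe B1_def)
    have f2: "\<bar>f y\<bar> \<le> B1 * (norm y)\<^sup>2" for y
      using abs_symbol_le[of y] mult_right_mono[of "mb 2" B1 "(norm y)\<^sup>2"] by (simp add: f_def mbe B1_def)
    have f4: "\<bar>f y - \<kappa> * (norm y)\<^sup>2\<bar> \<le> B2 * norm y powr (2 + s1)" for y
      using symbol_taylor[of s1 y] s s1 mult_right_mono[of "3 * mb (2 + s1)" B2 "norm y powr (2 + s1)"]
      by (simp add: f_def quad mbe B2_def)
    have ju: "norm (real j *\<^sub>R u) \<le> real n * norm u" if "j \<le> n" for j
      using that by (simp add: mult_right_mono)
    have f3: "c * (norm (k + real j *\<^sub>R u))\<^sup>2 \<le> f (k + real j *\<^sub>R u)" if k: "k \<in> torus" and j: "j \<le> n" for k j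
      unfolding c_def f_def
    proof (rule symbol_lower_wide)
      fix i
      have "\<bar>k $ i\<bar> \<le> pi" using k by (auto simp: torus_def abs_le_iff less_imp_le minus_le_iff)
      moreover have "\<bar>(real j *\<^sub>R u) $ i\<bar> \<le> 1 / 2"
        using component_le_norm_cart[of "real j *\<^sub>R u" i] ju[OF j] un by linarith
      ultimately show "\<bar>(k + real j *\<^sub>R u) $ i\<bar> \<le> 3 / 2 * pi"
        unfolding vector_add_component using abs_triangle_ineq[of "k $ i" "(real j *\<^sub>R u) $ i"] pi_ge_two by linarith
    qed
    have ball: "norm (k + real j *\<^sub>R u) \<le> R" if "k \<in> torus" "j \<le> n" for k j
    proof -
      have "norm (k + real j *\<^sub>R u) \<le> norm k + norm (real j *\<^sub>R u)" by (rule norm_triangle_ineq)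
      then show ?thesis using norm_le_torus_radius[OF that(1)] ju[OF that(2)] un unfolding R_def by linarith
    qed
    \<comment> \<open>The weight that balances H z <= lam H^2 / 2 + z^2 / (2 lam): the integrals of
      H^2 and z^2 are of order |u|^(2 a) and |u|^(- \<beta>), and this choice makes both terms
      |u|^(a - \<beta> / 2) = |u|^p.\<close>
    define lam where "lam = norm u powr - (a + \<beta> / 2)"
    have lam: "lam > 0" using up by (simp add: lam_def)
    define H where "H k = high_sum M n u f k" for k
    define S2 where "S2 k = (\<Sum>(m, j)\<in>?I. (findiff u m f (k + real j *\<^sub>R u))\<^sup>2)" for k
    have S20: "S2 k \<ge> 0" for k unfolding S2_def by (intro sum_nonneg) auto
    have HS: "(H k)\<^sup>2 \<le> real (card ?I) * S2 k" for k
    proof -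
      have "(H k)\<^sup>2 \<le> (\<Sum>x\<in>?I. (case x of (m, j) \<Rightarrow> \<bar>findiff u m f (k + real j *\<^sub>R u)\<bar>)\<^sup>2) * real (card ?I)"
        unfolding H_def high_sum_def by (rule sum_squared_le_sum_of_squares)
      also have "(\<Sum>x\<in>?I. (case x of (m, j) \<Rightarrow> \<bar>findiff u m f (k + real j *\<^sub>R u)\<bar>)\<^sup>2) = S2 k"
        unfolding S2_def by (intro sum.cong) auto
      finally show ?thesis by (simp add: mult.commute)
    qed
    define T0 where "T0 k = (\<Sum>j\<le>n. radial (dd - e) (k + real j *\<^sub>R u))" for k
    have T00: "T0 k \<ge> 0" for k unfolding T0_def by (intro sum_nonneg radial_nonneg)
    \<comment> \<open>One integrable majorant for both regions: its first term covers the
      neighbourhood of the origin and the regular part away from it, the second the high-order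
      differences.\<close>
    define Mj where "Mj k = C3 * norm u powr p * T0 k
        + C * (lam / 2 * (real (card ?I) * S2 k) + 1 / (2 * lam) * norm u powr - \<beta> * radial (8 - \<beta>) k)" for k
    have far: "\<bar>findiff u n E k\<bar> \<le> Mj k" if k: "k \<in> torus" and far: "2 * real n * norm u \<le> norm k" for k
    proof -
      have "1 * norm u \<le> 2 * real n * norm u" using n1 by (intro mult_right_mono) auto
      then have uk: "norm u \<le> norm k" using far by simp
      have k0: "norm k > 0" using uk up by linarith
      have kR: "norm k \<le> R" using ball[OF k, of 0] by simp
      have rad: "radial \<gamma> k = norm k powr - \<gamma>" for \<gamma> using kR by (simp add: radial_def R_def)
      have "\<bar>findiff u n E k\<bar> \<le> C * (norm k powr (s1 - 2) * (norm u / norm k) ^ CARD('d) + H k / norm k ^ 4)"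
        unfolding E_def H_def
        by (rule C[OF k0 kR far uk kc kB]) (use f1 f2 f3[OF k] f4 in auto)
      also have "\<dots> \<le> C * (norm u powr p * T0 k + (lam / 2 * (real (card ?I) * S2 k) + 1 / (2 * lam) * norm u powr - \<beta> * radial (8 - \<beta>) k))"
      proof (intro mult_left_mono add_mono C0)
        have "(norm u / norm k) ^ CARD('d) = (norm u / norm k) powr dd"
          using up k0 by (simp add: powr_realpow dd_def)
        also have "\<dots> \<le> (norm u / norm k) powr p" by (rule powr_mono') (use p0 uk up k0 in auto)
        also have "\<dots> = norm u powr p * norm k powr - p" using up k0 by (simp add: powr_divide powr_minus_divide)
        finally have "norm k powr (s1 - 2) * (norm u / norm k) ^ CARD('d) \<le> norm k powr (s1 - 2) * (norm u powr p * norm k powr - p)"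
          by (intro mult_left_mono) auto
        also have "\<dots> = norm u powr p * norm k powr (s1 - 2 - p)"
          by (simp add: powr_diff powr_minus divide_inverse)
        also have "s1 - 2 - p = - (dd - e)" by (simp add: p_def e_def)
        also have "norm k powr - (dd - e) = radial (dd - e) (k + real 0 *\<^sub>R u)" by (simp add: rad)
        also have "\<dots> \<le> T0 k" unfolding T0_def
          by (rule member_le_sum[where f="\<lambda>j. radial (dd - e) (k + real j *\<^sub>R u)"]) (auto intro: radial_nonneg)
        finally show "norm k powr (s1 - 2) * (norm u / norm k) ^ CARD('d) \<le> norm u powr p * T0 k"
          by (simp add: mult_left_mono)
        define z where "z = 1 / norm k ^ 4"
        \<comment> \<open>Of the eight powers of 1 / |k|, \<beta> are paid with |k| >= |u|, and the
          remaining 8 - \<beta> < d are integrable.\<close>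
        have zz: "z\<^sup>2 \<le> norm u powr - \<beta> * radial (8 - \<beta>) k"
        proof -
          have "z\<^sup>2 = 1 / norm k ^ 8" unfolding z_def power_divide by (simp flip: power_mult)
          also have "\<dots> = norm k powr - 8" using powr_realpow[OF k0, of 8] by (simp add: powr_minus_divide)
          also have "\<dots> = norm k powr - \<beta> * norm k powr - (8 - \<beta>)" by (simp add: powr_add[symmetric])
          also have "\<dots> \<le> norm u powr - \<beta> * norm k powr - (8 - \<beta>)"
            using up uk b0 by (intro mult_right_mono powr_mono2') auto
          finally show ?thesis by (simp add: rad)
        qed
        have "0 \<le> (lam * H k - z)\<^sup>2 / (2 * lam)" using lam by simp
        also have "(lam * H k - z)\<^sup>2 / (2 * lam) = lam / 2 * (H k)\<^sup>2 + 1 / (2 * lam) * z\<^sup>2 - H k * z"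
          using lam by (simp add: power2_eq_square field_simps)
        finally have "H k * z \<le> lam / 2 * (H k)\<^sup>2 + 1 / (2 * lam) * z\<^sup>2" by simp
        also have "\<dots> \<le> lam / 2 * (real (card ?I) * S2 k) + 1 / (2 * lam) * (norm u powr - \<beta> * radial (8 - \<beta>) k)"
          by (intro add_mono mult_left_mono HS zz) (use lam in auto)
        finally show "H k / norm k ^ 4 \<le> lam / 2 * (real (card ?I) * S2 k) + 1 / (2 * lam) * norm u powr - \<beta> * radial (8 - \<beta>) k"
          by (simp add: z_def)
      qed
      also have "\<dots> = C * norm u powr p * T0 k
        + C * (lam / 2 * (real (card ?I) * S2 k) + 1 / (2 * lam) * norm u powr - \<beta> * radial (8 - \<beta>) k)"
        by (simp only: distrib_left mult.assoc)
      also have "\<dots> \<le> Mj k" unfolding Mj_def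
        by (intro add_right_mono mult_right_mono T00) (use pos in \<open>auto simp: C3_def\<close>)
      finally show ?thesis .
    qed
    \<comment> \<open>Close to the origin differencing gains nothing, so the sampled values of the
      error are bounded one by one. All points satisfy |y| <= 3 n |u|, which turns |y|^(s1 - 2) =
      |y|^p |y|^(- (d - e)) into a multiple of |u|^p times an integrable power.\<close>
    have near: "\<bar>findiff u n E k\<bar> \<le> Mj k" if k: "k \<in> torus" and near: "norm k < 2 * real n * norm u" for k
    proof -
      have Ey: "\<bar>E (k + real j *\<^sub>R u)\<bar> \<le> B2 / (c * c) * ((3 * real n) powr p * norm u powr p) * radial (dd - e) (k + real j *\<^sub>R u)"
        if j: "j \<le> n" for j
      proof (cases "k + real j *\<^sub>R u = 0")
        case True
        then show ?thesis using pos by (simp add: E_def f_def symbol_0 radial_def)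
      next
        case False
        define y where "y = k + real j *\<^sub>R u"
        have y0: "norm y > 0" using False by (simp add: y_def)
        have fy: "c * (norm y)\<^sup>2 \<le> f y" unfolding y_def by (rule f3[OF k j])
        have qy: "c * (norm y)\<^sup>2 \<le> \<kappa> * (norm y)\<^sup>2" by (intro mult_right_mono kc) simp
        have cy: "0 < c * (norm y)\<^sup>2" using pos y0 by simp
        have yn: "norm y \<le> 3 * real n * norm u"
          using norm_triangle_ineq[of k "real j *\<^sub>R u"] ju[OF j] near unfolding y_def by linarith
        have "E y = (\<kappa> * (norm y)\<^sup>2 - f y) / (f y * (\<kappa> * (norm y)\<^sup>2))"
          unfolding E_def using fy qy cy by (subst diff_frac_eq) auto
        then have "\<bar>E y\<bar> = \<bar>f y - \<kappa> * (norm y)\<^sup>2\<bar> / (f y * (\<kappa> * (norm y)\<^sup>2))"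
          using fy qy cy by (simp add: abs_minus_commute)
        also have "\<dots> \<le> B2 * norm y powr (2 + s1) / ((c * (norm y)\<^sup>2) * (c * (norm y)\<^sup>2))"
          by (intro frac_le f4 mult_mono fy qy) (use cy pos fy in \<open>auto intro: mult_pos_pos\<close>)
        also have "\<dots> = B2 / (c * c) * norm y powr (s1 - 2)"
        proof -
          define Y where "Y = (norm y)\<^sup>2"
          have Y: "Y > 0" using y0 by (simp add: Y_def)
          have "norm y powr (2 + s1) = norm y powr (s1 - 2) * (Y * Y)"
          proof -
            have "Y * Y = norm y powr 4" using y0 by (simp add: Y_def flip: power_add)
            then show ?thesis by (simp only: powr_add[symmetric]) (simp add: add.commute)
          qed
          then show ?thesis using Y pos unfolding Y_def[symmetric] by simp
        qed
        finally have E1: "\<bar>E y\<bar> \<le> B2 / (c * c) * norm y powr (s1 - 2)" .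
        have "norm y powr (s1 - 2) = norm y powr p * norm y powr - (dd - e)"
          unfolding powr_add[symmetric] by (simp add: p_def e_def)
        also have "\<dots> \<le> (3 * real n * norm u) powr p * norm y powr - (dd - e)"
          by (intro mult_right_mono powr_mono2) (use yn p0 in auto)
        also have "(3 * real n * norm u) powr p = (3 * real n) powr p * norm u powr p" by (simp add: powr_mult)
        also have "norm y powr - (dd - e) = radial (dd - e) y" using ball[OF k j] by (simp add: radial_def y_def R_def)
        finally have "B2 / (c * c) * norm y powr (s1 - 2) \<le> B2 / (c * c) * ((3 * real n) powr p * norm u powr p * radial (dd - e) y)"
          using pos by (intro mult_left_mono) auto
        with E1 show ?thesis unfolding y_def by (simp only: mult.assoc)
      qed
      have "\<bar>findiff u n E k\<bar> \<le> 2 ^ n * (\<Sum>j\<le>n. \<bar>E (k + real j *\<^sub>R u)\<bar>)"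
        using findiff_norm_le_sum[of u n E k] by simp
      also have "\<dots> \<le> 2 ^ n * (\<Sum>j\<le>n. B2 / (c * c) * ((3 * real n) powr p * norm u powr p) * radial (dd - e) (k + real j *\<^sub>R u))"
        by (intro mult_left_mono sum_mono Ey) auto
      also have "\<dots> = (2 ^ n * (B2 / (c * c)) * (3 * real n) powr p) * norm u powr p * T0 k"
        unfolding T0_def sum_distrib_left[symmetric] by (simp only: mult_ac)
      also have "\<dots> \<le> C3 * norm u powr p * T0 k"
        by (intro mult_right_mono T00) (use C0 in \<open>auto simp: C3_def\<close>)
      also have "\<dots> \<le> Mj k" unfolding Mj_def
        using C0 lam S20[of k] radial_nonneg[of "8 - \<beta>" k] by simp
      finally show ?thesis .
    qed
    have Mj: "\<bar>findiff u n E k\<bar> \<le> Mj k" if "k \<in> torus" for k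
      using far[OF that] near[OF that] by linarith
    have de: "0 \<le> dd - e" "dd - e < real CARD('d)" using dd3 e0 by (auto simp: dd_def)
    have b8': "0 \<le> 8 - \<beta>" "8 - \<beta> < real CARD('d)" using b8 by (auto simp: dd_def)
    have T0i: "integrable torus_measure T0" unfolding T0_def[abs_def]
      by (intro Bochner_Integration.integrable_sum radial_translate_torus(1) de)
    have T0v: "(\<integral>k. T0 k \<partial>torus_measure) \<le> real (Suc n) * V0"
    proof -
      have "(\<integral>k. T0 k \<partial>torus_measure) = (\<Sum>j\<le>n. \<integral>k. radial (dd - e) (k + real j *\<^sub>R u) \<partial>torus_measure)"
        unfolding T0_def by (intro Bochner_Integration.integral_sum radial_translate_torus(1) de)
      also have "\<dots> \<le> (\<Sum>j\<le>n. V0)" unfolding V0_def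
        by (intro sum_mono radial_translate_torus(2) de)
      finally show ?thesis by simp
    qed
    have L2b: "integrable torus_measure (\<lambda>k. (findiff u m f (k + real j *\<^sub>R u))\<^sup>2)"
      "(\<integral>k. (findiff u m f (k + real j *\<^sub>R u))\<^sup>2 \<partial>torus_measure) \<le> L2 * norm u powr (2 * a)"
      if "(m, j) \<in> ?I" for m j
    proof -
      have m: "0 < m" "a \<le> real m" "m \<le> n" using that aM by (auto simp: high_orders_def)
      note a' = m(1) a0 m(2) a2[unfolded dd_def]
      show "integrable torus_measure (\<lambda>k. (findiff u m f (k + real j *\<^sub>R u))\<^sup>2)"
        unfolding f_def by (rule findiff_symbol_L2(1)[OF a'])
      have "(\<integral>k. (findiff u m f (k + real j *\<^sub>R u))\<^sup>2 \<partial>torus_measure)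
        \<le> (2 * pi) ^ CARD('d) * 4 ^ m * (K1\<^sup>2 * lattice_zeta TYPE('d) (2 * (real CARD('d) + 2 + \<rho>) - 2 * a)) * norm u powr (2 * a)"
        unfolding f_def by (rule findiff_symbol_L2(2)[OF a'])
      also have "\<dots> \<le> L2 * norm u powr (2 * a)" unfolding L2_def dd_def
        by (intro mult_right_mono mult_left_mono power_increasing m(3) mult_nonneg_nonneg lattice_zeta_nonneg) auto
      finally show "(\<integral>k. (findiff u m f (k + real j *\<^sub>R u))\<^sup>2 \<partial>torus_measure) \<le> L2 * norm u powr (2 * a)" .
    qed
    have S2i: "integrable torus_measure S2" unfolding S2_def[abs_def]
      by (rule Bochner_Integration.integrable_sum) (use L2b(1) in auto)
    have S2v: "(\<integral>k. S2 k \<partial>torus_measure) \<le> real (card ?I) * (L2 * norm u powr (2 * a))"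
    proof -
      have "(\<integral>k. S2 k \<partial>torus_measure) = (\<Sum>x\<in>?I. \<integral>k. (case x of (m, j) \<Rightarrow> (findiff u m f (k + real j *\<^sub>R u))\<^sup>2) \<partial>torus_measure)"
        unfolding S2_def by (rule Bochner_Integration.integral_sum) (use L2b(1) in auto)
      also have "\<dots> \<le> (\<Sum>x\<in>?I. L2 * norm u powr (2 * a))"
        by (rule sum_mono) (use L2b(2) in auto)
      finally show ?thesis by simp
    qed
    have R8i: "integrable torus_measure (radial (8 - \<beta>) :: real^'d \<Rightarrow> real)"
      and R8v: "(\<integral>k. radial (8 - \<beta>) (k :: real^'d) \<partial>torus_measure) \<le> V1"
      using radial_translate_torus[OF b8', of 0] by (simp_all add: V1_def)
    have Mji: "integrable torus_measure Mj" unfolding Mj_def[abs_def]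
      by (intro Bochner_Integration.integrable_add integrable_mult_right T0i S2i R8i)
    have "(\<integral>k. \<bar>findiff u n E k\<bar> \<partial>torus_measure) \<le> (\<integral>k. Mj k \<partial>torus_measure)"
      by (rule integral_mono[OF integrable_abs[OF int'] Mji]) (use Mj in simp)
    also have "\<dots> = C3 * norm u powr p * (\<integral>k. T0 k \<partial>torus_measure)
      + C * (lam / 2 * (real (card ?I) * (\<integral>k. S2 k \<partial>torus_measure)) + 1 / (2 * lam) * norm u powr - \<beta> * (\<integral>k. radial (8 - \<beta>) (k :: real^'d) \<partial>torus_measure))"
      unfolding Mj_def using T0i S2i R8i by simp
    also have "\<dots> \<le> C3 * norm u powr p * (real (Suc n) * V0)
      + C * (lam / 2 * (real (card ?I) * (real (card ?I) * (L2 * norm u powr (2 * a)))) + 1 / (2 * lam) * norm u powr - \<beta> * V1)"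
      by (intro add_mono mult_left_mono T0v S2v R8v C0) (use C30 lam in auto)
    also have "\<dots> = C3 * norm u powr p * (real (Suc n) * V0)
      + C * (1 / 2 * (real (card ?I) * (real (card ?I) * L2)) * (lam * norm u powr (2 * a)) + 1 / 2 * V1 * (1 / lam * norm u powr - \<beta>))"
      by (simp add: mult_ac)
    also have "lam * norm u powr (2 * a) = norm u powr p"
      unfolding lam_def powr_add[symmetric] by (simp add: a_def)
    also have "1 / lam * norm u powr - \<beta> = norm u powr p"
    proof -
      have l: "1 / lam = norm u powr (a + \<beta> / 2)" unfolding lam_def by (subst powr_minus_divide) simp
      show ?thesis unfolding l powr_add[symmetric] by (simp add: a_def)
    qed
    also have "C3 * norm u powr p * (real (Suc n) * V0)
      + C * (1 / 2 * (real (card ?I) * (real (card ?I) * L2)) * norm u powr p + 1 / 2 * V1 * norm u powr p) = CC * norm u powr p"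
      by (simp add: CC_def algebra_simps)
    finally have fin: "(\<integral>k. \<bar>findiff u n E k\<bar> \<partial>torus_measure) \<le> CC * norm u powr p" .
    show ?thesis
      by (rule back_subst[of "\<lambda>h. (\<integral>k. \<bar>findiff u n h k\<bar> \<partial>torus_measure) \<le> CC * norm u powr p", OF fin Eeq[symmetric]])
  qed
  then show ?thesis using CC0 unfolding p_def dd_def by blast
qed

section \<open>The Green function\<close>

definition green :: "(int^'d::finite \<Rightarrow> real) \<Rightarrow> int^'d \<Rightarrow> complex" where
  "green F x = (\<integral>k. complex_of_real (1 / symbol F k) * wave (- x) k \<partial>torus_measure) / (2 * pi) ^ CARD('d)"

context lattice_kernel
begin

lemma norm_green_le:
  assumes d: "CARD('d) \<ge> 3"
  shows "norm (green F x) \<le> 1 / K2 * (\<integral>k. radial 2 (k :: real^'d) \<partial>lborel)"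
proof -
  have one: "1 \<le> (2 * pi) ^ CARD('d)" using pi_ge_two by (intro one_le_power) simp
  have "norm (\<integral>k. complex_of_real (1 / symbol F k) * wave (- x) k \<partial>torus_measure)
    \<le> (\<integral>k. norm (complex_of_real (1 / symbol F k) * wave (- x) k) \<partial>torus_measure)"
    by (rule integral_norm_bound)
  also have "\<dots> = (\<integral>k. \<bar>1 / symbol F k\<bar> \<partial>torus_measure)"
    by (simp add: norm_mult norm_divide)
  also have "\<dots> \<le> 1 / K2 * (\<integral>k. radial 2 (k :: real^'d) \<partial>lborel)"
    by (rule inverse_symbol_integrable(2)[OF d])
  finally have b: "norm (\<integral>k. complex_of_real (1 / symbol F k) * wave (- x) k \<partial>torus_measure)
    \<le> 1 / K2 * (\<integral>k. radial 2 (k :: real^'d) \<partial>lborel)" .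
  have "norm (green F x) = norm (\<integral>k. complex_of_real (1 / symbol F k) * wave (- x) k \<partial>torus_measure) / (2 * pi) ^ CARD('d)"
    by (simp add: green_def norm_divide norm_mult norm_power)
  also have "\<dots> \<le> norm (\<integral>k. complex_of_real (1 / symbol F k) * wave (- x) k \<partial>torus_measure) / 1"
    by (rule divide_left_mono[OF one]) auto
  finally show ?thesis using b by simp
qed

lemma periodic_inverse_symbol: "periodic (\<lambda>k. complex_of_real (1 / symbol F k))"
  using periodic_symbol by (simp add: periodic_def)

end

text \<open>Collects the factor 2 d / \<kappa> of the quadratic part, the transform of 1 / |k|^2
  from \<open>riesz_fourier\<close> and the normalisation (2 \<pi>)^(- d); the powers of 2 and \<pi>
  cancel to the stated leading constant.\<close>

lemma a_const_identity:
  fixes \<kappa> X :: real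
  assumes d: "d \<ge> 3" and X: "X > 0" and \<kappa>: "\<kappa> > 0"
  shows "2 * real d / \<kappa> * (pi powr (real d / 2) * Gamma (real d / 2 - 1) * (X\<^sup>2 / 4) powr (1 - real d / 2)) / (2 * pi) ^ d
    = a_const d / (\<kappa> * X powr (real d - 2))"
proof -
  have "(X\<^sup>2 / 4) powr (1 - real d / 2) = ((X / 2) powr 2) powr (1 - real d / 2)"
    using X by (simp add: power_divide)
  also have "\<dots> = (X / 2) powr (2 - real d)" by (simp add: powr_powr algebra_simps)
  also have "\<dots> = X powr (2 - real d) * 2 powr (real d - 2)"
    using X powr_minus_divide[of 2 "real d - 2"] by (simp add: powr_divide)
  finally have e1: "(X\<^sup>2 / 4) powr (1 - real d / 2) = X powr (2 - real d) * 2 powr (real d - 2)" .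
  have e2: "(2 * pi) ^ d = (4 * 2 powr (real d - 2)) * (pi powr (real d / 2) * pi powr (real d / 2))"
  proof -
    have "(2::real) ^ d = 2 powr real d" by (simp add: powr_realpow)
    also have "\<dots> = 2 powr (2 + (real d - 2))" by simp
    also have "\<dots> = 4 * 2 powr (real d - 2)" by (subst powr_add) simp
    finally have "(2::real) ^ d = 4 * 2 powr (real d - 2)" .
    moreover have "pi ^ d = pi powr (real d / 2) * pi powr (real d / 2)"
      by (simp add: powr_add[symmetric] powr_realpow)
    ultimately show ?thesis by (simp add: power_mult_distrib)
  qed
  have e3: "X powr (2 - real d) = 1 / X powr (real d - 2)"
    using powr_minus_divide[of X "real d - 2"] by simp
  have e4: "real d / 2 - 1 = (real d - 2) / 2" by (simp add: field_simps)
  define P where "P = pi powr (real d / 2)"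
  define T where "T = (2::real) powr (real d - 2)"
  have "P > 0" "T > 0" by (auto simp: P_def T_def)
  then show ?thesis
    unfolding e1 e2 e3 e4 a_const_def P_def[symmetric] T_def[symmetric] by (simp add: field_simps)
qed

text \<open>(-2)^n times the Green integral and (-2)^n times the transform of the quadratic
  reciprocal are integrals of n-th differences against one and the same wave, over the torus and
  over the whole space. They differ by the torus integral of the differenced error and by a tail
  outside the torus, where the differences make |k|^(-2) decay like |k|^(- (d + s)).\<close>

lemma green_asymptotics_far:
  fixes K1 K2 \<rho> s :: real
  assumes d: "CARD('d::finite) \<ge> 3" and K: "K1 > 0" "K2 > 0" and \<rho>: "\<rho> > 0"
    and s: "0 < s" "s < \<rho>" "s < 2" and s8: "CARD('d) > 8 \<Longrightarrow> s < \<rho> - (real CARD('d) - 8) / 2"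
  shows "\<exists>C\<ge>0. \<exists>X0. \<forall>(F :: int^'d \<Rightarrow> real) x. lattice_kernel F K1 K2 \<rho> \<longrightarrow> x \<noteq> 0 \<longrightarrow> X0 \<le> enorm x \<longrightarrow>
    norm (green F x - complex_of_real (a_const CARD('d) / (kappa0 F * enorm x powr (real CARD('d) - 2))))
      \<le> C * enorm x powr - (real CARD('d) - 2 + s)"
proof -
  define dd where "dd = real CARD('d)"
  define p where "p = dd - 2 + s"
  \<comment> \<open>At least d + 10, to exceed every L^2 exponent a, and even, so that n = 2 m as
    the Gaussian difference bound behind \<open>riesz_fourier\<close> requires.\<close>
  define M where "M = 2 * CARD('d) + 10"
  define n where "n = M * Suc CARD('d)"
  define m where "m = (CARD('d) + 5) * Suc CARD('d)"
  have nm: "n = 2 * m" by (simp add: n_def m_def M_def algebra_simps)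
  have md: "CARD('d) \<le> m" unfolding m_def by simp
  have M1: "CARD('d) + 10 \<le> M" "2 \<le> M" by (auto simp: M_def)
  obtain CA where CA0: "CA \<ge> 0" and CA: "\<And>(F :: int^'d \<Rightarrow> real) u. \<lbrakk>lattice_kernel F K1 K2 \<rho>; u \<noteq> 0; 2 * real n * norm u \<le> 1;
    integrable torus_measure (findiff u n (\<lambda>y. 1 / symbol F y - 1 / lattice_kernel.quad F y))\<rbrakk> \<Longrightarrow>
    (\<integral>k. \<bar>findiff u n (\<lambda>y. 1 / symbol F y - 1 / lattice_kernel.quad F y) k\<bar> \<partial>torus_measure) \<le> CA * norm u powr p"
    using torus_difference_bound[where 'd='d, OF d K \<rho> s s8 M1(1)] unfolding n_def p_def dd_def by auto
  obtain CW where CW0: "CW \<ge> 0" and CW: "\<And>k u :: real^'d. \<lbrakk>0 < norm k; 2 * real n * norm u \<le> norm k; norm u \<le> norm k\<rbrakk> \<Longrightarrow>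
    \<bar>findiff u n (\<lambda>k. 1 / (norm k)\<^sup>2) k\<bar> \<le> CW / (norm k)\<^sup>2 * (norm u / norm k) ^ Suc CARD('d)"
    using findiff_inverse_square_le[where 'a="real^'d", OF M1(2), of "Suc CARD('d)"] unfolding n_def by auto
  let ?O = "\<lambda>k :: real^'d. indicator {k. 1 \<le> norm k} k * norm k powr - (dd + s)"
  define V2 where "V2 = (\<integral>k. ?O k \<partial>lborel)"
  have Oi: "integrable lborel ?O"
    using set_integrable_norm_powr_outside[where 'a="real^'d", of "dd + s"] s by (simp add: set_integrable_def dd_def)
  have V20: "V2 \<ge> 0" unfolding V2_def by (rule Bochner_Integration.integral_nonneg) simp
  define C where "C = (CA + 1 / K2 * (CW * V2)) * pi powr p"
  have C0: "C \<ge> 0" unfolding C_def using CA0 CW0 V20 K by (intro mult_nonneg_nonneg add_nonneg_nonneg) auto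
  have main: "norm (green F x - complex_of_real (a_const CARD('d) / (kappa0 F * enorm x powr (dd - 2)))) \<le> C * enorm x powr - p"
    if kern: "lattice_kernel F K1 K2 \<rho>" and x: "x \<noteq> 0" and xl: "2 * real n * pi \<le> enorm x"
    for F :: "int^'d \<Rightarrow> real" and x
  proof -
    interpret lattice_kernel F K1 K2 \<rho> by (rule kern)
    define u where "u = half_period x"
    have ex: "enorm x \<ge> 1" by (rule enorm_ge_1[OF x])
    have nu: "norm u = pi / enorm x" unfolding u_def by (rule norm_half_period[OF x])
    have up: "norm u > 0" using nu ex by simp
    have un: "2 * real n * norm u \<le> 1" using xl ex by (simp add: nu divide_le_eq)
    have n1: "1 \<le> n" by (simp add: n_def M_def)
    have u1: "norm u \<le> 1"
    proof -
      have "1 * norm u \<le> 2 * real n * norm u" using n1 by (intro mult_right_mono) auto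
      then show ?thesis using un by simp
    qed
    define c where "c = 2 * real CARD('d) / kappa0 F"
    have "0 < 2 * real CARD('d) * K2" using K by simp
    then have kp: "kappa0 F > 0" using kappa0_ge by linarith
    have c0: "c \<ge> 0" "c \<le> 1 / K2" using kappa0_ge kp K by (auto simp: c_def field_simps)
    define w where "w = (\<lambda>k::real^'d. 1 / (norm k)\<^sup>2)"
    have wq: "1 / quad y = c * w y" for y by (simp add: quad_def c_def w_def)
    have E: "findiff u n (\<lambda>y. 1 / symbol F y - 1 / quad y) k = findiff u n (\<lambda>y. 1 / symbol F y) k - c * findiff u n w k" for k
      unfolding wq findiff_diff findiff_cmult ..
    let ?f = "\<lambda>k. complex_of_real (1 / symbol F k)"
    have wm: "wave (- x) \<in> borel_measurable torus_measure" "wave (- x) \<in> borel_measurable lborel" by measurable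
    have f1: "integrable torus_measure (findiff u n ?f)"
      unfolding u_def by (rule integrable_torus_findiff[OF periodic_inverse_symbol inverse_symbol_integrable(1)[OF d] x])
    then have f1r: "integrable torus_measure (findiff u n (\<lambda>y. 1 / symbol F y))"
      using integrable_Re[OF f1] unfolding findiff_of_real by simp
    have f2: "(\<integral>k. findiff u n ?f k * wave (- x) k \<partial>torus_measure) = (-2) ^ n * ((2 * pi) ^ CARD('d) * green F x)"
      unfolding u_def by (subst integral_torus_findiff[OF periodic_inverse_symbol inverse_symbol_integrable(1)[OF d] x])
        (simp add: green_def)
    have w1: "integrable lborel (findiff u n w)"
      unfolding u_def nm w_def by (rule riesz_fourier(1)[OF d x md])
    define J where "J = pi powr (dd / 2) * Gamma (dd / 2 - 1) * ((enorm x)\<^sup>2 / 4) powr (1 - dd / 2)"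
    have w2: "(\<integral>k. complex_of_real (findiff u n w k) * wave (- x) k \<partial>lborel) = complex_of_real ((-2) ^ n * J)"
      unfolding u_def nm w_def J_def dd_def by (rule riesz_fourier(2)[OF d x md])
    have w1T: "integrable torus_measure (findiff u n w)"
      unfolding integrable_torus_iff set_integrable_def
      by (rule integrable_mult_indicator) (use w1 in auto)
    have Eint: "integrable torus_measure (findiff u n (\<lambda>y. 1 / symbol F y - 1 / quad y))"
      using Bochner_Integration.integrable_diff[OF f1r integrable_mult_right[OF w1T, of c]] unfolding E[symmetric] .
    have Eb: "(\<integral>k. \<bar>findiff u n (\<lambda>y. 1 / symbol F y - 1 / quad y) k\<bar> \<partial>torus_measure) \<le> CA * norm u powr p"
      by (rule CA[OF kern _ un Eint]) (use up in auto)
    let ?W = "\<lambda>k. complex_of_real (findiff u n w k) * wave (- x) k"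
    have iW: "integrable lborel ?W" by (intro integrable_wave_mult integrable_of_real w1 wm)
    have iWT: "integrable torus_measure ?W" by (intro integrable_wave_mult integrable_of_real w1T wm)
    have iWc: "integrable lborel (\<lambda>k. indicator (- torus) k *\<^sub>R ?W k)"
      by (rule integrable_mult_indicator) (use iW in auto)
    have iWt: "integrable lborel (\<lambda>k. indicator torus k *\<^sub>R ?W k)"
      by (rule integrable_mult_indicator) (use iW in auto)
    have split: "(\<integral>k. ?W k \<partial>lborel) = (\<integral>k. ?W k \<partial>torus_measure) + (\<integral>k. indicator (- torus) k *\<^sub>R ?W k \<partial>lborel)"
    proof -
      have "(\<integral>k. ?W k \<partial>lborel) = (\<integral>k. indicator torus k *\<^sub>R ?W k + indicator (- torus) k *\<^sub>R ?W k \<partial>lborel)"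
        by (intro Bochner_Integration.integral_cong refl) (auto split: split_indicator)
      also have "\<dots> = (\<integral>k. indicator torus k *\<^sub>R ?W k \<partial>lborel) + (\<integral>k. indicator (- torus) k *\<^sub>R ?W k \<partial>lborel)"
        by (rule Bochner_Integration.integral_add[OF iWt iWc])
      finally show ?thesis by (simp add: integral_torus_eq set_lebesgue_integral_def)
    qed
    have tail: "norm (\<integral>k. indicator (- torus) k *\<^sub>R ?W k \<partial>lborel) \<le> CW * norm u powr p * V2"
    proof -
      have "norm (indicator (- torus) k *\<^sub>R ?W k) \<le> CW * norm u powr p * ?O k" for k
      proof (cases "k \<in> torus")
        case True
        then show ?thesis using CW0 by simp
      next
        case False
        then obtain i where "\<not> (- pi < k $ i \<and> k $ i \<le> pi)" by (auto simp: torus_def)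
        then have "pi \<le> \<bar>k $ i\<bar>" by auto
        then have k1: "1 \<le> norm k" using component_le_norm_cart[of k i] pi_ge_two by linarith
        have uk: "norm u \<le> norm k" "2 * real n * norm u \<le> norm k" using u1 un k1 by linarith+
        have k0: "0 < norm k" using k1 by linarith
        have ratio: "norm u / norm k \<le> 1" using uk(1) by (subst divide_le_eq_1_pos[OF k0])
        have "norm (indicator (- torus) k *\<^sub>R ?W k) = \<bar>findiff u n w k\<bar>" using False by (simp add: norm_mult)
        also have "\<dots> \<le> CW / (norm k)\<^sup>2 * (norm u / norm k) ^ Suc CARD('d)"
          unfolding w_def by (rule CW) (use k1 uk in auto)
        also have "\<dots> \<le> CW / (norm k)\<^sup>2 * (norm u powr p * norm k powr - p)"
        proof (rule mult_left_mono)
          have "(norm u / norm k) ^ Suc CARD('d) = (norm u / norm k) powr real (Suc CARD('d))"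
            by (rule powr_realpow[symmetric]) (rule divide_pos_pos[OF up k0])
          also have "\<dots> \<le> (norm u / norm k) powr p"
            by (rule powr_mono') (use ratio s in \<open>auto simp: p_def dd_def\<close>)
          also have "\<dots> = norm u powr p * norm k powr - p" using up k1 by (simp add: powr_divide powr_minus_divide)
          finally show "(norm u / norm k) ^ Suc CARD('d) \<le> norm u powr p * norm k powr - p" .
        qed (use CW0 in simp)
        also have "\<dots> = CW * norm u powr p * (norm k powr - p * norm k powr - 2)"
          using k1 by (simp add: powr_minus divide_inverse)
        also have "norm k powr - p * norm k powr - 2 = ?O k"
          unfolding powr_add[symmetric] using k1 by (simp add: p_def)
        finally show ?thesis .
      qed
      then have "norm (\<integral>k. indicator (- torus) k *\<^sub>R ?W k \<partial>lborel) \<le> (\<integral>k. CW * norm u powr p * ?O k \<partial>lborel)"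
        by (intro order_trans[OF integral_norm_bound] integral_mono integrable_norm iWc integrable_mult_right Oi)
      then show ?thesis by (simp add: V2_def)
    qed
    let ?D = "(2 * pi) ^ CARD('d) * green F x - complex_of_real (c * J)"
    have "(-2) ^ n * ?D = (\<integral>k. findiff u n ?f k * wave (- x) k \<partial>torus_measure) - complex_of_real c * (\<integral>k. ?W k \<partial>lborel)"
      unfolding f2 w2 by (simp add: right_diff_distrib)
    also have "\<dots> = ((\<integral>k. findiff u n ?f k * wave (- x) k \<partial>torus_measure) - complex_of_real c * (\<integral>k. ?W k \<partial>torus_measure))
        - complex_of_real c * (\<integral>k. indicator (- torus) k *\<^sub>R ?W k \<partial>lborel)"
      unfolding split by (simp add: distrib_left)
    also have "(\<integral>k. findiff u n ?f k * wave (- x) k \<partial>torus_measure) - complex_of_real c * (\<integral>k. ?W k \<partial>torus_measure)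
      = (\<integral>k. findiff u n ?f k * wave (- x) k - complex_of_real c * ?W k \<partial>torus_measure)"
      by (subst Bochner_Integration.integral_diff[OF integrable_wave_mult[OF f1 wm(1)] integrable_mult_right[OF iWT]]) simp
    also have "\<dots> = (\<integral>k. complex_of_real (findiff u n (\<lambda>y. 1 / symbol F y - 1 / quad y) k) * wave (- x) k \<partial>torus_measure)"
      by (intro Bochner_Integration.integral_cong refl) (simp only: E findiff_of_real of_real_diff of_real_mult left_diff_distrib mult.assoc)
    finally have eq: "(-2) ^ n * ?D = (\<integral>k. complex_of_real (findiff u n (\<lambda>y. 1 / symbol F y - 1 / quad y) k) * wave (- x) k \<partial>torus_measure)
      - complex_of_real c * (\<integral>k. indicator (- torus) k *\<^sub>R ?W k \<partial>lborel)" .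
    have "2 ^ n * norm ?D = norm ((-2) ^ n * ?D)" by (simp add: norm_mult norm_power)
    also have "\<dots> \<le> norm (\<integral>k. complex_of_real (findiff u n (\<lambda>y. 1 / symbol F y - 1 / quad y) k) * wave (- x) k \<partial>torus_measure)
      + norm (complex_of_real c * (\<integral>k. indicator (- torus) k *\<^sub>R ?W k \<partial>lborel))"
      unfolding eq by (rule norm_triangle_ineq4)
    also have "\<dots> \<le> CA * norm u powr p + 1 / K2 * (CW * norm u powr p * V2)"
    proof (rule add_mono)
      have "norm (\<integral>k. complex_of_real (findiff u n (\<lambda>y. 1 / symbol F y - 1 / quad y) k) * wave (- x) k \<partial>torus_measure)
        \<le> (\<integral>k. norm (complex_of_real (findiff u n (\<lambda>y. 1 / symbol F y - 1 / quad y) k) * wave (- x) k) \<partial>torus_measure)"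
        by (rule integral_norm_bound)
      also have "\<dots> = (\<integral>k. \<bar>findiff u n (\<lambda>y. 1 / symbol F y - 1 / quad y) k\<bar> \<partial>torus_measure)"
        by (simp add: norm_mult)
      finally show "norm (\<integral>k. complex_of_real (findiff u n (\<lambda>y. 1 / symbol F y - 1 / quad y) k) * wave (- x) k \<partial>torus_measure)
        \<le> CA * norm u powr p" using Eb by linarith
      show "norm (complex_of_real c * (\<integral>k. indicator (- torus) k *\<^sub>R ?W k \<partial>lborel)) \<le> 1 / K2 * (CW * norm u powr p * V2)"
        unfolding norm_mult by (intro mult_mono tail) (use c0 K in auto)
    qed
    also have "\<dots> = C * enorm x powr - p"
    proof -
      have "norm u powr p = pi powr p * enorm x powr - p"
        using ex by (simp add: nu powr_divide powr_minus_divide)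
      then show ?thesis by (simp add: C_def algebra_simps)
    qed
    finally have b1: "2 ^ n * norm ?D \<le> C * enorm x powr - p" .
    have pw: "1 \<le> (2 * pi) ^ CARD('d)" using pi_ge_two by (intro one_le_power) simp
    have ceq: "c * J = (2 * pi) ^ CARD('d) * (a_const CARD('d) / (kappa0 F * enorm x powr (dd - 2)))"
    proof -
      have "c * J / (2 * pi) ^ CARD('d) = a_const CARD('d) / (kappa0 F * enorm x powr (dd - 2))"
        unfolding c_def J_def dd_def by (rule a_const_identity[OF d _ kp]) (use ex in linarith)
      moreover have "c * J = (2 * pi) ^ CARD('d) * (c * J / (2 * pi) ^ CARD('d))" by simp
      ultimately show ?thesis by (simp only:)
    qed
    have Deq: "?D = complex_of_real ((2 * pi) ^ CARD('d)) * (green F x - complex_of_real (a_const CARD('d) / (kappa0 F * enorm x powr (dd - 2))))"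
      unfolding ceq by (simp add: right_diff_distrib)
    let ?N = "norm (green F x - complex_of_real (a_const CARD('d) / (kappa0 F * enorm x powr (dd - 2))))"
    have "1 * (1 * ?N) \<le> 2 ^ n * ((2 * pi) ^ CARD('d) * ?N)"
      by (intro mult_mono pw) auto
    also have "(2 * pi) ^ CARD('d) * ?N = norm ?D" unfolding Deq norm_mult norm_of_real by simp
    finally show ?thesis using b1 by simp
  qed
  show ?thesis
    using C0 main unfolding dd_def p_def by blast
qed

text \<open>Closes the gap at bounded x, including x = 0: both the Green function and the leading
  term are bounded there uniformly in F, and a power of the threshold absorbs the missing
  decay.\<close>

lemma green_asymptotics:
  fixes K1 K2 \<rho> s :: real
  assumes d: "CARD('d::finite) \<ge> 3" and K: "K1 > 0" "K2 > 0" and \<rho>: "\<rho> > 0"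
    and s: "0 < s" "s < \<rho>" "s < 2" and s8: "CARD('d) > 8 \<Longrightarrow> s < \<rho> - (real CARD('d) - 8) / 2"
  shows "\<exists>C\<ge>0. \<forall>(F :: int^'d \<Rightarrow> real) x. lattice_kernel F K1 K2 \<rho> \<longrightarrow>
    norm (green F x - complex_of_real (a_const CARD('d) / kappa0 F * xnorm x powr - (real CARD('d) - 2)))
      \<le> C * xnorm x powr - (real CARD('d) - 2 + s)"
proof -
  define dd where "dd = real CARD('d)"
  have dd3: "dd \<ge> 3" using d by (simp add: dd_def)
  define p where "p = dd - 2 + s"
  have p0: "p \<ge> 0" using dd3 s by (simp add: p_def)
  obtain C X0 where C0: "C \<ge> 0" and C: "\<And>(F :: int^'d \<Rightarrow> real) x. \<lbrakk>lattice_kernel F K1 K2 \<rho>; x \<noteq> 0; X0 \<le> enorm x\<rbrakk> \<Longrightarrow>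
    norm (green F x - complex_of_real (a_const CARD('d) / (kappa0 F * enorm x powr (dd - 2)))) \<le> C * enorm x powr - p"
    using green_asymptotics_far[where 'd='d, OF d K \<rho> s s8] unfolding dd_def p_def by blast
  define X1 where "X1 = max X0 1"
  have X1: "X1 \<ge> 1" by (simp add: X1_def)
  define V where "V = (\<integral>k. radial 2 (k :: real^'d) \<partial>lborel)"
  have V0: "V \<ge> 0" unfolding V_def by (rule Bochner_Integration.integral_nonneg, rule radial_nonneg)
  have a0: "a_const CARD('d) \<ge> 0"
  proof -
    have "Gamma ((real CARD('d) - 2) / 2) > 0" using d by (intro Gamma_real_pos) simp
    then show ?thesis by (simp add: a_const_def)
  qed
  define C' where "C' = C + (1 / K2 * V + a_const CARD('d) / K2) * X1 powr p"
  have C'0: "C' \<ge> 0" unfolding C'_def using C0 V0 K a0 by (intro add_nonneg_nonneg mult_nonneg_nonneg) auto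
  have main: "norm (green F x - complex_of_real (a_const CARD('d) / kappa0 F * xnorm x powr - (dd - 2))) \<le> C' * xnorm x powr - p"
    if kern: "lattice_kernel F K1 K2 \<rho>" for F :: "int^'d \<Rightarrow> real" and x
  proof -
    interpret lattice_kernel F K1 K2 \<rho> by (rule kern)
    have kK: "kappa0 F \<ge> K2"
    proof -
      have "1 * K2 \<le> 2 * real CARD('d) * K2" using d K by (intro mult_right_mono) auto
      then show ?thesis using kappa0_ge by simp
    qed
    have kp: "kappa0 F > 0" using kK K by linarith
    show ?thesis
    proof (cases "x \<noteq> 0 \<and> X0 \<le> enorm x")
      case True
      have eq: "a_const CARD('d) / kappa0 F * xnorm x powr - (dd - 2) = a_const CARD('d) / (kappa0 F * enorm x powr (dd - 2))"
        using True powr_minus_divide[of "enorm x" "dd - 2"] by (simp add: xnorm_eq_enorm)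
      have "norm (green F x - complex_of_real (a_const CARD('d) / kappa0 F * xnorm x powr - (dd - 2))) \<le> C * enorm x powr - p"
        unfolding eq by (rule C[OF kern]) (use True in auto)
      also have "\<dots> \<le> C' * xnorm x powr - p"
        using True V0 K a0 by (simp add: xnorm_eq_enorm) (intro mult_right_mono; simp add: C'_def)
      finally show ?thesis .
    next
      case False
      have xX: "xnorm x \<le> X1"
      proof (cases "x = 0")
        case True then show ?thesis using X1 by (simp add: xnorm_def enorm_def)
      next
        case F: False then show ?thesis using False by (simp add: xnorm_eq_enorm X1_def)
      qed
      have "norm (green F x - complex_of_real (a_const CARD('d) / kappa0 F * xnorm x powr - (dd - 2)))
        \<le> norm (green F x) + norm (complex_of_real (a_const CARD('d) / kappa0 F * xnorm x powr - (dd - 2)))"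
        by (rule norm_triangle_ineq4)
      also have "\<dots> \<le> 1 / K2 * V + a_const CARD('d) / K2"
      proof (rule add_mono)
        show "norm (green F x) \<le> 1 / K2 * V" unfolding V_def by (rule norm_green_le[OF d])
        have "a_const CARD('d) / kappa0 F * xnorm x powr - (dd - 2) \<le> a_const CARD('d) / K2 * 1"
        proof (rule mult_mono)
          show "a_const CARD('d) / kappa0 F \<le> a_const CARD('d) / K2"
            using kK K a0 by (intro divide_left_mono) auto
          show "xnorm x powr - (dd - 2) \<le> 1"
            using powr_mono[of "- (dd - 2)" 0 "xnorm x"] dd3 by simp
        qed (use a0 K in auto)
        then show "norm (complex_of_real (a_const CARD('d) / kappa0 F * xnorm x powr - (dd - 2))) \<le> a_const CARD('d) / K2"
          unfolding norm_of_real using a0 kp by simp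
      qed
      also have "\<dots> \<le> (1 / K2 * V + a_const CARD('d) / K2) * (X1 powr p * xnorm x powr - p)"
      proof -
        have "xnorm x powr p \<le> X1 powr p" by (intro powr_mono2 p0 xX) simp
        then have "1 \<le> X1 powr p * xnorm x powr - p" by (simp add: powr_minus field_simps)
        moreover have "0 \<le> 1 / K2 * V + a_const CARD('d) / K2" using V0 a0 K by simp
        ultimately have "(1 / K2 * V + a_const CARD('d) / K2) * 1 \<le> (1 / K2 * V + a_const CARD('d) / K2) * (X1 powr p * xnorm x powr - p)"
          by (rule mult_left_mono)
        then show ?thesis by (simp only: mult_1_right)
      qed
      also have "\<dots> \<le> C' * xnorm x powr - p"
        unfolding C'_def mult.assoc[symmetric] by (intro mult_right_mono) (use C0 in auto)
      finally show ?thesis .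
    qed
  qed
  show ?thesis using C'0 main unfolding dd_def p_def by blast
qed

section \<open>Convolution with the Green function\<close>

lemma powr_taylor_bound:
  fixes b :: real
  assumes b: "b > 0" and v: "1 / 4 \<le> v" "v \<le> 9 / 4"
  shows "\<bar>v powr - b - 1 + b * (v - 1)\<bar> \<le> b * (b + 1) * (1 / 4) powr (- b - 2) * (v - 1)\<^sup>2"
proof (cases "v = 1")
  case False
  define D where "D m t = (if m = 0 then t powr - b else if m = 1 then - b * t powr (- b - 1) else b * (b + 1) * t powr (- b - 2))"
    for m :: nat and t :: real
  have der: "\<forall>m t. m < 2 \<and> 1 / 4 \<le> t \<and> t \<le> 9 / 4 \<longrightarrow> DERIV (D m) t :> D (Suc m) t"
  proof (intro allI impI)
    fix m :: nat and t :: real assume a: "m < 2 \<and> 1 / 4 \<le> t \<and> t \<le> 9 / 4"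
    then have t: "t > 0" by simp
    consider "m = 0" | "m = 1" using a by linarith
    then show "DERIV (D m) t :> D (Suc m) t"
    proof cases
      case 1
      have "D 0 = (\<lambda>t. t powr - b)" by (simp add: D_def fun_eq_iff)
      then show ?thesis using t 1 by (auto simp: D_def intro!: derivative_eq_intros)
    next
      case 2
      have "D 1 = (\<lambda>t. - b * t powr (- b - 1))" by (simp add: D_def fun_eq_iff)
      moreover have "((\<lambda>t. - b * t powr (- b - 1)) has_real_derivative b * (b + 1) * t powr (- b - 2)) (at t)"
        using t by (auto intro!: derivative_eq_intros simp: algebra_simps)
      ultimately show ?thesis using 2 by (simp add: D_def)
    qed
  qed
  obtain t where t: "if v < 1 then v < t \<and> t < 1 else 1 < t \<and> t < v"
    and eq: "D 0 v = (\<Sum>m<2. D m 1 / fact m * (v - 1) ^ m) + D 2 t / fact 2 * (v - 1) ^ 2"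
    using Taylor[of 2 D "D 0" "1/4" "9/4" 1 v] der v False by auto
  have t4: "1 / 4 \<le> t" using t v by (auto split: if_splits)
  have "(\<Sum>m<2. D m 1 / fact m * (v - 1) ^ m) = 1 - b * (v - 1)"
    by (simp add: D_def numeral_2_eq_2)
  then have "v powr - b - 1 + b * (v - 1) = b * (b + 1) * t powr (- b - 2) / 2 * (v - 1)\<^sup>2"
    using eq by (simp add: D_def)
  also have "\<bar>\<dots>\<bar> \<le> b * (b + 1) * (1 / 4) powr (- b - 2) * (v - 1)\<^sup>2"
  proof -
    have "t powr (- b - 2) \<le> (1 / 4) powr (- b - 2)" using t4 b by (intro powr_mono2') auto
    then have "t powr (- b - 2) / 2 \<le> (1 / 4) powr (- b - 2)"
      using powr_ge_zero[of t "- b - 2"] by linarith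
    then have "b * (b + 1) * (t powr (- b - 2) / 2) * (v - 1)\<^sup>2 \<le> b * (b + 1) * (1 / 4) powr (- b - 2) * (v - 1)\<^sup>2"
      using b by (intro mult_right_mono mult_left_mono) auto
    then show ?thesis using b by (simp add: abs_mult)
  qed
  finally show ?thesis .
qed simp

lemma half_powr_minus:
  fixes v a :: real
  assumes "v > 0" shows "(v / 2) powr - a = 2 powr a * v powr - a"
  using assms by (simp add: powr_divide powr_minus_divide)

text \<open>
  Averaging over \<open>y\<close> and \<open>- y\<close> removes the first-order term of the expansion.
\<close>
lemma norm_powr_second_difference:
  fixes q :: real
  assumes q: "q > 0"
  shows "\<exists>C\<ge>0. \<forall>x y :: 'a::real_inner. x \<noteq> 0 \<longrightarrow> 2 * norm y \<le> norm x \<longrightarrow>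
    \<bar>(norm (x - y) powr - q + norm (x + y) powr - q) / 2 - norm x powr - q\<bar>
      \<le> C * norm x powr - q * (norm y / norm x)\<^sup>2"
proof -
  define b where "b = q / 2"
  have b: "b > 0" using q by (simp add: b_def)
  define A where "A = b * (b + 1) * (1 / 4) powr (- b - 2)"
  have A: "A \<ge> 0" using b by (simp add: A_def)
  define C where "C = 7 * A + b"
  have "\<bar>(norm (x - y) powr - q + norm (x + y) powr - q) / 2 - norm x powr - q\<bar> \<le> C * norm x powr - q * (norm y / norm x)\<^sup>2"
    if x: "x \<noteq> 0" and y: "2 * norm y \<le> norm x" for x y :: 'a
  proof -
    define r where "r = norm x"
    define z where "z = norm y / r"
    have r: "r > 0" using x by (simp add: r_def)
    have z: "0 \<le> z" "z \<le> 1 / 2" using y r by (auto simp: z_def r_def divide_le_eq)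
    define t where "t = (x \<bullet> y) / r\<^sup>2"
    have t: "\<bar>t\<bar> \<le> z"
    proof -
      have "\<bar>x \<bullet> y\<bar> \<le> r * norm y" unfolding r_def by (rule Cauchy_Schwarz_ineq2)
      then have "\<bar>x \<bullet> y\<bar> / r\<^sup>2 \<le> (r * norm y) / r\<^sup>2" using r by (intro divide_right_mono) auto
      then show ?thesis using r by (simp add: t_def z_def power2_eq_square abs_divide)
    qed
    \<comment> \<open>\<open>v1\<close> and \<open>v2\<close> are the squared ratios |x - y|^2 /
      |x|^2 and |x + y|^2 / |x|^2; expanding in the square of the norm makes the dependence on y
      polynomial.\<close>
    define v1 where "v1 = 1 - 2 * t + z\<^sup>2"
    define v2 where "v2 = 1 + 2 * t + z\<^sup>2"
    have zz: "z\<^sup>2 \<le> z / 2" using mult_left_mono[OF z(2) z(1)] by (simp add: power2_eq_square)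
    have n1: "(norm (x - y))\<^sup>2 = r\<^sup>2 * v1" and n2: "(norm (x + y))\<^sup>2 = r\<^sup>2 * v2"
      using r unfolding v1_def v2_def t_def z_def
      by (simp_all add: distrib_left right_diff_distrib power_divide r_def)
         (simp_all add: power2_norm_eq_inner inner_simps inner_commute)
    have vb: "1 / 4 \<le> v1" "v1 \<le> 9 / 4" "1 / 4 \<le> v2" "v2 \<le> 9 / 4"
    proof -
      have nx: "r / 2 \<le> norm (x - y)" "norm (x - y) \<le> 3 / 2 * r" "r / 2 \<le> norm (x + y)" "norm (x + y) \<le> 3 / 2 * r"
        using norm_triangle_ineq2[of x y] norm_triangle_ineq4[of x y] norm_triangle_ineq[of x y] norm_diff_ineq[of x y] y
        unfolding r_def by linarith+
      have sq: "1 / 4 \<le> v \<and> v \<le> 9 / 4" if "w\<^sup>2 = r\<^sup>2 * v" "r / 2 \<le> w" "w \<le> 3 / 2 * r" for w v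
      proof -
        have "(r / 2)\<^sup>2 \<le> w\<^sup>2" by (rule power_mono) (use that r in auto)
        moreover have "w\<^sup>2 \<le> (3 / 2 * r)\<^sup>2" by (rule power_mono) (use that r in auto)
        ultimately have "r\<^sup>2 * (1 / 4) \<le> r\<^sup>2 * v" "r\<^sup>2 * v \<le> r\<^sup>2 * (9 / 4)"
          unfolding that(1) by (simp_all add: power_divide power_mult_distrib)
        then show ?thesis using r by (simp add: mult_le_cancel_left_pos)
      qed
      show "1 / 4 \<le> v1" "v1 \<le> 9 / 4" "1 / 4 \<le> v2" "v2 \<le> 9 / 4"
        using sq[OF n1 nx(1,2)] sq[OF n2 nx(3,4)] by auto
    qed
    have pw: "w powr - q = r powr - q * v powr - b" if "w\<^sup>2 = r\<^sup>2 * v" "w \<ge> 0" "v > 0" for w v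
    proof -
      have "w = r * v powr (1 / 2)" using that r by (metis real_sqrt_mult real_sqrt_unique less_imp_le powr_half_sqrt abs_of_nonneg real_sqrt_abs)
      then have "w powr - q = r powr - q * (v powr (1 / 2)) powr - q" using r by (simp add: powr_mult)
      then show ?thesis by (simp add: powr_powr b_def)
    qed
    have w1: "norm (x - y) powr - q = r powr - q * v1 powr - b" by (rule pw[OF n1]) (use vb in auto)
    have w2: "norm (x + y) powr - q = r powr - q * v2 powr - b" by (rule pw[OF n2]) (use vb in auto)
    have sq7: "w\<^sup>2 \<le> 7 * z\<^sup>2" if "\<bar>w\<bar> \<le> 5 / 2 * z" for w
    proof -
      have "\<bar>w\<bar>\<^sup>2 \<le> (5 / 2 * z)\<^sup>2" by (intro power_mono that) auto
      also have "\<dots> \<le> 7 * z\<^sup>2" by (simp add: power_mult_distrib power2_eq_square)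
      finally show ?thesis by simp
    qed
    have d1: "(v1 - 1)\<^sup>2 \<le> 7 * z\<^sup>2" and d2: "(v2 - 1)\<^sup>2 \<le> 7 * z\<^sup>2"
    proof -
      have t': "t \<le> z" "- t \<le> z" using t by (simp_all add: abs_le_iff)
      have z2: "0 \<le> z\<^sup>2" by simp
      show "(v1 - 1)\<^sup>2 \<le> 7 * z\<^sup>2" unfolding v1_def by (rule sq7, rule abs_leI) (use t' z2 zz z(1) in linarith)+
      show "(v2 - 1)\<^sup>2 \<le> 7 * z\<^sup>2" unfolding v2_def by (rule sq7, rule abs_leI) (use t' z2 zz z(1) in linarith)+
    qed
    have T1: "\<bar>v1 powr - b - 1 + b * (v1 - 1)\<bar> \<le> A * (7 * z\<^sup>2)"
      using powr_taylor_bound[OF b vb(1,2)] mult_left_mono[OF d1 A] by (simp add: A_def)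
    have T2: "\<bar>v2 powr - b - 1 + b * (v2 - 1)\<bar> \<le> A * (7 * z\<^sup>2)"
      using powr_taylor_bound[OF b vb(3,4)] mult_left_mono[OF d2 A] by (simp add: A_def)
    \<comment> \<open>The linear terms - 2 t and 2 t cancel in the average; of v1 - 1 and v2 - 1
      only z^2 survives.\<close>
    have eqn: "(v1 powr - b + v2 powr - b) / 2 - 1 = ((v1 powr - b - 1 + b * (v1 - 1)) + (v2 powr - b - 1 + b * (v2 - 1))) / 2 - b * z\<^sup>2"
      by (simp add: v1_def v2_def algebra_simps)
    have aux: "\<bar>(a1 + a2) / 2 - w\<bar> \<le> T + w" if "\<bar>a1\<bar> \<le> T" "\<bar>a2\<bar> \<le> T" "0 \<le> w" for a1 a2 w T :: real
    proof -
      have "\<bar>a1 + a2\<bar> \<le> T + T" by (rule order_trans[OF abs_triangle_ineq add_mono[OF that(1,2)]])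
      then have "\<bar>(a1 + a2) / 2\<bar> \<le> T" by simp
      then show ?thesis using that(3) by (intro order_trans[OF abs_triangle_ineq4 add_mono]) auto
    qed
    have "\<bar>(v1 powr - b + v2 powr - b) / 2 - 1\<bar> \<le> A * (7 * z\<^sup>2) + b * z\<^sup>2"
      unfolding eqn by (rule aux[OF T1 T2]) (use b in simp)
    then have "r powr - q * \<bar>(v1 powr - b + v2 powr - b) / 2 - 1\<bar> \<le> r powr - q * (C * z\<^sup>2)"
      by (intro mult_left_mono) (simp_all add: C_def algebra_simps)
    also have "r powr - q * \<bar>(v1 powr - b + v2 powr - b) / 2 - 1\<bar> = \<bar>r powr - q * ((v1 powr - b + v2 powr - b) / 2 - 1)\<bar>"
      by (simp add: abs_mult)
    also have "r powr - q * ((v1 powr - b + v2 powr - b) / 2 - 1) = (norm (x - y) powr - q + norm (x + y) powr - q) / 2 - norm x powr - q"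
      unfolding w1 w2 by (simp add: r_def algebra_simps)
    finally show ?thesis by (simp add: r_def z_def mult_ac)
  qed
  moreover have "C \<ge> 0" using A b by (simp add: C_def)
  ultimately show ?thesis by blast
qed

text \<open>
  A lattice point \<open>y\<close> comparable with \<open>x\<close> contributes through the decay of \<open>g\<close>, whether or not
  \<open>y\<close> is close to \<open>x\<close>.
\<close>
lemma far_term_bound:
  fixes g :: "int^'d::finite \<Rightarrow> real"
  assumes g: "\<And>x. \<bar>g x\<bar> \<le> K / xnorm x powr (dd + \<sigma>)" and K: "K \<ge> 0"
    and dd: "dd > 2" and s: "0 < s" "s < \<sigma>" and q: "dd - 2 \<le> q" "q \<le> dd - 2 + s" and far: "xnorm x \<le> 2 * xnorm y"
  shows "\<bar>g y\<bar> * xnorm (x - y) powr - q \<le> (2 powr (q + s) + K * 2 powr (dd + \<sigma>)) * xnorm x powr - (dd - 2 + s)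
      * (\<bar>g y\<bar> * xnorm y powr s + xnorm (x - y) powr - (dd + (\<sigma> - s)))"
proof (cases "xnorm x \<le> 2 * xnorm (x - y)")
  case True
  have e: "xnorm (x - y) powr - q \<le> 2 powr q * xnorm x powr - q"
  proof -
    have "xnorm (x - y) powr - q \<le> (xnorm x / 2) powr - q" using True q dd by (intro powr_mono2') auto
    then show ?thesis by (simp only: half_powr_minus[OF xnorm_pos])
  qed
  have one: "1 \<le> 2 powr s * xnorm y powr s * xnorm x powr - s"
  proof -
    have "xnorm x powr s \<le> (2 * xnorm y) powr s" using far s by (intro powr_mono2) auto
    then show ?thesis by (simp add: powr_mult powr_minus field_simps)
  qed
  have mono: "xnorm x powr - (q + s) \<le> xnorm x powr - (dd - 2 + s)"
    using q by (intro powr_mono) auto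
  have "\<bar>g y\<bar> * xnorm (x - y) powr - q \<le> \<bar>g y\<bar> * ((2 powr q * xnorm x powr - q) * (2 powr s * xnorm y powr s * xnorm x powr - s))"
    using mult_mono[OF e one] by (intro mult_left_mono) auto
  also have "\<dots> = 2 powr (q + s) * (\<bar>g y\<bar> * xnorm y powr s) * xnorm x powr - (q + s)"
  proof -
    have "xnorm x powr - (q + s) = xnorm x powr - q * xnorm x powr - s" by (simp flip: powr_add)
    then show ?thesis by (simp only: powr_add[of 2] mult_ac)
  qed
  also have "\<dots> \<le> 2 powr (q + s) * (\<bar>g y\<bar> * xnorm y powr s) * xnorm x powr - (dd - 2 + s)"
    by (intro mult_left_mono mono) auto
  also have "\<dots> = 2 powr (q + s) * xnorm x powr - (dd - 2 + s) * (\<bar>g y\<bar> * xnorm y powr s)" by simp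
  also have "\<dots> \<le> (2 powr (q + s) + K * 2 powr (dd + \<sigma>)) * xnorm x powr - (dd - 2 + s)
      * (\<bar>g y\<bar> * xnorm y powr s + xnorm (x - y) powr - (dd + (\<sigma> - s)))"
    using K by (intro mult_mono) auto
  finally show ?thesis .
next
  case False
  \<comment> \<open>Here x - y is small against x, so g y carries the decay |x|^(- (d + \<sigma>)).
    Raising the power of 1 / |x - y| to d + \<delta> costs at most |x|^(2 + \<delta>) and makes it
    summable in y; the spare decay \<sigma> - s of g pays for this.\<close>
  define \<delta> where "\<delta> = \<sigma> - s"
  have g1: "\<bar>g y\<bar> \<le> K * (2 powr (dd + \<sigma>) * xnorm x powr - (dd + \<sigma>))"
  proof -
    have "xnorm y powr - (dd + \<sigma>) \<le> (xnorm x / 2) powr - (dd + \<sigma>)" using far s dd by (intro powr_mono2') auto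
    then have "xnorm y powr - (dd + \<sigma>) \<le> 2 powr (dd + \<sigma>) * xnorm x powr - (dd + \<sigma>)"
      by (simp only: half_powr_minus[OF xnorm_pos])
    then have "K * xnorm y powr - (dd + \<sigma>) \<le> K * (2 powr (dd + \<sigma>) * xnorm x powr - (dd + \<sigma>))"
      by (intro mult_left_mono K)
    moreover have "\<bar>g y\<bar> \<le> K * xnorm y powr - (dd + \<sigma>)" using g[of y] by (simp only: powr_minus divide_inverse)
    ultimately show ?thesis by (rule order_trans[rotated])
  qed
  have "xnorm (x - y) powr - q \<le> xnorm (x - y) powr (2 + \<delta> + - (dd + \<delta>))" using q by (intro powr_mono) auto
  also have "\<dots> = xnorm (x - y) powr (2 + \<delta>) * xnorm (x - y) powr - (dd + \<delta>)" by (rule powr_add)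
  also have "\<dots> \<le> xnorm x powr (2 + \<delta>) * xnorm (x - y) powr - (dd + \<delta>)"
  proof (intro mult_right_mono powr_mono2)
    show "xnorm (x - y) \<le> xnorm x" using False xnorm_nonneg[of "x - y"] by linarith
  qed (use s in \<open>auto simp: \<delta>_def\<close>)
  finally have x1: "xnorm (x - y) powr - q \<le> xnorm x powr (2 + \<delta>) * xnorm (x - y) powr - (dd + \<delta>)" .
  have "\<bar>g y\<bar> * xnorm (x - y) powr - q \<le> (K * (2 powr (dd + \<sigma>) * xnorm x powr - (dd + \<sigma>))) * (xnorm x powr (2 + \<delta>) * xnorm (x - y) powr - (dd + \<delta>))"
    using K by (intro mult_mono g1 x1) auto
  also have "\<dots> = (K * 2 powr (dd + \<sigma>)) * (xnorm x powr - (dd + \<sigma>) * xnorm x powr (2 + \<delta>)) * xnorm (x - y) powr - (dd + \<delta>)"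
    by (simp only: mult_ac)
  also have "xnorm x powr - (dd + \<sigma>) * xnorm x powr (2 + \<delta>) = xnorm x powr - (dd - 2 + s)"
    unfolding powr_add[symmetric] by (simp add: \<delta>_def algebra_simps)
  also have "(K * 2 powr (dd + \<sigma>)) * xnorm x powr - (dd - 2 + s) * xnorm (x - y) powr - (dd + \<delta>)
    \<le> (2 powr (q + s) + K * 2 powr (dd + \<sigma>)) * xnorm x powr - (dd - 2 + s)
      * (\<bar>g y\<bar> * xnorm y powr s + xnorm (x - y) powr - (dd + \<delta>))"
    using K by (intro mult_mono) auto
  finally show ?thesis by (simp add: \<delta>_def)
qed

lemma near_xnorm:
  fixes x y :: "int^'d::finite"
  assumes near: "2 * xnorm y < xnorm x"
  shows "x \<noteq> 0" "2 * norm (rvec y) \<le> norm (rvec x)" "xnorm x = norm (rvec x)"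
    "xnorm (x - y) = norm (rvec x - rvec y)" "xnorm (x + y) = norm (rvec x + rvec y)"
    "xnorm x / 2 \<le> xnorm (x - y)"
proof -
  have x2: "xnorm x > 2" using near xnorm_ge_1[of y] by linarith
  then show x: "x \<noteq> 0" by (auto simp: xnorm_def enorm_def)
  show xn: "xnorm x = norm (rvec x)" using xnorm_eq_enorm[OF x] by (simp add: enorm_def)
  have yn: "norm (rvec y) \<le> xnorm y" using enorm_le_xnorm[of y] by (simp add: enorm_def)
  show "2 * norm (rvec y) \<le> norm (rvec x)" using yn near xn by linarith
  have m: "rvec (x - y) = rvec x - rvec y" by (rule rvec_diff)
  have p: "rvec (x + y) = rvec x + rvec y" using rvec_diff[of x "- y"] by (simp add: rvec_minus)
  have l1: "xnorm x / 2 \<le> norm (rvec x - rvec y)" using norm_triangle_ineq2[of "rvec x" "rvec y"] yn near xn by linarith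
  have l2: "xnorm x / 2 \<le> norm (rvec x + rvec y)" using norm_diff_ineq[of "rvec x" "rvec y"] yn near xn by linarith
  have "1 \<le> norm (rvec x - rvec y)" "1 \<le> norm (rvec x + rvec y)" using l1 l2 x2 by linarith+
  then have "max (norm (rvec x - rvec y)) 1 = norm (rvec x - rvec y)" "max (norm (rvec x + rvec y)) 1 = norm (rvec x + rvec y)"
    by (simp_all only: max_absorb1)
  then show xm: "xnorm (x - y) = norm (rvec x - rvec y)" and "xnorm (x + y) = norm (rvec x + rvec y)"
    unfolding xnorm_def enorm_def m p by this+
  show "xnorm x / 2 \<le> xnorm (x - y)" using l1 xm by simp
qed

lemma summable_on_involution:
  assumes "\<And>x. h (h x) = x" and "f summable_on UNIV"
  shows "(\<lambda>x. f (h x)) summable_on UNIV"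
  using assms(2) by (rule summable_on_reindex_bij_witness[of _ h h, THEN iffD1, rotated -1]) (use assms(1) in auto)

text \<open>Two estimates for one convolution: the error kernel of order d - 2 + s keeps its decay,
  and the leading kernel of order d - 2 reproduces itself times the sum of g up to an error of the
  better order. Evenness of g allows averaging over y and - y in the second.\<close>

lemma convolution_bound:
  fixes K \<sigma> s :: real
  assumes d: "CARD('d::finite) \<ge> 3" and K: "K \<ge> 0" and s: "0 < s" "s < \<sigma>" "s \<le> 2"
  shows "\<exists>C\<ge>0. \<forall>(g :: int^'d \<Rightarrow> real) x. (\<forall>y. g (- y) = g y) \<longrightarrow>
    (\<forall>y. \<bar>g y\<bar> \<le> K / xnorm y powr (real CARD('d) + \<sigma>)) \<longrightarrow>
    (\<lambda>y. \<bar>g y\<bar> * xnorm (x - y) powr - (real CARD('d) - 2 + s)) summable_on UNIV \<and>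
    (\<Sum>\<^sub>\<infinity>y. \<bar>g y\<bar> * xnorm (x - y) powr - (real CARD('d) - 2 + s)) \<le> C * xnorm x powr - (real CARD('d) - 2 + s) \<and>
    (\<lambda>y. g y * xnorm (x - y) powr - (real CARD('d) - 2)) summable_on UNIV \<and>
    \<bar>(\<Sum>\<^sub>\<infinity>y. g y * xnorm (x - y) powr - (real CARD('d) - 2)) - xnorm x powr - (real CARD('d) - 2) * (\<Sum>\<^sub>\<infinity>y. g y)\<bar>
      \<le> C * xnorm x powr - (real CARD('d) - 2 + s)"
proof -
  define dd where "dd = real CARD('d)"
  have dd: "dd > 2" using d by (simp add: dd_def)
  define p where "p = dd - 2 + s"
  define q where "q = dd - 2"
  have q0: "q > 0" using dd by (simp add: q_def)
  define \<gamma> where "\<gamma> = dd + (\<sigma> - s)"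
  obtain C1 where C10: "C1 \<ge> 0" and C1: "\<And>x y :: real^'d. \<lbrakk>x \<noteq> 0; 2 * norm y \<le> norm x\<rbrakk> \<Longrightarrow>
    \<bar>(norm (x - y) powr - q + norm (x + y) powr - q) / 2 - norm x powr - q\<bar> \<le> C1 * norm x powr - q * (norm y / norm x)\<^sup>2"
    using norm_powr_second_difference[where 'a="real^'d", OF q0] by blast
  define A where "A = 2 powr (p + s) + 2 powr (q + s) + K * 2 powr (dd + \<sigma>) + 2 powr p + 2 powr s + C1"
  have A0: "A \<ge> 0" using K C10 by (simp add: A_def)
  define Z where "Z = lattice_zeta TYPE('d) \<gamma>"
  have Z0: "Z \<ge> 0" unfolding Z_def by (rule lattice_zeta_nonneg)
  define G where "G = K * lattice_zeta TYPE('d) (dd + \<sigma> - s)"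
  have G0: "G \<ge> 0" unfolding G_def by (intro mult_nonneg_nonneg K lattice_zeta_nonneg)
  define C where "C = A * (2 * G + 2 * Z)"
  have C0: "C \<ge> 0" unfolding C_def using A0 G0 Z0 by simp
  have main: "(\<lambda>y. \<bar>g y\<bar> * xnorm (x - y) powr - p) summable_on UNIV \<and>
    (\<Sum>\<^sub>\<infinity>y. \<bar>g y\<bar> * xnorm (x - y) powr - p) \<le> C * xnorm x powr - p \<and>
    (\<lambda>y. g y * xnorm (x - y) powr - q) summable_on UNIV \<and>
    \<bar>(\<Sum>\<^sub>\<infinity>y. g y * xnorm (x - y) powr - q) - xnorm x powr - q * (\<Sum>\<^sub>\<infinity>y. g y)\<bar> \<le> C * xnorm x powr - p"
    if ev: "\<And>y. g (- y) = g y" and g: "\<And>y. \<bar>g y\<bar> \<le> K / xnorm y powr (dd + \<sigma>)" for g :: "int^'d \<Rightarrow> real" and x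
  proof -
    define X where "X = xnorm x powr - p"
    have X0: "X \<ge> 0" by (simp add: X_def)
    \<comment> \<open>A majorant symmetric under y to - y, so that it serves both halves of the
      average. Its sum is bounded independently of x, since the translated zeta sums do not depend
      on x.\<close>
    define W where "W y = \<bar>g y\<bar> * xnorm y powr s + xnorm (x - y) powr - \<gamma> + (\<bar>g y\<bar> * xnorm y powr s + xnorm (x + y) powr - \<gamma>)" for y
    have gs: "(\<lambda>y. \<bar>g y\<bar> * xnorm y powr s) summable_on UNIV" "(\<Sum>\<^sub>\<infinity>y. \<bar>g y\<bar> * xnorm y powr s) \<le> G"
      unfolding G_def by (rule weighted_summable[OF g] weighted_sum_le[OF g]; use s in \<open>simp add: dd_def\<close>)+
    have zs: "(\<lambda>y::int^'d. xnorm y powr - \<gamma>) summable_on UNIV"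
      by (rule summable_on_xnorm_powr) (use s in \<open>simp add: \<gamma>_def dd_def\<close>)
    have z1: "(\<lambda>y. xnorm (x - y) powr - \<gamma>) summable_on UNIV" "(\<Sum>\<^sub>\<infinity>y. xnorm (x - y) powr - \<gamma>) = Z"
      using summable_on_involution[of "\<lambda>y. x - y", OF _ zs] infsum_involution[of "\<lambda>y. x - y" "\<lambda>y. xnorm y powr - \<gamma>"]
      by (auto simp: Z_def lattice_zeta_def)
    have xm: "xnorm (- x - y) = xnorm (x + y)" for y using xnorm_minus[of "x + y"] by (simp add: algebra_simps)
    have z2: "(\<lambda>y. xnorm (x + y) powr - \<gamma>) summable_on UNIV" "(\<Sum>\<^sub>\<infinity>y. xnorm (x + y) powr - \<gamma>) = Z"
      using summable_on_involution[of "\<lambda>y. - x - y", OF _ zs] infsum_involution[of "\<lambda>y. - x - y" "\<lambda>y. xnorm y powr - \<gamma>"]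
      by (auto simp: Z_def lattice_zeta_def xm)
    have Ws: "W summable_on UNIV" unfolding W_def[abs_def] by (intro summable_on_add gs z1 z2)
    have Wi: "infsum W UNIV \<le> 2 * G + 2 * Z"
    proof -
      have "(W has_sum ((\<Sum>\<^sub>\<infinity>y. \<bar>g y\<bar> * xnorm y powr s) + Z + ((\<Sum>\<^sub>\<infinity>y. \<bar>g y\<bar> * xnorm y powr s) + Z))) UNIV"
        unfolding W_def[abs_def]
        by (intro has_sum_add has_sum_infsum gs(1) has_sum_infsum[OF z1(1), unfolded z1(2)] has_sum_infsum[OF z2(1), unfolded z2(2)])
      then show ?thesis using gs(2) by (simp add: infsumI)
    qed
    have AWs: "(\<lambda>y. A * X * W y) summable_on UNIV" by (intro summable_on_cmult_right Ws)
    have AWi: "(\<Sum>\<^sub>\<infinity>y. A * X * W y) \<le> C * X"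
    proof -
      have "(\<Sum>\<^sub>\<infinity>y. A * X * W y) = A * X * infsum W UNIV" by (rule infsum_cmult_right')
      also have "\<dots> \<le> A * X * (2 * G + 2 * Z)" by (intro mult_left_mono Wi) (use A0 X0 in simp)
      finally show ?thesis by (simp add: C_def mult_ac)
    qed
    have gW: "\<bar>g y\<bar> \<le> W y" "\<bar>g y\<bar> * xnorm y powr s \<le> W y"
      "\<bar>g y\<bar> * xnorm y powr s + xnorm (x - y) powr - \<gamma> \<le> W y"
      "\<bar>g y\<bar> * xnorm y powr s + xnorm (x + y) powr - \<gamma> \<le> W y" for y
    proof -
      have "1 \<le> xnorm y powr s" using s by (intro ge_one_powr_ge_zero) auto
      then have "\<bar>g y\<bar> * 1 \<le> \<bar>g y\<bar> * xnorm y powr s" by (intro mult_left_mono) auto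
      then show "\<bar>g y\<bar> \<le> W y" unfolding W_def
        using powr_ge_zero[of "xnorm (x - y)" "- \<gamma>"] powr_ge_zero[of "xnorm (x + y)" "- \<gamma>"]
          mult_nonneg_nonneg[OF abs_ge_zero[of "g y"] powr_ge_zero[of "xnorm y" s]] by linarith
      show "\<bar>g y\<bar> * xnorm y powr s \<le> W y"
        "\<bar>g y\<bar> * xnorm y powr s + xnorm (x - y) powr - \<gamma> \<le> W y"
        "\<bar>g y\<bar> * xnorm y powr s + xnorm (x + y) powr - \<gamma> \<le> W y" unfolding W_def by auto
    qed
    have W0: "W y \<ge> 0" for y using gW(1)[of y] abs_ge_zero[of "g y"] by linarith
    have far: "\<bar>g y\<bar> * xnorm (x - y) powr - q' \<le> (2 powr (q' + s) + K * 2 powr (dd + \<sigma>)) * X * (\<bar>g y\<bar> * xnorm y powr s + xnorm (x - y) powr - \<gamma>)"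
      if "xnorm x \<le> 2 * xnorm y" "dd - 2 \<le> q'" "q' \<le> dd - 2 + s" for y q'
      using far_term_bound[OF g K dd s(1,2) that(2,3,1)] by (simp add: X_def p_def \<gamma>_def)
    have t1: "\<bar>g y\<bar> * xnorm (x - y) powr - p \<le> A * X * W y" for y
    proof (cases "xnorm x \<le> 2 * xnorm y")
      case True
      have "\<bar>g y\<bar> * xnorm (x - y) powr - p \<le> (2 powr (p + s) + K * 2 powr (dd + \<sigma>)) * X * (\<bar>g y\<bar> * xnorm y powr s + xnorm (x - y) powr - \<gamma>)"
        by (rule far[OF True]) (use s in \<open>auto simp: p_def\<close>)
      also have "\<dots> \<le> A * X * W y"
        by (intro mult_mono gW) (use X0 A0 C10 K W0 in \<open>auto simp: A_def\<close>)
      finally show ?thesis .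
    next
      case False
      then have "xnorm x / 2 \<le> xnorm (x - y)" by (intro near_xnorm(6)) simp
      then have "xnorm (x - y) powr - p \<le> (xnorm x / 2) powr - p" using s dd by (intro powr_mono2') (auto simp: p_def)
      also have "\<dots> = 2 powr p * X" unfolding X_def by (rule half_powr_minus[OF xnorm_pos])
      finally have "\<bar>g y\<bar> * xnorm (x - y) powr - p \<le> \<bar>g y\<bar> * (2 powr p * X)" by (intro mult_left_mono) auto
      also have "\<dots> = 2 powr p * X * \<bar>g y\<bar>" by simp
      also have "\<dots> \<le> A * X * W y"
        by (intro mult_mono gW) (use X0 A0 C10 K W0 in \<open>auto simp: A_def\<close>)
      finally show ?thesis .
    qed
    have qX: "xnorm x powr - q * xnorm x powr - s = X" unfolding X_def powr_add[symmetric] by (simp add: q_def p_def)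
    have gx: "\<bar>g y\<bar> * xnorm x powr - q \<le> 2 powr s * X * (\<bar>g y\<bar> * xnorm y powr s)" if "xnorm x \<le> 2 * xnorm y" for y
    proof -
      have "xnorm x powr s \<le> (2 * xnorm y) powr s" using that s by (intro powr_mono2) auto
      then have "1 \<le> 2 powr s * xnorm y powr s * xnorm x powr - s" by (simp add: powr_mult powr_minus field_simps)
      then have "\<bar>g y\<bar> * xnorm x powr - q * 1 \<le> \<bar>g y\<bar> * xnorm x powr - q * (2 powr s * xnorm y powr s * xnorm x powr - s)"
        by (intro mult_left_mono) auto
      also have "\<dots> = 2 powr s * (xnorm x powr - q * xnorm x powr - s) * (\<bar>g y\<bar> * xnorm y powr s)" by simp
      finally show ?thesis unfolding qX by simp
    qed
    have t2: "\<bar>g y * ((xnorm (x - y) powr - q + xnorm (x + y) powr - q) / 2 - xnorm x powr - q)\<bar> \<le> A * X * W y" for y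
    proof (cases "xnorm x \<le> 2 * xnorm y")
      case True
      let ?c = "2 powr (q + s) + K * 2 powr (dd + \<sigma>)"
      have "\<bar>g y\<bar> * xnorm (x - y) powr - q \<le> ?c * X * (\<bar>g y\<bar> * xnorm y powr s + xnorm (x - y) powr - \<gamma>)"
        by (rule far[OF True]) (use s in \<open>auto simp: q_def\<close>)
      also have "\<dots> \<le> ?c * X * W y" by (intro mult_left_mono gW) (use X0 K in auto)
      finally have b1: "\<bar>g y\<bar> * xnorm (x - y) powr - q \<le> ?c * X * W y" .
      have "\<bar>g (- y)\<bar> * xnorm (x - - y) powr - q \<le> ?c * X * (\<bar>g (- y)\<bar> * xnorm (- y) powr s + xnorm (x - - y) powr - \<gamma>)"
        by (rule far) (use True s in \<open>auto simp: q_def\<close>)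
      also have "\<dots> \<le> ?c * X * W y" using gW(4)[of y] by (intro mult_left_mono) (use X0 K in \<open>auto simp: ev\<close>)
      finally have b2: "\<bar>g y\<bar> * xnorm (x + y) powr - q \<le> ?c * X * W y" by (simp add: ev)
      have "\<bar>g y\<bar> * xnorm x powr - q \<le> 2 powr s * X * (\<bar>g y\<bar> * xnorm y powr s)" by (rule gx[OF True])
      also have "\<dots> \<le> 2 powr s * X * W y" by (intro mult_left_mono gW) (use X0 in auto)
      finally have b3: "\<bar>g y\<bar> * xnorm x powr - q \<le> 2 powr s * X * W y" .
      have avg: "(a + b) / 2 + c \<le> P + Q" if "a \<le> P" "b \<le> P" "c \<le> Q" for a b c P Q :: real
        using add_mono[OF divide_right_mono[OF add_mono[OF that(1,2)], of 2] that(3)] by simp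
      have tri: "\<bar>(a + b) / 2 - c\<bar> \<le> (a + b) / 2 + c" if "a \<ge> 0" "b \<ge> 0" "c \<ge> 0" for a b c :: real
        using abs_triangle_ineq4[of "(a + b) / 2" c] that by simp
      have "\<bar>g y * ((xnorm (x - y) powr - q + xnorm (x + y) powr - q) / 2 - xnorm x powr - q)\<bar>
        \<le> \<bar>g y\<bar> * ((xnorm (x - y) powr - q + xnorm (x + y) powr - q) / 2 + xnorm x powr - q)"
        unfolding abs_mult by (intro mult_left_mono tri) auto
      also have "\<dots> = (\<bar>g y\<bar> * xnorm (x - y) powr - q + \<bar>g y\<bar> * xnorm (x + y) powr - q) / 2 + \<bar>g y\<bar> * xnorm x powr - q"
        by (simp add: distrib_left)
      also have "\<dots> \<le> ?c * X * W y + 2 powr s * X * W y" by (rule avg[OF b1 b2 b3])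
      also have "\<dots> = (?c + 2 powr s) * (X * W y)" by (simp add: algebra_simps)
      also have "\<dots> \<le> A * (X * W y)" by (intro mult_right_mono) (use X0 W0 C10 in \<open>auto simp: A_def\<close>)
      finally show ?thesis by (simp add: mult.assoc)
    next
      case False
      then have nr: "2 * xnorm y < xnorm x" by simp
      note n = near_xnorm[OF nr]
      have rx: "rvec x \<noteq> 0" using n(3) xnorm_pos[of x] by auto
      have "\<bar>(xnorm (x - y) powr - q + xnorm (x + y) powr - q) / 2 - xnorm x powr - q\<bar> \<le> C1 * xnorm x powr - q * (norm (rvec y) / xnorm x)\<^sup>2"
        unfolding n(3-5) by (rule C1[OF rx n(2)])
      \<comment> \<open>As |y| < |x| and s <= 2, the square of the ratio may be weakened to its
        power s; it is the sum of g weighted with |y|^s whose finiteness is at hand.\<close>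
      also have "\<dots> \<le> C1 * xnorm x powr - q * (xnorm y powr s * xnorm x powr - s)"
      proof (intro mult_left_mono)
        have "norm (rvec y) / xnorm x \<le> xnorm y / xnorm x"
          using enorm_le_xnorm[of y] by (intro divide_right_mono) (auto simp: enorm_def)
        then have "(norm (rvec y) / xnorm x)\<^sup>2 \<le> (xnorm y / xnorm x)\<^sup>2" by (intro power_mono) auto
        also have "\<dots> = (xnorm y / xnorm x) powr 2" by simp
        also have "\<dots> \<le> (xnorm y / xnorm x) powr s"
        proof (rule powr_mono')
          have "xnorm y \<le> xnorm x" using nr xnorm_pos[of y] by linarith
          then show "xnorm y / xnorm x \<le> 1" by (subst divide_le_eq_1_pos) auto
        qed (use s in auto)
        also have "\<dots> = xnorm y powr s * xnorm x powr - s" by (simp add: powr_divide powr_minus_divide)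
        finally show "(norm (rvec y) / xnorm x)\<^sup>2 \<le> xnorm y powr s * xnorm x powr - s" .
      qed (use C10 in simp)
      also have "\<dots> = C1 * (xnorm x powr - q * xnorm x powr - s) * xnorm y powr s" by simp
      finally have "\<bar>g y\<bar> * \<bar>(xnorm (x - y) powr - q + xnorm (x + y) powr - q) / 2 - xnorm x powr - q\<bar> \<le> \<bar>g y\<bar> * (C1 * X * xnorm y powr s)"
        unfolding qX by (intro mult_left_mono) auto
      also have "\<dots> = C1 * X * (\<bar>g y\<bar> * xnorm y powr s)" by simp
      also have "\<dots> \<le> A * X * W y"
        by (intro mult_mono gW) (use X0 A0 C10 K W0 in \<open>auto simp: A_def\<close>)
      finally show ?thesis by (simp only: abs_mult)
    qed
    have g0: "(\<lambda>y. \<bar>g y\<bar>) summable_on UNIV"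
      by (rule summable_on_comparison_test[OF Ws]) (use gW in auto)
    have bnd: "(\<lambda>y. g y * xnorm (z y) powr - q) summable_on UNIV" for z :: "int^'d \<Rightarrow> int^'d"
    proof (rule infsum_bounded_by(1)[OF g0])
      fix y
      have "xnorm (z y) powr - q \<le> 1" using powr_mono[of "- q" 0 "xnorm (z y)"] q0 by simp
      then show "\<bar>g y * xnorm (z y) powr - q\<bar> \<le> \<bar>g y\<bar>" by (simp add: abs_mult mult_left_le)
    qed
    let ?S1 = "\<Sum>\<^sub>\<infinity>y. g y * xnorm (x - y) powr - q" and ?S2 = "\<Sum>\<^sub>\<infinity>y. g y * xnorm (x + y) powr - q"
    have S12: "?S2 = ?S1"
      using infsum_involution[of uminus "\<lambda>y. g y * xnorm (x - y) powr - q"] by (simp add: ev)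
    have gsum: "g summable_on UNIV" by (rule abs_summable_summable) (use g0 in simp)
    note b1 = has_sum_infsum[OF bnd[of "\<lambda>y. x - y"]] and b2 = has_sum_infsum[OF bnd[of "\<lambda>y. x + y"]]
    have eqf: "(1/2) * (g y * xnorm (x - y) powr - q) + (1/2) * (g y * xnorm (x + y) powr - q) + (- (xnorm x powr - q)) * g y
        = g y * ((xnorm (x - y) powr - q + xnorm (x + y) powr - q) / 2 - xnorm x powr - q)" for y
      by (simp add: field_simps)
    have eqs: "(1/2) * ?S1 + (1/2) * ?S2 + (- (xnorm x powr - q)) * infsum g UNIV = ?S1 - xnorm x powr - q * infsum g UNIV"
      unfolding S12 by simp
    have "((\<lambda>y. g y * ((xnorm (x - y) powr - q + xnorm (x + y) powr - q) / 2 - xnorm x powr - q)) has_sum (?S1 - xnorm x powr - q * infsum g UNIV)) UNIV"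
      using has_sum_add[OF has_sum_add[OF has_sum_cmult_right[OF b1, of "1/2"] has_sum_cmult_right[OF b2, of "1/2"]]
        has_sum_cmult_right[OF has_sum_infsum[OF gsum], of "- (xnorm x powr - q)"]]
      unfolding eqf eqs .
    then have "?S1 - xnorm x powr - q * infsum g UNIV = (\<Sum>\<^sub>\<infinity>y. g y * ((xnorm (x - y) powr - q + xnorm (x + y) powr - q) / 2 - xnorm x powr - q))"
      by (rule infsumI[symmetric])
    then have c4: "\<bar>?S1 - xnorm x powr - q * infsum g UNIV\<bar> \<le> C * X"
      using infsum_bounded_by(2)[OF AWs t2] AWi by linarith
    have t1': "\<bar>\<bar>g y\<bar> * xnorm (x - y) powr - p\<bar> \<le> A * X * W y" for y using t1[of y] by simp
    have c1: "(\<lambda>y. \<bar>g y\<bar> * xnorm (x - y) powr - p) summable_on UNIV" by (rule infsum_bounded_by(1)[OF AWs t1'])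
    have c2: "(\<Sum>\<^sub>\<infinity>y. \<bar>g y\<bar> * xnorm (x - y) powr - p) \<le> C * X"
      using infsum_bounded_by(2)[OF AWs t1'] AWi by linarith
    show ?thesis using c1 c2 bnd c4 unfolding X_def by blast
  qed
  show ?thesis
    by (rule exI[of _ C], rule conjI[OF C0], intro allI impI) (use main[unfolded p_def q_def dd_def] in blast)
qed

section \<open>The solution as a convolution with the Green function\<close>

context lattice_kernel
begin

lemma sol_integrand_eq:
  "sol_integrand F g x k = fseries (\<lambda>y. complex_of_real (g y)) k * (complex_of_real (1 / symbol F k) * wave (- x) k / (2 * pi) ^ CARD('d))"
  by (simp add: sol_integrand_def fourier_eq_fseries[of g] fourier_symbol wave_minus_eq)

text \<open>Expanding the transform of g under the integral, which summability of g and
  integrability of 1 / f justify, gives the convolution with the Green function. Summing F against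
  translates of the solution multiplies the integrand by f, which cancels the denominator and leaves
  a Fourier coefficient of g.\<close>

lemma sol_representation:
  fixes g :: "int^'d \<Rightarrow> real"
  assumes d: "CARD('d) \<ge> 3" and g: "(\<lambda>y. \<bar>g y\<bar>) summable_on UNIV"
  shows "integrable torus_measure (sol_integrand F g x)"
    and "((\<lambda>y. complex_of_real (g y) * green F (x - y)) has_sum sol F g x) UNIV"
    and "conv (\<lambda>y. complex_of_real (F y)) (sol F g) x = complex_of_real (g x)"
proof -
  let ?P = "complex_of_real ((2 * pi) ^ CARD('d))"
  define \<phi> where "\<phi> x y k = complex_of_real (g y) * (complex_of_real (1 / symbol F k) * wave (- (x - y)) k / ?P)" for x y k
  have wm: "wave z \<in> borel_measurable torus_measure" for z :: "int^'d" by measurable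
  have base: "integrable torus_measure (\<lambda>k. complex_of_real (1 / symbol F k) * wave z k / ?P)" for z
    by (intro Bochner_Integration.integrable_divide integrable_wave_mult inverse_symbol_integrable(1)[OF d] wm)
  have i: "integrable torus_measure (\<phi> x y)" for x y
    unfolding \<phi>_def by (intro integrable_mult_right base)
  have nrm: "norm (\<phi> x y k) = \<bar>g y\<bar> * (\<bar>1 / symbol F k\<bar> / (2 * pi) ^ CARD('d))" for x y k
    by (simp add: \<phi>_def norm_mult norm_divide norm_power)
  have s1: "(\<lambda>y. \<integral>k. norm (\<phi> x y k) \<partial>torus_measure) summable_on UNIV" for x
    unfolding nrm integral_mult_right_zero by (intro summable_on_cmult_left g)
  have s2: "(\<lambda>y. norm (\<phi> x y k)) summable_on UNIV" for x k
    unfolding nrm by (intro summable_on_cmult_left g)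
  have sum: "(\<Sum>\<^sub>\<infinity>y. \<phi> x y k) = sol_integrand F g x k" for x k
  proof -
    have "\<phi> x y k = complex_of_real (g y) * wave y k * (complex_of_real (1 / symbol F k) * wave (- x) k / (2 * pi) ^ CARD('d))" for y
      using wave_plus[of y "- x" k] by (simp add: \<phi>_def algebra_simps)
    then show ?thesis unfolding sol_integrand_eq fseries_def by (simp only: infsum_cmult_left')
  qed
  have sol: "sol F g x = (\<integral>k. sol_integrand F g x k \<partial>torus_measure)" for x
    by (simp add: sol_def integral_torus_eq)
  show int: "integrable torus_measure (sol_integrand F g x)" for x
    using integrable_infsum[OF i s1 s2, of x] unfolding sum .
  have "((\<lambda>y. \<integral>k. \<phi> x y k \<partial>torus_measure) has_sum sol F g x) UNIV"
    using integral_has_sum[OF i s1 s2, of x] unfolding sum sol .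
  moreover have "(\<integral>k. \<phi> x y k \<partial>torus_measure) = complex_of_real (g y) * green F (x - y)" for y
    by (simp only: \<phi>_def green_def integral_mult_right_zero integral_divide_zero of_real_power of_real_mult of_real_numeral)
  ultimately show "((\<lambda>y. complex_of_real (g y) * green F (x - y)) has_sum sol F g x) UNIV" by simp
  have gc: "(\<lambda>y. norm (complex_of_real (g y))) summable_on UNIV" using g by simp
  define \<psi> where "\<psi> y k = complex_of_real (F y) * sol_integrand F g (x - y) k" for y k
  have shift: "sol_integrand F g (x - y) k = wave y k * sol_integrand F g x k" for y k
    using wave_plus[of y "- x" k] by (simp add: sol_integrand_eq algebra_simps)
  have ni: "norm (\<psi> y k) = \<bar>F y\<bar> * norm (sol_integrand F g x k)" for y k
    by (simp add: \<psi>_def shift norm_mult)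
  have j1: "integrable torus_measure (\<psi> y)" for y unfolding \<psi>_def[abs_def] by (intro integrable_mult_right int)
  have j2: "(\<lambda>y. \<integral>k. norm (\<psi> y k) \<partial>torus_measure) summable_on UNIV"
    unfolding ni integral_mult_right_zero by (intro summable_on_cmult_left abs_summable)
  have j3: "(\<lambda>y. norm (\<psi> y k)) summable_on UNIV" for k
    unfolding ni by (intro summable_on_cmult_left abs_summable)
  have sumF: "(\<Sum>\<^sub>\<infinity>y. \<psi> y k) = complex_of_real (symbol F k) * sol_integrand F g x k" for k
  proof -
    have "\<psi> y k = complex_of_real (F y) * wave y k * sol_integrand F g x k" for y by (simp add: \<psi>_def shift)
    then have "(\<Sum>\<^sub>\<infinity>y. \<psi> y k) = fseries (\<lambda>y. complex_of_real (F y)) k * sol_integrand F g x k"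
      unfolding fseries_def by (simp only: infsum_cmult_left')
    then show ?thesis by (simp only: fourier_eq_fseries[symmetric] fourier_symbol)
  qed
  have "((\<lambda>y. \<integral>k. \<psi> y k \<partial>torus_measure) has_sum (\<integral>k. complex_of_real (symbol F k) * sol_integrand F g x k \<partial>torus_measure)) UNIV"
    using integral_has_sum[OF j1 j2 j3] unfolding sumF .
  moreover have "(\<integral>k. \<psi> y k \<partial>torus_measure) = complex_of_real (F y) * sol F g (x - y)" for y
    by (simp add: \<psi>_def sol)
  ultimately have "conv (\<lambda>y. complex_of_real (F y)) (sol F g) x = (\<integral>k. complex_of_real (symbol F k) * sol_integrand F g x k \<partial>torus_measure)"
    unfolding conv_def by (simp add: infsumI)
  also have "\<dots> = (\<integral>k. fseries (\<lambda>y. complex_of_real (g y)) k * wave (- x) k / ?P \<partial>torus_measure)"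
  proof (rule integral_cong_AE)
    \<comment> \<open>The cancellation of f against 1 / f fails at k = 0, where f vanishes and the
      quotient is 0 by convention; that is a null set.\<close>
    have "AE k in lborel. k \<in> torus \<longrightarrow> complex_of_real (symbol F k) * sol_integrand F g x k
        = fseries (\<lambda>y. complex_of_real (g y)) k * wave (- x) k / ?P"
      using AE_lborel_singleton[of "0 :: real^'d"]
    proof eventually_elim
      case (elim k)
      show ?case
      proof
        assume k: "k \<in> torus"
        have "0 < K2 * (norm k)\<^sup>2" using elim K2 by simp
        then have "symbol F k \<noteq> 0" using symbol_lower[OF k] by linarith
        then show "complex_of_real (symbol F k) * sol_integrand F g x k = fseries (\<lambda>y. complex_of_real (g y)) k * wave (- x) k / ?P"
          by (simp add: sol_integrand_eq)
      qed
    qed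
    then show "AE k in torus_measure. complex_of_real (symbol F k) * sol_integrand F g x k
        = fseries (\<lambda>y. complex_of_real (g y)) k * wave (- x) k / ?P"
      unfolding torus_measure_def by (subst AE_restrict_space_iff) auto
    have fm: "fseries (\<lambda>y. complex_of_real (g y)) \<in> borel_measurable torus_measure"
      by (rule borel_measurable_integrable[OF integrable_fseries[OF gc]])
    show "(\<lambda>k. fseries (\<lambda>y. complex_of_real (g y)) k * wave (- x) k / ?P) \<in> borel_measurable torus_measure"
      by (intro borel_measurable_divide borel_measurable_times fm wm borel_measurable_const)
    have "(\<lambda>k. complex_of_real (symbol F k)) \<in> borel_measurable torus_measure" by measurable
    then show "(\<lambda>k. complex_of_real (symbol F k) * sol_integrand F g x k) \<in> borel_measurable torus_measure"
      by (intro borel_measurable_times borel_measurable_integrable[OF int])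
  qed
  also have "\<dots> = (\<integral>k. fseries (\<lambda>y. complex_of_real (g y)) k * wave (- x) k \<partial>torus_measure) / ?P"
    by (rule integral_divide_zero)
  also have "\<dots> = complex_of_real (g x)" unfolding fseries_coeff[OF gc] by simp
  finally show "conv (\<lambda>y. complex_of_real (F y)) (sol F g) x = complex_of_real (g x)" .
qed

end

theorem corollary1p3:
  fixes K1 K2 K3 \<rho> s :: real
  assumes "CARD('d::finite) > 2"
    and "K1 > 0" and "K2 > 0" and "K3 > 0"
    and "\<rho> > max ((real CARD('d) - 8) / 2) 0"
    and "CARD('d) \<le> 8 \<Longrightarrow> s < min \<rho> 2"
    and "CARD('d) > 8 \<Longrightarrow> s < min (\<rho> - (real CARD('d) - 8) / 2) 2"
  shows "\<exists>C::real. \<forall>(F :: int ^ 'd \<Rightarrow> real) (g :: int ^ 'd \<Rightarrow> real).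
      lattice_symmetric F \<and>
      fourier F 0 = 0 \<and>
      (\<forall>x. \<bar>F x\<bar> \<le> K1 / xnorm x powr (real CARD('d) + 2 + \<rho>)) \<and>
      (\<forall>k\<in>torus. fourier F k \<in> \<real> \<and> Re (fourier F k) \<ge> K2 * (norm k)\<^sup>2) \<and>
      lattice_symmetric g \<and>
      (\<forall>x. \<bar>g x\<bar> \<le> K3 / xnorm x powr (real CARD('d) + min \<rho> 2))
      \<longrightarrow>
      kappa0 F \<ge> 2 * real CARD('d) * K2 \<and>
      (\<forall>x. set_integrable lborel torus (sol_integrand F g x)) \<and>
      (\<forall>x. conv (\<lambda>y. complex_of_real (F y)) (sol F g) x = complex_of_real (g x)) \<and>
      (\<forall>x. norm (sol F g x - complex_of_real
              (a_const CARD('d) * (\<Sum>\<^sub>\<infinity>y. g y) /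
                 (kappa0 F * xnorm x powr (real CARD('d) - 2))))
           \<le> C / xnorm x powr (real CARD('d) - 2 + s))"
proof -
  define dd where "dd = real CARD('d)"
  define lim where "lim = (if CARD('d) > 8 then min (\<rho> - (dd - 8) / 2) 2 else min \<rho> 2)"
  \<comment> \<open>s may be zero or negative, while the estimates want a positive exponent. t lies
    strictly between max s 0 and the admissible limit; as \<open>xnorm\<close> is at least 1, an
    error of order t implies one of order s.\<close>
  define t where "t = (max s 0 + lim) / 2"
  have d: "CARD('d) \<ge> 3" using assms(1) by simp
  have rho: "\<rho> > 0" "\<rho> > (dd - 8) / 2" using assms(5) by (auto simp: dd_def)
  have lim: "lim > 0" "s < lim" using assms(6,7) rho by (auto simp: lim_def dd_def)
  have limle: "lim \<le> min \<rho> 2"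
  proof (cases "CARD('d) > 8")
    case True
    then have "\<rho> - (dd - 8) / 2 \<le> \<rho>" by (simp add: dd_def)
    then show ?thesis using True unfolding lim_def by (simp only: if_True)
  qed (simp add: lim_def)
  have t: "0 < t" "s < t" "t < \<rho>" "t < 2" "t < min \<rho> 2" "t < lim" using lim limle by (auto simp: t_def)
  have t8: "t < \<rho> - (real CARD('d) - 8) / 2" if "CARD('d) > 8"
    using t(6) that by (simp add: lim_def dd_def)
  define p where "p = dd - 2 + t"
  define q where "q = dd - 2"
  obtain CG where CG0: "CG \<ge> 0" and CG: "\<And>(F :: int^'d \<Rightarrow> real) x. lattice_kernel F K1 K2 \<rho> \<Longrightarrow>
    norm (green F x - complex_of_real (a_const CARD('d) / kappa0 F * xnorm x powr - q)) \<le> CG * xnorm x powr - p"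
    using green_asymptotics[where 'd='d, OF d assms(2,3) rho(1) t(1,3,4) t8] unfolding q_def p_def dd_def by blast
  obtain CH where CH0: "CH \<ge> 0" and CH: "\<And>(g :: int^'d \<Rightarrow> real) x. \<lbrakk>\<forall>y. g (- y) = g y; \<forall>y. \<bar>g y\<bar> \<le> K3 / xnorm y powr (dd + min \<rho> 2)\<rbrakk> \<Longrightarrow>
    (\<lambda>y. \<bar>g y\<bar> * xnorm (x - y) powr - p) summable_on UNIV \<and>
    (\<Sum>\<^sub>\<infinity>y. \<bar>g y\<bar> * xnorm (x - y) powr - p) \<le> CH * xnorm x powr - p \<and>
    (\<lambda>y. g y * xnorm (x - y) powr - q) summable_on UNIV \<and>
    \<bar>(\<Sum>\<^sub>\<infinity>y. g y * xnorm (x - y) powr - q) - xnorm x powr - q * (\<Sum>\<^sub>\<infinity>y. g y)\<bar> \<le> CH * xnorm x powr - p"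
    using convolution_bound[where 'd='d and K=K3 and \<sigma>="min \<rho> 2" and s=t] d assms(4) t unfolding q_def p_def dd_def by fastforce
  have a0: "a_const CARD('d) \<ge> 0"
  proof -
    have "Gamma ((real CARD('d) - 2) / 2) > 0" using d by (intro Gamma_real_pos) simp
    then show ?thesis by (simp add: a_const_def)
  qed
  define C where "C = CG * CH + a_const CARD('d) / K2 * CH"
  have C0: "C \<ge> 0" using CG0 CH0 a0 assms(3) by (simp add: C_def)
  show ?thesis
  proof (intro exI[of _ C] allI impI)
    fix F g :: "int^'d \<Rightarrow> real"
    assume H: "lattice_symmetric F \<and> fourier F 0 = 0 \<and>
      (\<forall>x. \<bar>F x\<bar> \<le> K1 / xnorm x powr (real CARD('d) + 2 + \<rho>)) \<and>
      (\<forall>k\<in>torus. fourier F k \<in> \<real> \<and> Re (fourier F k) \<ge> K2 * (norm k)\<^sup>2) \<and>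
      lattice_symmetric g \<and> (\<forall>x. \<bar>g x\<bar> \<le> K3 / xnorm x powr (real CARD('d) + min \<rho> 2))"
    have kern: "lattice_kernel F K1 K2 \<rho>" by unfold_locales (use H assms rho in auto)
    interpret lattice_kernel F K1 K2 \<rho> by (rule kern)
    have gsym: "\<forall>y. g (- y) = g y" using lattice_symmetric_uminus H by blast
    have gb: "\<bar>g y\<bar> \<le> K3 / xnorm y powr (dd + min \<rho> 2)" for y using H by (simp add: dd_def)
    have gs: "(\<lambda>y. \<bar>g y\<bar>) summable_on UNIV"
      using weighted_summable[OF gb, of 0] rho by (simp add: dd_def)
    have kK: "kappa0 F \<ge> K2"
    proof -
      have "1 * K2 \<le> 2 * real CARD('d) * K2" using d K2 by (intro mult_right_mono) auto
      then show ?thesis using kappa0_ge by simp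
    qed
    then have kp: "kappa0 F > 0" using K2 by linarith
    define c where "c = a_const CARD('d) / kappa0 F"
    have c: "0 \<le> c" "c \<le> a_const CARD('d) / K2" unfolding c_def using a0 kK kp K2 by (auto intro!: divide_left_mono)
    have est: "norm (sol F g x - complex_of_real (a_const CARD('d) * (\<Sum>\<^sub>\<infinity>y. g y) / (kappa0 F * xnorm x powr (real CARD('d) - 2))))
      \<le> C / xnorm x powr (real CARD('d) - 2 + s)" for x
    proof -
      note ch = CH[OF gsym, OF allI[OF gb], of x]
      define S where "S = (\<Sum>\<^sub>\<infinity>y. g y * xnorm (x - y) powr - q)"
      \<comment> \<open>The Green function is split into its leading power and this error. Convolved
        with g, the former gives the main term by the second estimate of
        \<open>convolution_bound\<close>, the latter is controlled by the first.\<close>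
      define err where "err z = green F z - complex_of_real (c * xnorm z powr - q)" for z
      have errb: "norm (err z) \<le> CG * xnorm z powr - p" for z unfolding err_def c_def by (rule CG[OF kern])
      have h1: "((\<lambda>y. complex_of_real (g y) * green F (x - y)) has_sum sol F g x) UNIV"
        by (rule sol_representation(2)[OF d gs])
      have "((\<lambda>y. g y * xnorm (x - y) powr - q) has_sum S) UNIV" using ch by (simp add: S_def)
      then have h2: "((\<lambda>y. complex_of_real (- c * (g y * xnorm (x - y) powr - q))) has_sum complex_of_real (- c * S)) UNIV"
        by (intro has_sum_of_real has_sum_cmult_right)
      have h3: "((\<lambda>y. complex_of_real (g y) * err (x - y)) has_sum (sol F g x - complex_of_real (c * S))) UNIV"
        using has_sum_add[OF h1 h2] by (simp add: err_def algebra_simps)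
      have eb: "norm (complex_of_real (g y) * err (x - y)) \<le> CG * (\<bar>g y\<bar> * xnorm (x - y) powr - p)" for y
        using mult_left_mono[OF errb[of "x - y"] abs_ge_zero[of "g y"]] by (simp add: norm_mult mult_ac)
      have es: "(\<lambda>y. CG * (\<bar>g y\<bar> * xnorm (x - y) powr - p)) summable_on UNIV"
        by (intro summable_on_cmult_right) (use ch in blast)
      have "norm (sol F g x - complex_of_real (c * S)) \<le> (\<Sum>\<^sub>\<infinity>y. CG * (\<bar>g y\<bar> * xnorm (x - y) powr - p))"
        unfolding infsumI[OF h3, symmetric] by (rule norm_infsum_le[OF has_sum_infsum[OF has_sum_imp_summable[OF h3]] has_sum_infsum[OF es] eb])
      also have "\<dots> = CG * (\<Sum>\<^sub>\<infinity>y. \<bar>g y\<bar> * xnorm (x - y) powr - p)" by (rule infsum_cmult_right')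
      also have "\<dots> \<le> CG * (CH * xnorm x powr - p)" by (intro mult_left_mono CG0) (use ch in blast)
      finally have b1: "norm (sol F g x - complex_of_real (c * S)) \<le> CG * (CH * xnorm x powr - p)" .
      have "norm (complex_of_real (c * S) - complex_of_real (c * (xnorm x powr - q * (\<Sum>\<^sub>\<infinity>y. g y)))) = c * \<bar>S - xnorm x powr - q * (\<Sum>\<^sub>\<infinity>y. g y)\<bar>"
        unfolding of_real_diff[symmetric] norm_of_real right_diff_distrib[symmetric] abs_mult using c by simp
      also have "\<dots> \<le> a_const CARD('d) / K2 * (CH * xnorm x powr - p)"
        by (intro mult_mono c) (use ch a0 K2 in \<open>auto simp: S_def\<close>)
      finally have b2: "norm (complex_of_real (c * S) - complex_of_real (c * (xnorm x powr - q * (\<Sum>\<^sub>\<infinity>y. g y)))) \<le> a_const CARD('d) / K2 * (CH * xnorm x powr - p)" .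
      have lead: "a_const CARD('d) * (\<Sum>\<^sub>\<infinity>y. g y) / (kappa0 F * xnorm x powr (real CARD('d) - 2)) = c * (xnorm x powr - q * (\<Sum>\<^sub>\<infinity>y. g y))"
        unfolding c_def q_def dd_def powr_minus by (simp add: divide_inverse)
      have "norm (sol F g x - complex_of_real (c * (xnorm x powr - q * (\<Sum>\<^sub>\<infinity>y. g y)))) \<le> C * xnorm x powr - p"
        using norm_triangle_ineq[of "sol F g x - complex_of_real (c * S)" "complex_of_real (c * S) - complex_of_real (c * (xnorm x powr - q * (\<Sum>\<^sub>\<infinity>y. g y)))"] b1 b2
        by (simp add: C_def algebra_simps)
      also have "\<dots> \<le> C * xnorm x powr - (dd - 2 + s)"
        by (intro mult_left_mono C0 powr_mono) (use t in \<open>auto simp: p_def\<close>)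
      also have "\<dots> = C / xnorm x powr (real CARD('d) - 2 + s)" unfolding dd_def powr_minus divide_inverse ..
      finally show ?thesis unfolding lead .
    qed
    show "kappa0 F \<ge> 2 * real CARD('d) * K2 \<and>
      (\<forall>x. set_integrable lborel torus (sol_integrand F g x)) \<and>
      (\<forall>x. conv (\<lambda>y. complex_of_real (F y)) (sol F g) x = complex_of_real (g x)) \<and>
      (\<forall>x. norm (sol F g x - complex_of_real
              (a_const CARD('d) * (\<Sum>\<^sub>\<infinity>y. g y) /
                 (kappa0 F * xnorm x powr (real CARD('d) - 2))))
           \<le> C / xnorm x powr (real CARD('d) - 2 + s))"
      using kappa0_ge est sol_representation(1,3)[OF d gs] by (auto simp: integrable_torus_iff)
  qed
qed

end
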